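(* Let $N\ge3$, let $\Omega\subseteq\mathbb{R}^N$ be a bounded, connected, open Lipschitz set, $x_0\in\Omega$, and let $\lambda_n(\Omega)$ be an eigenvalue of the Neumann problem $-\Delta\varphi+\varphi=\lambda\varphi$ in $\Omega$, $\partial_{\boldsymbol\nu}\varphi=0$ on $\partial\Omega$, with eigenspace $E(\lambda_n(\Omega))$. For $\varphi,\psi\in E(\lambda_n(\Omega))$ let $$\mathcal L_{x_0,B_1}(\varphi,\psi)=\int_{\mathbb{R}^N\setminus B_1}\nabla U_{B_1,\nabla\varphi(x_0)\cdot\boldsymbol\nu}\cdot\nabla U_{B_1,\nabla\psi(x_0)\cdot\boldsymbol\nu}\,dx+|B_1|\Big(\nabla\varphi(x_0)\cdot\nabla\psi(x_0)-(\lambda_n(\Omega)-1)\varphi(x_0)\psi(x_0)\Big).$$ Then, for every $\varphi,\psi\in E(\lambda_n(\Omega))$, $$\mathcal L_{x_0,B_1}(\varphi,\psi)=\omega_N\left(\frac{N}{N-1}\nabla\varphi(x_0)\cdot\nabla\psi(x_0)-(\lambda_n(\Omega)-1)\varphi(x_0)\psi(x_0)\right),$$ where $\omega_N=|B_1|$.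
   Context: $B_1=\{x\in\mathbb{R}^N:|x|<1\}$ and $|B_1|$ is its Lebesgue measure. Eigenfunctions are in the weak sense in $H^1(\Omega)$ and are smooth in the interior of $\Omega$. The space $\mathcal D^{1,2}(\mathbb{R}^N\setminus B_1)$ is the completion of $C_c^\infty(\mathbb{R}^N\setminus B_1)$ with respect to the norm $\big(\int_{\mathbb{R}^N\setminus B_1}|\nabla u|^2dx\big)^{1/2}$; here $\mathbb{R}^N\setminus B_1$ is closed, so functions need not vanish on $\partial B_1$. For $f\in L^2(\partial B_1)$, $U_{B_1,f}\in\mathcal D^{1,2}(\mathbb{R}^N\setminus B_1)$ is the unique minimizer of $u\mapsto\frac12\int_{\mathbb{R}^N\setminus B_1}|\nabla u|^2dx-\int_{\partial B_1}fu\,dS$; equivalently, the unique weak solution in this space of $-\Delta U=0$ in $\mathbb{R}^N\setminus\overline{B_1}$, $\partial_{\boldsymbol\nu}U=f$ on $\partial B_1$, where $\boldsymbol\nu$ on $\partial B_1$ is the unit normal pointing outward from $\mathbb{R}^N\setminus\overline{B_1}$ (into $B_1$). *)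

theory Defs
  imports "HOL-Analysis.Analysis"
begin

section \<open>Classical gradients and smooth functions\<close>

definition gradient :: "('a::euclidean_space \<Rightarrow> real) \<Rightarrow> 'a \<Rightarrow> 'a" where
  "gradient f x = (THE D. GDERIV f x :> D)"

text \<open>\<open>C\<^sup>k\<close> and \<open>C\<^sup>\<infinity>\<close> on a set \<open>S\<close> that is meant to be open.\<close>

primrec Ck_on :: "nat \<Rightarrow> 'a::euclidean_space set \<Rightarrow> ('a \<Rightarrow> real) \<Rightarrow> bool" where
  "Ck_on 0 S f \<longleftrightarrow> continuous_on S f"
| "Ck_on (Suc k) S f \<longleftrightarrow>
     (\<forall>x\<in>S. f differentiable (at x)) \<and> (\<forall>b\<in>Basis. Ck_on k S (\<lambda>x. gradient f x \<bullet> b))"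

definition smooth_on :: "'a::euclidean_space set \<Rightarrow> ('a \<Rightarrow> real) \<Rightarrow> bool" where
  "smooth_on S f \<longleftrightarrow> (\<forall>k. Ck_on k S f)"

text \<open>\<open>C\<^sub>c\<^sup>\<infinity>(S)\<close> for open \<open>S\<close>, extended by zero to the whole space.\<close>

definition test_functions :: "'a::euclidean_space set \<Rightarrow> ('a \<Rightarrow> real) set" where
  "test_functions S =
     {\<phi>. smooth_on UNIV \<phi> \<and> compact (closure {x. \<phi> x \<noteq> 0}) \<and> closure {x. \<phi> x \<noteq> 0} \<subseteq> S}"

section \<open>Weak gradients and the Neumann problem\<close>

definition locally_integrable_on ::
    "'a::euclidean_space set \<Rightarrow> ('a \<Rightarrow> 'b::euclidean_space) \<Rightarrow> bool" where
  "locally_integrable_on S f \<longleftrightarrow> (\<forall>K. compact K \<and> K \<subseteq> S \<longrightarrow> integrable (lebesgue_on K) f)"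

definition has_weak_gradient ::
    "'a::euclidean_space set \<Rightarrow> ('a \<Rightarrow> real) \<Rightarrow> ('a \<Rightarrow> 'a) \<Rightarrow> bool" where
  "has_weak_gradient S u G \<longleftrightarrow>
     locally_integrable_on S u \<and> locally_integrable_on S G \<and>
     (\<forall>\<phi>\<in>test_functions S.
        (\<integral>x. u x *\<^sub>R gradient \<phi> x \<partial>lebesgue_on S) = - (\<integral>x. \<phi> x *\<^sub>R G x \<partial>lebesgue_on S))"

text \<open>A weak gradient is unique up to a null set; we select a representative.\<close>

definition weak_gradient :: "'a::euclidean_space set \<Rightarrow> ('a \<Rightarrow> real) \<Rightarrow> 'a \<Rightarrow> 'a" where
  "weak_gradient S u = (SOME G. has_weak_gradient S u G)"

definition L2_on :: "'a::euclidean_space set \<Rightarrow> ('a \<Rightarrow> 'b::euclidean_space) \<Rightarrow> bool" where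
  "L2_on S f \<longleftrightarrow>
     f \<in> borel_measurable (lebesgue_on S) \<and> integrable (lebesgue_on S) (\<lambda>x. (norm (f x))\<^sup>2)"

text \<open>Sobolev and \<open>L\<^sup>2\<close> spaces are sets of functions; functions equal almost everywhere are
  not identified.\<close>

definition H1 :: "'a::euclidean_space set \<Rightarrow> ('a \<Rightarrow> real) set" where
  "H1 S = {u. L2_on S u \<and> (\<exists>G. has_weak_gradient S u G \<and> L2_on S G)}"

text \<open>Near each boundary point, the set lies strictly on one side of the graph of a Lipschitz
  function over the hyperplane orthogonal to some unit vector \<open>e\<close>.\<close>

definition lipschitz_set :: "'a::euclidean_space set \<Rightarrow> bool" where
  "lipschitz_set S \<longleftrightarrow>
     (\<forall>p\<in>frontier S. \<exists>e r C g. norm e = 1 \<and> r > 0 \<and> C-lipschitz_on {y. y \<bullet> e = 0} g \<and>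
        S \<inter> ball p r = {x \<in> ball p r. x \<bullet> e > g (x - (x \<bullet> e) *\<^sub>R e)})"

text \<open>Weak solutions in \<open>H\<^sup>1(\<Omega>)\<close> of \<open>- \<Delta>u + u = lam u\<close> with homogeneous Neumann
  condition, the latter being encoded in the use of all \<open>w \<in> H\<^sup>1(\<Omega>)\<close> for testing.\<close>

definition neumann_weak_solution ::
    "'a::euclidean_space set \<Rightarrow> real \<Rightarrow> ('a \<Rightarrow> real) \<Rightarrow> bool" where
  "neumann_weak_solution \<Omega> lam u \<longleftrightarrow> u \<in> H1 \<Omega> \<and>
     (\<forall>w\<in>H1 \<Omega>.
        (\<integral>x. weak_gradient \<Omega> u x \<bullet> weak_gradient \<Omega> w x \<partial>lebesgue_on \<Omega>)
          + (\<integral>x. u x * w x \<partial>lebesgue_on \<Omega>)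
        = lam * (\<integral>x. u x * w x \<partial>lebesgue_on \<Omega>))"

definition neumann_eigenvalue :: "'a::euclidean_space set \<Rightarrow> real \<Rightarrow> bool" where
  "neumann_eigenvalue \<Omega> lam \<longleftrightarrow>
     (\<exists>u. neumann_weak_solution \<Omega> lam u \<and> \<not> (AE x in lebesgue_on \<Omega>. u x = 0))"

text \<open>Each class of weak solutions modulo null sets contains, by interior elliptic regularity,
  exactly one function smooth in \<open>\<Omega>\<close> (up to its values outside \<open>\<Omega>\<close>). The eigenspace consists of
  these representatives, which makes point values meaningful.\<close>

definition neumann_eigenspace :: "'a::euclidean_space set \<Rightarrow> real \<Rightarrow> ('a \<Rightarrow> real) set" where
  "neumann_eigenspace \<Omega> lam = {u. neumann_weak_solution \<Omega> lam u \<and> smooth_on \<Omega> u}"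

section \<open>The exterior Neumann problem for the unit ball\<close>

text \<open>Surface measure on the unit sphere: \<open>\<sigma>(A) = N |{r \<theta> | 0 < r < 1, \<theta> \<in> A}|\<close>.
  Note that \<open>sgn x = x / |x|\<close>.\<close>

definition sphere_measure :: "'a::euclidean_space measure" where
  "sphere_measure =
     scale_measure (ennreal (real DIM('a)))
       (distr (lebesgue_on (ball 0 1 - {0})) (restrict_space borel (sphere 0 1)) sgn)"

definition sphere_normal :: "'a::euclidean_space \<Rightarrow> 'a" where
  "sphere_normal x = - x"  \<comment> \<open>outward for the exterior domain, hence pointing into the ball\<close>

abbreviation exterior :: "'a::euclidean_space set" where
  "exterior \<equiv> - ball 0 1"

text \<open>The gradient on the exterior is the weak gradient in the open set \<open>- cball 0 1\<close>; the
  sphere is a null set.\<close>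

abbreviation ext_gradient :: "('a::euclidean_space \<Rightarrow> real) \<Rightarrow> 'a \<Rightarrow> 'a" where
  "ext_gradient u \<equiv> weak_gradient (- cball 0 1) u"

text \<open>Elements of \<open>C\<^sub>c\<^sup>\<infinity>\<close> of the closed exterior are restrictions of elements of
  \<open>C\<^sub>c\<^sup>\<infinity>\<close> of the whole space, so they need not vanish on the sphere. In dimension at least 3, by
  the Sobolev and trace inequalities, a sequence of such functions that is Cauchy in the Dirichlet
  norm converges in \<open>L\<^sup>2\<close> on bounded parts of the exterior, and its restrictions to the
  sphere converge in \<open>L\<^sup>2\<close> of the sphere. The completion is thereby realised as a space of
  functions \<open>u\<close> having a weak gradient and a trace \<open>T\<close>, both of which are determined
  by \<open>u\<close> up to null sets.\<close>

definition D12_approx ::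
    "(nat \<Rightarrow> 'a::euclidean_space \<Rightarrow> real) \<Rightarrow> ('a \<Rightarrow> real) \<Rightarrow> ('a \<Rightarrow> real) \<Rightarrow> bool" where
  "D12_approx v u T \<longleftrightarrow>
     (\<forall>k. v k \<in> test_functions UNIV) \<and>
     (\<lambda>k. \<integral>\<^sup>+x. ennreal ((norm (gradient (v k) x - ext_gradient u x))\<^sup>2)
             \<partial>lebesgue_on exterior) \<longlonglongrightarrow> 0 \<and>
     (\<forall>R. (\<lambda>k. \<integral>\<^sup>+x. ennreal ((v k x - u x)\<^sup>2) \<partial>lebesgue_on (exterior \<inter> ball 0 R)) \<longlonglongrightarrow> 0) \<and>
     (\<lambda>k. \<integral>\<^sup>+x. ennreal ((v k x - T x)\<^sup>2) \<partial>sphere_measure) \<longlonglongrightarrow> 0"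

definition D12_trace :: "('a::euclidean_space \<Rightarrow> real) \<Rightarrow> ('a \<Rightarrow> real) \<Rightarrow> bool" where
  "D12_trace u T \<longleftrightarrow> T \<in> borel_measurable sphere_measure \<and> (\<exists>v. D12_approx v u T)"

definition D12 :: "('a::euclidean_space \<Rightarrow> real) set" where
  "D12 = {u. u \<in> borel_measurable (lebesgue_on exterior) \<and>
             (\<exists>G. has_weak_gradient (- cball 0 1) u G) \<and> (\<exists>T. D12_trace u T)}"

definition sphere_trace :: "('a::euclidean_space \<Rightarrow> real) \<Rightarrow> 'a \<Rightarrow> real" where
  "sphere_trace u = (SOME T. D12_trace u T)"

definition neumann_energy :: "('a::euclidean_space \<Rightarrow> real) \<Rightarrow> ('a \<Rightarrow> real) \<Rightarrow> real" where
  "neumann_energy f u =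
     1 / 2 * (\<integral>x. (norm (ext_gradient u x))\<^sup>2 \<partial>lebesgue_on exterior)
       - (\<integral>x. f x * sphere_trace u x \<partial>sphere_measure)"

text \<open>The minimiser is unique up to null sets, whence \<open>SOME\<close> rather than \<open>THE\<close>.\<close>

definition U_ball :: "('a::euclidean_space \<Rightarrow> real) \<Rightarrow> 'a \<Rightarrow> real" where
  "U_ball f = (SOME u. u \<in> D12 \<and> (\<forall>w\<in>D12. neumann_energy f u \<le> neumann_energy f w))"

definition L_form ::
    "real \<Rightarrow> 'a::euclidean_space \<Rightarrow> ('a \<Rightarrow> real) \<Rightarrow> ('a \<Rightarrow> real) \<Rightarrow> real" where
  "L_form lam x\<^sub>0 \<phi> \<psi> =
     (\<integral>x. ext_gradient (U_ball (\<lambda>y. gradient \<phi> x\<^sub>0 \<bullet> sphere_normal y)) x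
          \<bullet> ext_gradient (U_ball (\<lambda>y. gradient \<psi> x\<^sub>0 \<bullet> sphere_normal y)) x
        \<partial>lebesgue_on exterior)
     + measure lebesgue (ball (0::'a) 1)
         * (gradient \<phi> x\<^sub>0 \<bullet> gradient \<psi> x\<^sub>0 - (lam - 1) * \<phi> x\<^sub>0 * \<psi> x\<^sub>0)"

end

theory Submission
  imports Defs
begin

text \<open>The minimiser for the datum \<open>a \<bullet> \<nu>\<close> is the dipole potential
  \<open>U(x) = - (a \<bullet> x) / ((N - 1) |x|\<^sup>N)\<close>. It is harmonic off the origin and
  \<open>\<partial>U/\<partial>\<nu> = a \<bullet> \<nu>\<close> on the sphere, so the divergence theorem gives
  \<open>\<integral> \<nabla>U \<bullet> \<nabla>v = \<integral> (a \<bullet> \<nu>) v d\<sigma>\<close> for test functions \<open>v\<close>, and by density for all \<open>v\<close> in the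
  energy space. Completing the square, the energy of \<open>w\<close> exceeds that of \<open>U\<close> by
  \<open>1/2 \<integral> |\<nabla>w - \<nabla>U|\<^sup>2\<close>, so every minimiser has the gradient of \<open>U\<close> almost everywhere. Testing
  one dipole with another reduces the Dirichlet integral to
  \<open>1/(N - 1) \<integral> (a \<bullet> y) (b \<bullet> y) d\<sigma> = |B| (a \<bullet> b) / (N - 1)\<close>.\<close>

subsection \<open>Calculus of \<open>C\<^sup>k\<close> functions\<close>

text \<open>The datum is a spherical harmonic of degree 1. Its decaying harmonic extension is a
  multiple of \<open>(a \<bullet> x) / |x|^N\<close>, whose radial derivative on the unit sphere is
  \<open>1 - N\<close> times its value; hence the factor \<open>1 / (N - 1)\<close>. Surface measure
  is given through volumes of cones, so boundary integrals have to be extracted from volume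
  integrals. The exterior is cut off by a piecewise linear function of \<open>|x|\<close>, whose
  gradient lives on a thin shell, and dilation invariance identifies the limit of the shell
  averages. This is why integrals of gradients are shown to vanish for Lipschitz functions and not
  only for smooth ones. Weak gradient, trace and minimiser are arbitrary choices. Gradients are
  pinned down almost everywhere by the fundamental lemma of the calculus of variations, and Green's
  formula is proved for every admissible trace, so it covers the chosen one. Membership of
  \<open>U\<close> in the energy space rests on truncations at large radius: their gradients differ
  from that of \<open>U\<close> by at most a fixed multiple of \<open>|x|^(-N)\<close>, which is
  square integrable over the exterior.\<close>

lemma GDERIV_unique:
  assumes "GDERIV f x :> D" "GDERIV f x :> D'"
  shows "D = D'"
proof -
  have "(\<lambda>h. inner h D) = (\<lambda>h. inner h D')"
    using assms unfolding gderiv_def by (rule has_derivative_unique)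
  then have "inner (D - D') D = inner (D - D') D'"
    by (rule fun_cong)
  then have "inner (D - D') (D - D') = 0"
    by (simp add: inner_diff_right)
  then show ?thesis by simp
qed

lemma gradient_eqI: "GDERIV f x :> D \<Longrightarrow> gradient f x = D"
  unfolding gradient_def by (rule the_equality) (auto intro: GDERIV_unique)

lemma GDERIV_gradient:
  fixes f :: "'a::euclidean_space \<Rightarrow> real"
  assumes "f differentiable (at x)"
  shows "GDERIV f x :> gradient f x"
proof -
  obtain f' where f': "(f has_derivative f') (at x)"
    using assms by (auto simp: differentiable_def)
  interpret linear f'
    using f' has_derivative_linear by blast
  \<comment> \<open>The Riesz vector of the functional \<open>f'\<close>, read off from its values
    on the basis.\<close>
  define D where "D = (\<Sum>b\<in>Basis. f' b *\<^sub>R b)"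
  have "f' h = inner h D" for h
  proof -
    have "f' h = f' (\<Sum>b\<in>Basis. (h \<bullet> b) *\<^sub>R b)"
      by (simp add: euclidean_representation)
    also have "\<dots> = inner h D"
      by (simp add: D_def inner_sum_right sum scale mult.commute)
    finally show ?thesis .
  qed
  then have "f' = (\<lambda>h. inner h D)" by auto
  then have "GDERIV f x :> D"
    using f' by (simp add: gderiv_def)
  then show ?thesis using gradient_eqI by metis
qed

lemma GDERIV_imp_differentiable: "GDERIV f x :> D \<Longrightarrow> f differentiable (at x)"
  by (auto simp: gderiv_def differentiable_def)

lemma GDERIV_transform_open:
  assumes "GDERIV f x :> D" "open S" "x \<in> S" "\<And>y. y \<in> S \<Longrightarrow> f y = g y"
  shows "GDERIV g x :> D"
  using assms(1) unfolding gderiv_def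
  by (rule has_derivative_transform_within_open[OF _ assms(2,3)]) (rule assms(4))

lemma gradient_cong_open:
  fixes f :: "'a::euclidean_space \<Rightarrow> real"
  assumes "open S" "x \<in> S" "\<And>y. y \<in> S \<Longrightarrow> f y = g y"
  shows "gradient f x = gradient g x"
proof -
  have "GDERIV f x :> D \<longleftrightarrow> GDERIV g x :> D" for D
    using GDERIV_transform_open[of f x D S g] GDERIV_transform_open[of g x D S f] assms by auto
  then show ?thesis by (simp add: gradient_def)
qed

text \<open>Every closure rule below computes a gradient only at points of \<open>S\<close>. This
  congruence carries the explicit formula back into the recursive definition, where
  \<open>gradient\<close> is applied to the whole function.\<close>

lemma Ck_on_cong_open:
  assumes "open S" "\<And>y. y \<in> S \<Longrightarrow> f y = g y" "Ck_on k S f"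
  shows "Ck_on k S g"
  using assms(2,3)
proof (induction k arbitrary: f g)
  case 0
  then show ?case using continuous_on_cong[of S S f g] by simp
next
  case (Suc k)
  have "g differentiable (at x)" if "x \<in> S" for x
  proof (rule GDERIV_imp_differentiable[OF GDERIV_transform_open[OF GDERIV_gradient assms(1) that]])
    show "f differentiable (at x)" using Suc.prems(2) that by simp
  qed (rule Suc.prems(1))
  moreover have "Ck_on k S (\<lambda>x. gradient g x \<bullet> b)" if "b \<in> Basis" for b
  proof (rule Suc.IH)
    show "Ck_on k S (\<lambda>x. gradient f x \<bullet> b)" using Suc.prems(2) that by simp
    show "gradient f y \<bullet> b = gradient g y \<bullet> b" if "y \<in> S" for y
      using gradient_cong_open[OF assms(1) that Suc.prems(1)] by simp
  qed
  ultimately show ?case by (simp only: Ck_on.simps) blast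
qed

lemma Ck_on_SucD: "Ck_on (Suc k) S f \<Longrightarrow> Ck_on k S f"
proof (induction k arbitrary: f)
  case 0
  then show ?case
    by (simp add: differentiable_imp_continuous_on differentiable_at_imp_differentiable_on)
next
  case (Suc k)
  then show ?case by (simp only: Ck_on.simps) blast
qed

lemma Ck_on_Un:
  assumes "open S" "open T"
  shows "Ck_on k S f \<Longrightarrow> Ck_on k T f \<Longrightarrow> Ck_on k (S \<union> T) f"
  using assms
proof (induction k arbitrary: f)
  case 0
  then show ?case by (simp add: continuous_on_open_Un)
next
  case (Suc k)
  then show ?case by (simp only: Ck_on.simps) blast
qed

lemma Ck_on_const: "open S \<Longrightarrow> Ck_on k S (\<lambda>x. c)"
proof (induction k arbitrary: c)
  case (Suc k)
  have "gradient (\<lambda>x. c) x = 0" for x :: 'a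
    by (rule gradient_eqI) (rule GDERIV_const)
  then show ?case using Suc by simp
qed simp

lemma Ck_on_inner:
  assumes "open S" shows "Ck_on k S (\<lambda>x. x \<bullet> a)"
proof (cases k)
  case (Suc j)
  have G: "GDERIV (\<lambda>x. x \<bullet> a) x :> a" for x
    unfolding gderiv_def by (auto intro!: derivative_eq_intros)
  then have "gradient (\<lambda>x. x \<bullet> a) x = a" for x
    by (rule gradient_eqI)
  moreover have "(\<lambda>x. x \<bullet> a) differentiable (at x)" for x
    using G by (rule GDERIV_imp_differentiable)
  ultimately show ?thesis using Suc assms by (simp add: Ck_on_const)
qed (simp add: continuous_on_inner continuous_on_id continuous_on_const)

lemma Ck_on_add:
  assumes "open S"
  shows "Ck_on k S f \<Longrightarrow> Ck_on k S g \<Longrightarrow> Ck_on k S (\<lambda>x. f x + g x)"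
proof (induction k arbitrary: f g)
  case 0
  then show ?case by (simp add: continuous_on_add continuous_on_mult)
next
  case (Suc k)
  have D: "GDERIV (\<lambda>x. f x + g x) x :> gradient f x + gradient g x" if "x \<in> S" for x
    using that Suc.prems by (auto intro: GDERIV_add[OF GDERIV_gradient GDERIV_gradient])
  have "Ck_on k S (\<lambda>x. gradient (\<lambda>x. f x + g x) x \<bullet> b)" if "b \<in> Basis" for b
  proof (rule Ck_on_cong_open[OF assms])
    show "Ck_on k S (\<lambda>x. gradient f x \<bullet> b + gradient g x \<bullet> b)"
      by (rule Suc.IH) (use that Suc.prems in simp_all)
  qed (simp add: gradient_eqI[OF D] inner_add_left)
  then show ?case using GDERIV_imp_differentiable[OF D] by (simp only: Ck_on.simps) blast
qed

lemma Ck_on_mult: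
  assumes "open S"
  shows "Ck_on k S f \<Longrightarrow> Ck_on k S g \<Longrightarrow> Ck_on k S (\<lambda>x. f x * g x)"
proof (induction k arbitrary: f g)
  case 0
  then show ?case by (simp add: continuous_on_add continuous_on_mult)
next
  case (Suc k)
  have D: "GDERIV (\<lambda>x. f x * g x) x :> f x *\<^sub>R gradient g x + g x *\<^sub>R gradient f x"
    if "x \<in> S" for x
    using that Suc.prems by (auto intro: GDERIV_mult[OF GDERIV_gradient GDERIV_gradient])
  have "Ck_on k S (\<lambda>x. gradient (\<lambda>x. f x * g x) x \<bullet> b)" if "b \<in> Basis" for b
  proof (rule Ck_on_cong_open[OF assms])
    show "Ck_on k S (\<lambda>x. f x * (gradient g x \<bullet> b) + g x * (gradient f x \<bullet> b))"
      \<comment> \<open>The product rule also contains the undifferentiated factors; these have one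
        order of smoothness to spare, which \<open>Ck_on_SucD\<close> gives away to match the
        induction hypothesis.\<close>
      using that Suc.prems
      by (intro Ck_on_add[OF assms, of k "\<lambda>x. f x * (gradient g x \<bullet> b)"] Suc.IH[of f]
          Suc.IH[of g] Suc.prems[THEN Ck_on_SucD]) simp_all
  qed (simp add: gradient_eqI[OF D] inner_add_left)
  then show ?case using GDERIV_imp_differentiable[OF D] by (simp only: Ck_on.simps) blast
qed

text \<open>The chain rule produces \<open>gradient h\<close> composed with the same inner function,
  so the induction generalises over the outer function only.\<close>

lemma Ck_on_compose:
  assumes "open S" "open T" and "\<And>x. x \<in> S \<Longrightarrow> f x \<in> T"
  shows "Ck_on k T h \<Longrightarrow> Ck_on k S f \<Longrightarrow> Ck_on k S (\<lambda>x. h (f x))"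
proof (induction k arbitrary: h)
  case 0
  then show ?case
    using assms(3) by (auto intro: continuous_on_compose2)
next
  case (Suc k)
  have H: "(h has_real_derivative gradient h (f x)) (at (f x))" if "x \<in> S" for x
    using that Suc.prems(1) assms(3) GDERIV_gradient[of h "f x"] by simp
  have D: "GDERIV (\<lambda>x. h (f x)) x :> gradient h (f x) *\<^sub>R gradient f x" if "x \<in> S" for x
    using GDERIV_DERIV_compose[of f x "gradient f x" h "gradient h (f x)"]
      GDERIV_gradient[of f x] H[OF that] Suc.prems(2) that by simp
  \<comment> \<open>The basis of the real line is \<open>{1}\<close>, so the single component of the
    gradient is the derivative itself.\<close>
  have h: "Ck_on k T (gradient h)"
    using Suc.prems(1) by simp
  have "Ck_on k S (\<lambda>x. gradient (\<lambda>x. h (f x)) x \<bullet> b)" if "b \<in> Basis" for b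
  proof (rule Ck_on_cong_open[OF assms(1)])
    show "Ck_on k S (\<lambda>x. gradient h (f x) * (gradient f x \<bullet> b))"
    proof (rule Ck_on_mult[OF assms(1) Suc.IH[OF h Ck_on_SucD[OF Suc.prems(2)]]])
      show "Ck_on k S (\<lambda>x. gradient f x \<bullet> b)" using Suc.prems(2) that by simp
    qed
  qed (simp add: gradient_eqI[OF D])
  then show ?case using GDERIV_imp_differentiable[OF D] by (simp only: Ck_on.simps) blast
qed

lemma Ck_on_real_Suc:
  fixes f f' :: "real \<Rightarrow> real"
  assumes "open S" "\<And>x. x \<in> S \<Longrightarrow> (f has_real_derivative f' x) (at x)" "Ck_on k S f'"
  shows "Ck_on (Suc k) S f"
proof -
  have "gradient f x = f' x" if "x \<in> S" for x
    by (rule gradient_eqI) (use assms(2) that in simp)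
  moreover have "f differentiable (at x)" if "x \<in> S" for x
    by (rule GDERIV_imp_differentiable[of _ _ "f' x"]) (use assms(2) that in simp)
  ultimately show ?thesis
    using Ck_on_cong_open[OF assms(1) _ assms(3), of "gradient f"] by simp
qed

lemma smooth_on_cong_open:
  "open S \<Longrightarrow> (\<And>y. y \<in> S \<Longrightarrow> f y = g y) \<Longrightarrow> smooth_on S f \<Longrightarrow> smooth_on S g"
  unfolding smooth_on_def using Ck_on_cong_open by blast

lemma smooth_on_Un:
  "open S \<Longrightarrow> open T \<Longrightarrow> smooth_on S f \<Longrightarrow> smooth_on T f \<Longrightarrow> smooth_on (S \<union> T) f"
  by (simp add: smooth_on_def Ck_on_Un)

lemma smooth_on_const: "open S \<Longrightarrow> smooth_on S (\<lambda>x. c)"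
  by (simp add: smooth_on_def Ck_on_const)

lemma smooth_on_inner: "open S \<Longrightarrow> smooth_on S (\<lambda>x. x \<bullet> a)"
  by (simp add: smooth_on_def Ck_on_inner)

lemma smooth_on_add:
  "open S \<Longrightarrow> smooth_on S f \<Longrightarrow> smooth_on S g \<Longrightarrow> smooth_on S (\<lambda>x. f x + g x)"
  by (simp add: smooth_on_def Ck_on_add)

lemma smooth_on_mult:
  "open S \<Longrightarrow> smooth_on S f \<Longrightarrow> smooth_on S g \<Longrightarrow> smooth_on S (\<lambda>x. f x * g x)"
  by (simp add: smooth_on_def Ck_on_mult)

lemma smooth_on_diff:
  assumes "open S" "smooth_on S f" "smooth_on S g" shows "smooth_on S (\<lambda>x. f x - g x)"
  using smooth_on_add[OF assms(1,2) smooth_on_mult[OF assms(1) smooth_on_const[OF assms(1), of "-1"] assms(3)]]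
  by simp

lemma smooth_on_sum:
  "open S \<Longrightarrow> (\<And>i. i \<in> I \<Longrightarrow> smooth_on S (f i)) \<Longrightarrow> smooth_on S (\<lambda>x. \<Sum>i\<in>I. f i x)"
  by (induction I rule: infinite_finite_induct) (auto intro: smooth_on_const smooth_on_add)

lemma smooth_on_prod:
  "open S \<Longrightarrow> (\<And>i. i \<in> I \<Longrightarrow> smooth_on S (f i)) \<Longrightarrow> smooth_on S (\<lambda>x. \<Prod>i\<in>I. f i x)"
  by (induction I rule: infinite_finite_induct) (auto intro: smooth_on_const smooth_on_mult)

lemma smooth_on_compose:
  "open S \<Longrightarrow> open T \<Longrightarrow> (\<And>x. x \<in> S \<Longrightarrow> f x \<in> T) \<Longrightarrow> smooth_on T h \<Longrightarrow> smooth_on S f \<Longrightarrow>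
    smooth_on S (\<lambda>x. h (f x))"
  by (simp add: smooth_on_def Ck_on_compose)

lemma smooth_on_inner_self:
  assumes "open S" shows "smooth_on S (\<lambda>x. x \<bullet> x)"
  by (subst euclidean_inner) (intro smooth_on_sum smooth_on_mult smooth_on_inner assms)

lemma smooth_on_gradient:
  "smooth_on S f \<Longrightarrow> b \<in> Basis \<Longrightarrow> smooth_on S (\<lambda>x. gradient f x \<bullet> b)"
  by (metis smooth_on_def Ck_on.simps(2))

lemma smooth_on_GDERIV: "smooth_on S f \<Longrightarrow> x \<in> S \<Longrightarrow> GDERIV f x :> gradient f x"
  by (metis smooth_on_def Ck_on.simps(2) GDERIV_gradient)

lemma smooth_on_continuous: "smooth_on S f \<Longrightarrow> continuous_on S f"
  by (metis smooth_on_def Ck_on.simps(1))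

lemma smooth_on_continuous_gradient: "smooth_on S f \<Longrightarrow> continuous_on S (gradient f)"
  by (subst continuous_on_componentwise) (auto intro: smooth_on_continuous smooth_on_gradient)

lemma smooth_on_powr: "smooth_on {0<..} (\<lambda>s::real. s powr p)"
proof -
  have "Ck_on k {0<..} (\<lambda>s::real. s powr p)" for k
  proof (induction k arbitrary: p)
    case 0
    then show ?case by (auto intro!: continuous_intros)
  next
    case (Suc k)
    show ?case
    proof (rule Ck_on_real_Suc)
      show "((\<lambda>s. s powr p) has_real_derivative p * s powr (p - 1)) (at s)"
        if "s \<in> {0<..}" for s
        using that by (intro has_real_derivative_powr) simp
      show "Ck_on k {0<..} (\<lambda>s. p * s powr (p - 1))"
        by (rule Ck_on_mult[OF _ Ck_on_const Suc]) simp_all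
    qed simp
  qed
  then show ?thesis by (simp add: smooth_on_def)
qed

lemma smooth_on_inverse: "smooth_on {0<..} (inverse :: real \<Rightarrow> real)"
  by (rule smooth_on_cong_open[OF _ _ smooth_on_powr[of "-1"]]) (auto simp: powr_minus)


subsection \<open>Cut-off functions\<close>

text \<open>All derivatives of \<open>exp (- 1 / t)\<close> are linear combinations of these functions.\<close>

definition flat :: "nat \<Rightarrow> real \<Rightarrow> real" where
  "flat n t = (if t > 0 then exp (- inverse t) * inverse t ^ n else 0)"

text \<open>With \<open>y = inverse t\<close> this is the decay of \<open>y ^ n / exp y\<close> at
  infinity.\<close>

lemma flat_tendsto_0: "(flat n \<longlongrightarrow> 0) (at_right 0)"
proof -
  have "((\<lambda>y. y ^ n / exp y) \<longlongrightarrow> 0) (at_top :: real filter)"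
    by (rule tendsto_power_div_exp_0)
  then have "((\<lambda>t. inverse t ^ n / exp (inverse t)) \<longlongrightarrow> 0) (at_right (0::real))"
    by (rule filterlim_compose[OF _ filterlim_inverse_at_top_right])
  moreover have "\<forall>\<^sub>F t in at_right 0. inverse t ^ n / exp (inverse t) = flat n t"
    by (auto simp: eventually_at_filter flat_def exp_minus field_simps)
  ultimately show ?thesis by (rule Lim_transform_eventually)
qed

lemma flat_has_derivative:
  "(flat n has_real_derivative flat (n + 2) t - n * flat (n + 1) t) (at t)"
proof -
  consider "t > 0" | "t < 0" | "t = 0" by linarith
  then show ?thesis
  proof cases
    case 1
    have inv: "(inverse has_real_derivative - (inverse t ^ 2)) (at t)"
      using DERIV_inverse[of t UNIV] 1 by (simp add: numeral_2_eq_2)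
    have pow: "((\<lambda>t. inverse t ^ n) has_real_derivative - (n * inverse t ^ (n + 1))) (at t)"
    proof (cases n)
      case (Suc m)
      show ?thesis
        using DERIV_power[OF inv, of n] unfolding Suc
        by (simp add: power2_eq_square mult_ac)
    qed simp
    have "((\<lambda>t. exp (- inverse t)) has_real_derivative exp (- inverse t) * inverse t ^ 2) (at t)"
      using DERIV_fun_exp[OF DERIV_minus[OF inv]] by simp
    from DERIV_mult[OF this pow]
    have "((\<lambda>t. exp (- inverse t) * inverse t ^ n) has_real_derivative
        flat (n + 2) t - n * flat (n + 1) t) (at t)"
      by (rule DERIV_cong) (use 1 in \<open>simp add: flat_def power_add power2_eq_square algebra_simps\<close>)
    then show ?thesis
      by (rule has_field_derivative_transform_within_open[of _ _ _ "{0<..}"])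
         (use 1 in \<open>auto simp: flat_def\<close>)
  next
    case 2
    have "((\<lambda>t. 0) has_real_derivative flat (n + 2) t - n * flat (n + 1) t) (at t)"
      using 2 by (auto simp: flat_def)
    then show ?thesis
      by (rule has_field_derivative_transform_within_open[of _ _ _ "{..<0}"])
         (use 2 in \<open>auto simp: flat_def\<close>)
  next
    case 3
    \<comment> \<open>To the right of 0 the difference quotient is exactly
      \<open>flat (n + 1)\<close>, to the left it is zero; both limits are therefore known.\<close>
    have "((\<lambda>s. (flat n s - flat n 0) / (s - 0)) \<longlongrightarrow> 0) (at 0)"
    proof (rule filterlim_split_at)
      have "\<forall>\<^sub>F s in at_left 0. 0 = (flat n s - flat n 0) / (s - 0)"
        by (auto simp: eventually_at_filter flat_def)
      then show "((\<lambda>s. (flat n s - flat n 0) / (s - 0)) \<longlongrightarrow> 0) (at_left 0)"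
        by (rule Lim_transform_eventually[OF tendsto_const])
      have "\<forall>\<^sub>F s in at_right 0. flat (n + 1) s = (flat n s - flat n 0) / (s - 0)"
        by (auto simp: eventually_at_filter flat_def field_simps)
      then show "((\<lambda>s. (flat n s - flat n 0) / (s - 0)) \<longlongrightarrow> 0) (at_right 0)"
        by (rule Lim_transform_eventually[OF flat_tendsto_0])
    qed
    then show ?thesis using 3 by (simp add: has_field_derivative_iff flat_def)
  qed
qed

lemma smooth_flat: "smooth_on UNIV (flat n)"
proof -
  have "Ck_on k UNIV (flat n)" for k
  proof (induction k arbitrary: n)
    case 0
    then show ?case
      using DERIV_isCont[OF flat_has_derivative] by (simp add: continuous_at_imp_continuous_on)
  next
    case (Suc k)
    have "Ck_on k UNIV (\<lambda>t. flat (n + 2) t + (- real n) * flat (n + 1) t)"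
      by (intro Ck_on_add Ck_on_mult Ck_on_const Suc open_UNIV)
    then show ?case
      by (intro Ck_on_real_Suc[OF _ flat_has_derivative]) auto
  qed
  then show ?thesis by (simp add: smooth_on_def)
qed

text \<open>The usual smooth transition from 0 on \<open>t \<le> 0\<close> to 1 on
  \<open>t \<ge> 1\<close>. The denominator never vanishes because \<open>t\<close> and
  \<open>1 - t\<close> cannot both be nonpositive.\<close>

definition step :: "real \<Rightarrow> real" where
  "step t = flat 0 t * inverse (flat 0 t + flat 0 (1 - t))"

lemma flat_nonneg: "flat n t \<ge> 0"
  by (simp add: flat_def)

lemma flat_denom_pos: "flat 0 t + flat 0 (1 - t) > 0"
  by (auto simp: flat_def intro: add_pos_pos)

lemma step_nonneg: "0 \<le> step t" and step_le_1: "step t \<le> 1"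
  using flat_denom_pos[of t] flat_nonneg[of 0 t] flat_nonneg[of 0 "1 - t"]
  by (auto simp: step_def field_simps)

lemma step_eq_0: "t \<le> 0 \<Longrightarrow> step t = 0"
  by (simp add: step_def flat_def)

lemma step_eq_1: "t \<ge> 1 \<Longrightarrow> step t = 1"
  by (simp add: step_def flat_def)

lemma smooth_step: "smooth_on UNIV step"
proof -
  have "smooth_on UNIV (\<lambda>t::real. 1 - t)"
    using smooth_on_diff[OF _ smooth_on_const smooth_on_inner, of UNIV 1 "1::real"] by simp
  then have "smooth_on UNIV (\<lambda>t. flat 0 (1 - t))"
    by (intro smooth_on_compose[OF _ open_UNIV _ smooth_flat]) auto
  then have "smooth_on UNIV (\<lambda>t. inverse (flat 0 t + flat 0 (1 - t)))"
    using flat_denom_pos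
    by (intro smooth_on_compose[OF _ _ _ smooth_on_inverse] smooth_on_add smooth_flat) auto
  then have "smooth_on UNIV (\<lambda>t. flat 0 t * inverse (flat 0 t + flat 0 (1 - t)))"
    by (intro smooth_on_mult smooth_flat open_UNIV)
  then show ?thesis by (simp add: step_def[abs_def])
qed

subsection \<open>Test functions\<close>

lemma test_functionsI:
  assumes "smooth_on UNIV f" "compact K" "K \<subseteq> S" "\<And>x. x \<notin> K \<Longrightarrow> f x = 0"
  shows "f \<in> test_functions S"
proof -
  have *: "closure {x. f x \<noteq> 0} \<subseteq> K"
    using assms(2,4) by (intro closure_minimal compact_imp_closed) auto
  then have "compact (closure {x. f x \<noteq> 0})"
    using compact_Int_closed[OF assms(2), of "closure {x. f x \<noteq> 0}"] by (simp add: Int_absorb1)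
  then show ?thesis
    using assms * by (auto simp: test_functions_def)
qed

lemma test_functionsE:
  assumes "f \<in> test_functions S"
  obtains K where "smooth_on UNIV f" "compact K" "K \<subseteq> S" "\<And>x. x \<notin> K \<Longrightarrow> f x = 0"
    "\<And>x. x \<notin> K \<Longrightarrow> gradient f x = 0"
proof -
  define K where "K = closure {x. f x \<noteq> 0}"
  have out: "f x = 0" if "x \<notin> K" for x
    using contra_subsetD[OF closure_subset that[unfolded K_def]] by simp
  have K: "smooth_on UNIV f" "compact K" "K \<subseteq> S" "open (- K)"
    using assms by (auto simp: test_functions_def K_def open_Compl)
  have "gradient f x = 0" if "x \<notin> K" for x
  proof -
    have "gradient f x = gradient (\<lambda>x. 0) x"
      by (rule gradient_cong_open[OF K(4)]) (use that out in auto)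
    also have "\<dots> = 0"
      by (rule gradient_eqI) (rule GDERIV_const)
    finally show ?thesis .
  qed
  with out K show ?thesis by (intro that[of K])
qed

lemma test_functions_mono: "S \<subseteq> T \<Longrightarrow> test_functions S \<subseteq> test_functions T"
  by (auto simp: test_functions_def)

lemma test_functions_mult:
  assumes "smooth_on UNIV u" "f \<in> test_functions S"
  shows "(\<lambda>x. u x * f x) \<in> test_functions S"
proof -
  obtain K where "smooth_on UNIV f" "compact K" "K \<subseteq> S" "\<And>x. x \<notin> K \<Longrightarrow> f x = 0"
    using assms(2) by (rule test_functionsE) blast
  then show ?thesis
    using assms(1) by (intro test_functionsI[of _ K] smooth_on_mult) auto
qed

lemma gradient_mult:
  assumes "smooth_on UNIV f" "smooth_on UNIV g"
  shows "gradient (\<lambda>x. f x * g x) x = f x *\<^sub>R gradient g x + g x *\<^sub>R gradient f x"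
  by (intro gradient_eqI GDERIV_mult smooth_on_GDERIV[OF assms(1)] smooth_on_GDERIV[OF assms(2)]) auto

section \<open>Integrals of compactly supported gradients and integration by parts\<close>

lemma integrable_continuous_compact_support:
  fixes f :: "'a::euclidean_space \<Rightarrow> 'b::euclidean_space"
  assumes "continuous_on UNIV f" "compact K" "\<And>x. x \<notin> K \<Longrightarrow> f x = 0"
  shows "integrable lebesgue f"
proof -
  have "integrable lborel (\<lambda>x. indicator K x *\<^sub>R f x)"
    using assms continuous_on_subset by (intro borel_integrable_compact) blast+
  also have "(\<lambda>x. indicator K x *\<^sub>R f x) = f"
    using assms(3) by (auto simp: indicator_def fun_eq_iff)
  finally have "integrable lborel f" .
  moreover have "f \<in> borel_measurable lborel"
    using assms(1) by (simp add: borel_measurable_continuous_onI)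
  ultimately show ?thesis
    by (simp add: integrable_completion)
qed

lemma lebesgue_integral_translation:
  fixes f :: "'a::euclidean_space \<Rightarrow> real"
  assumes "f \<in> borel_measurable borel"
  shows "(\<integral>x. f (x + t) \<partial>lebesgue) = (\<integral>x. f x \<partial>lebesgue)"
proof -
  have *: "(\<lambda>x. f (x + t)) \<in> borel_measurable lborel"
    using assms by measurable
  have "(\<integral>x. f x \<partial>lebesgue) = (\<integral>x. f x \<partial>distr lborel borel ((+) t))"
    using assms by (simp add: integral_completion lborel_distr_plus)
  also have "\<dots> = (\<integral>x. f (x + t) \<partial>lborel)"
    using assms by (subst integral_distr) (auto simp: add.commute)
  also have "\<dots> = (\<integral>x. f (x + t) \<partial>lebesgue)"
    using * by (rule integral_completion[symmetric])
  finally show ?thesis by (rule sym)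
qed

lemma GDERIV_imp_DERIV_line:
  assumes "GDERIV g x :> D"
  shows "((\<lambda>t. g (x + t *\<^sub>R e)) has_real_derivative D \<bullet> e) (at 0)"
proof -
  have "((\<lambda>t. x + t *\<^sub>R e) has_derivative (\<lambda>t. t *\<^sub>R e)) (at (0::real))"
    by (auto intro!: derivative_eq_intros)
  moreover have "(g has_derivative (\<lambda>h. h \<bullet> D)) (at (x + 0 *\<^sub>R e))"
    using assms by (simp add: gderiv_def)
  ultimately have "((\<lambda>t. g (x + t *\<^sub>R e)) has_derivative (\<lambda>t. (t *\<^sub>R e) \<bullet> D)) (at 0)"
    by (rule has_derivative_compose)
  moreover have "(\<lambda>t. (t *\<^sub>R e) \<bullet> D) = (*) (D \<bullet> e)"
    by (simp add: fun_eq_iff inner_commute)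
  ultimately show ?thesis
    by (simp add: has_field_derivative_def)
qed

text \<open>Translation invariance makes the integral of every difference quotient vanish.\<close>

lemma integral_gradient_lipschitz_eq_0:
  fixes g :: "'a::euclidean_space \<Rightarrow> real"
  assumes lip: "L-lipschitz_on UNIV g" and K: "bounded K" "\<And>x. x \<notin> K \<Longrightarrow> g x = 0"
    and D: "AE x in lebesgue. GDERIV g x :> D x"
    and meas: "(\<lambda>x. D x \<bullet> e) \<in> borel_measurable lebesgue"
  shows "(\<integral>x. D x \<bullet> e \<partial>lebesgue) = 0"
proof -
  obtain R where R: "\<And>x. x \<in> K \<Longrightarrow> norm x \<le> R"
    using K(1) by (auto simp: bounded_iff)
  \<comment> \<open>Since \<open>h n \<le> 1\<close>, a segment from \<open>x\<close> to
    \<open>x + h n *\<^sub>R e\<close> that meets the support at an endpoint starts in this ball.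
    One integrable majorant thus serves all difference quotients.\<close>
  define B where "B = cball (0::'a) (R + norm e)"
  define h where "h = (\<lambda>n. inverse (real (Suc n)))"
  define q where "q = (\<lambda>n x. (g (x + h n *\<^sub>R e) - g x) / h n)"
  have h: "h n > 0" "h n \<le> 1" for n
    by (auto simp: h_def inverse_eq_divide)
  have cont: "continuous_on UNIV g"
    using lip by (rule lipschitz_on_continuous_on)
  then have gm[measurable]: "g \<in> borel_measurable borel"
    by (rule borel_measurable_continuous_onI)
  have int_g: "integrable lebesgue g"
  proof (rule integrable_continuous_compact_support[OF cont])
    show "compact (cball (0::'a) R)" by simp
    show "g x = 0" if "x \<notin> cball 0 R" for x
      using that K(2) R by auto
  qed
  have int_gt: "integrable lebesgue (\<lambda>x. g (x + t *\<^sub>R e))" for t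
  proof (rule integrable_continuous_compact_support)
    show "continuous_on UNIV (\<lambda>x. g (x + t *\<^sub>R e))"
      by (intro continuous_on_compose2[OF cont] continuous_intros) auto
    show "compact (cball (- (t *\<^sub>R e)) R)" by simp
    show "g (x + t *\<^sub>R e) = 0" if "x \<notin> cball (- (t *\<^sub>R e)) R" for x
    proof (rule K(2), rule notI)
      assume "x + t *\<^sub>R e \<in> K"
      from R[OF this] that show False
        by (simp add: dist_norm norm_minus_commute add.commute)
    qed
  qed
  have q_0: "(\<integral>x. q n x \<partial>lebesgue) = 0" for n
    using int_g int_gt lebesgue_integral_translation[OF gm, of "h n *\<^sub>R e"]
    by (simp add: q_def)
  have "(\<lambda>n. \<integral>x. q n x \<partial>lebesgue) \<longlonglongrightarrow> (\<integral>x. D x \<bullet> e \<partial>lebesgue)"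
  proof (rule integral_dominated_convergence)
    show "integrable lebesgue (\<lambda>x. indicator B x * (L * norm e))"
      using emeasure_lborel_cball_finite[of 0 "R + norm e"]
      by (intro integrable_mult_left) (simp add: B_def integrable_indicator_iff)
    show "q n \<in> borel_measurable lebesgue" for n
      unfolding q_def using int_g int_gt by (auto intro!: borel_measurable_divide borel_measurable_diff)
    show "AE x in lebesgue. (\<lambda>n. q n x) \<longlonglongrightarrow> D x \<bullet> e"
      using D
    proof eventually_elim
      case (elim x)
      then have lim: "((\<lambda>t. (g (x + t *\<^sub>R e) - g x) / t) \<longlongrightarrow> D x \<bullet> e) (at 0)"
        using GDERIV_imp_DERIV_line[of g x "D x" e] by (simp add: DERIV_def)
      have "filterlim h (at 0) sequentially"
        using LIMSEQ_inverse_real_of_nat by (simp add: filterlim_at h_def)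
      from filterlim_compose[OF lim this] show ?case
        by (simp add: q_def)
    qed
    show "AE x in lebesgue. norm (q n x) \<le> indicator B x * (L * norm e)" for n
    proof (rule AE_I2)
      fix x :: 'a
      show "norm (q n x) \<le> indicator B x * (L * norm e)"
      proof (cases "x \<in> B")
        case True
        have "\<bar>g (x + h n *\<^sub>R e) - g x\<bar> \<le> L * norm (h n *\<^sub>R e)"
          using lipschitz_onD[OF lip, of "x + h n *\<^sub>R e" x] by (simp add: dist_norm)
        then show ?thesis using True h[of n]
          by (simp add: q_def field_simps)
      next
        case False
        have "x \<notin> K" using False R[of x] norm_ge_zero[of e] by (auto simp: B_def)
        moreover have "x + h n *\<^sub>R e \<notin> K"
        proof
          assume "x + h n *\<^sub>R e \<in> K"
          then have "norm (x + h n *\<^sub>R e) \<le> R" by (rule R)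
          moreover have "norm (h n *\<^sub>R e) \<le> norm e"
            using h[of n] by (simp add: mult_left_le_one_le)
          moreover have "norm x \<le> norm (x + h n *\<^sub>R e) + norm (h n *\<^sub>R e)"
            by (metis add_diff_cancel_right' norm_triangle_ineq4)
          ultimately show False using False by (simp add: B_def)
        qed
        ultimately show ?thesis using False K(2) by (simp add: q_def)
      qed
    qed
  qed (rule meas)
  then show ?thesis
    by (simp add: q_0 LIMSEQ_const_iff)
qed

lemma test_function_lipschitz:
  assumes "g \<in> test_functions S"
  obtains L where "L-lipschitz_on UNIV g"
proof -
  obtain K where g: "smooth_on UNIV g" "compact K" "\<And>x. x \<notin> K \<Longrightarrow> gradient g x = 0"
    using assms by (rule test_functionsE) blast
  have "compact (gradient g ` K)"
    using g smooth_on_continuous_gradient continuous_on_subset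
    by (intro compact_continuous_image) blast+
  then obtain C where C: "\<And>x. x \<in> K \<Longrightarrow> norm (gradient g x) \<le> C"
    using compact_imp_bounded[of "gradient g ` K"] by (auto simp: bounded_iff)
  have "(max 0 C)-lipschitz_on UNIV g"
  proof (rule bounded_derivative_imp_lipschitz)
    show "(g has_derivative (\<lambda>h. h \<bullet> gradient g x)) (at x within UNIV)" for x
      using smooth_on_GDERIV[OF g(1), of x] by (simp add: gderiv_def)
    show "onorm (\<lambda>h. h \<bullet> gradient g x) \<le> max 0 C" for x
    proof (rule onorm_bound)
      fix h :: 'a
      have "norm (gradient g x) \<le> max 0 C"
        using C[of x] g(3)[of x] by (cases "x \<in> K") auto
      then have "norm h * norm (gradient g x) \<le> norm h * max 0 C"
        by (intro mult_left_mono) auto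
      then show "norm (h \<bullet> gradient g x) \<le> max 0 C * norm h"
        using Cauchy_Schwarz_ineq2[of h "gradient g x"] by (simp add: mult.commute)
    qed simp
  qed auto
  then show thesis by (rule that)
qed

lemma integral_gradient_test_function:
  fixes g :: "'a::euclidean_space \<Rightarrow> real"
  assumes "g \<in> test_functions UNIV"
  shows "(\<integral>x. gradient g x \<bullet> e \<partial>lebesgue) = 0"
proof -
  obtain K where K: "smooth_on UNIV g" "compact K" "\<And>x. x \<notin> K \<Longrightarrow> g x = 0"
    using assms by (rule test_functionsE) blast
  obtain L where "L-lipschitz_on UNIV g"
    using assms by (rule test_function_lipschitz)
  then show ?thesis
  proof (rule integral_gradient_lipschitz_eq_0)
    show "AE x in lebesgue. GDERIV g x :> gradient g x"
      using smooth_on_GDERIV[OF K(1)] by simp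
    have "continuous_on UNIV (\<lambda>x. gradient g x \<bullet> e)"
      by (intro continuous_on_inner smooth_on_continuous_gradient K(1) continuous_on_const)
    then show "(\<lambda>x. gradient g x \<bullet> e) \<in> borel_measurable lebesgue"
      by (simp add: borel_measurable_continuous_onI measurable_completion)
  qed (fact compact_imp_bounded[OF K(2)], fact K(3))
qed

lemma integrable_lebesgue_on_compact:
  fixes f :: "'a::euclidean_space \<Rightarrow> 'b::euclidean_space"
  assumes "continuous_on K f" "compact K"
  shows "integrable (lebesgue_on K) f"
proof -
  have "(\<lambda>x. indicator K x *\<^sub>R f x) \<in> borel_measurable borel"
    using assms by (simp add: borel_measurable_continuous_on_indicator borel_compact)
  then have "integrable lebesgue (\<lambda>x. indicator K x *\<^sub>R f x)"
    using borel_integrable_compact[OF assms(2,1)] by (simp add: integrable_completion)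
  then show ?thesis
    using assms(2) by (subst integrable_restrict_space) (auto simp: fmeasurableD lmeasurable_compact)
qed

lemma locally_integrable_on_continuous:
  "continuous_on UNIV f \<Longrightarrow> locally_integrable_on S f"
  unfolding locally_integrable_on_def
  using integrable_lebesgue_on_compact continuous_on_subset by blast

text \<open>Integration by parts without a boundary: \<open>u * \<phi>\<close> is again a test
  function, so the integral of its gradient over the whole space is zero, and the product rule
  splits it into the two sides.\<close>

lemma smooth_has_weak_gradient:
  fixes u :: "'a::euclidean_space \<Rightarrow> real"
  assumes u: "smooth_on UNIV u" and S: "open S"
  shows "has_weak_gradient S u (gradient u)"
proof -
  have "(\<integral>x. u x *\<^sub>R gradient \<phi> x \<partial>lebesgue_on S) = - (\<integral>x. \<phi> x *\<^sub>R gradient u x \<partial>lebesgue_on S)"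
    if "\<phi> \<in> test_functions S" for \<phi>
  proof -
    obtain K where K: "smooth_on UNIV \<phi>" "compact K" "K \<subseteq> S" "\<And>x. x \<notin> K \<Longrightarrow> \<phi> x = 0"
        "\<And>x. x \<notin> K \<Longrightarrow> gradient \<phi> x = 0"
      using \<open>\<phi> \<in> test_functions S\<close> by (rule test_functionsE) blast
    have S_int: "(\<integral>x. f x \<partial>lebesgue_on S) = (\<integral>x. f x \<partial>lebesgue)"
      if "\<And>x. x \<notin> K \<Longrightarrow> f x = 0" for f :: "'a \<Rightarrow> 'a"
    proof -
      have "(\<integral>x. f x \<partial>lebesgue_on S) = (\<integral>x. indicator S x *\<^sub>R f x \<partial>lebesgue)"
        using S by (intro integral_restrict_space) auto
      also have "(\<lambda>x. indicator S x *\<^sub>R f x) = f"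
        using that K(3) by (force simp: indicator_def fun_eq_iff)
      finally show ?thesis .
    qed
    have cont: "continuous_on UNIV u" "continuous_on UNIV \<phi>" "continuous_on UNIV (gradient u)"
        "continuous_on UNIV (gradient \<phi>)"
      using u K(1) by (auto intro: smooth_on_continuous smooth_on_continuous_gradient)
    have int: "integrable lebesgue (\<lambda>x. u x *\<^sub>R gradient \<phi> x)"
        "integrable lebesgue (\<lambda>x. \<phi> x *\<^sub>R gradient u x)"
      by (rule integrable_continuous_compact_support[OF _ K(2)];
          auto intro!: continuous_on_scaleR cont simp: K)+
    have "(\<integral>x. u x *\<^sub>R gradient \<phi> x \<partial>lebesgue) = - (\<integral>x. \<phi> x *\<^sub>R gradient u x \<partial>lebesgue)"
    proof (rule euclidean_eqI)
      fix b :: 'a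
      have "(\<lambda>x. u x * \<phi> x) \<in> test_functions UNIV"
        using test_functions_mult[OF u that] test_functions_mono by blast
      from integral_gradient_test_function[OF this, of b]
      have "(\<integral>x. (u x *\<^sub>R gradient \<phi> x + \<phi> x *\<^sub>R gradient u x) \<bullet> b \<partial>lebesgue) = 0"
        by (simp add: gradient_mult u K(1))
      then have "(\<integral>x. (u x *\<^sub>R gradient \<phi> x + \<phi> x *\<^sub>R gradient u x) \<partial>lebesgue) \<bullet> b = 0"
        using int by (subst (asm) integral_inner_left) auto
      then show "(\<integral>x. u x *\<^sub>R gradient \<phi> x \<partial>lebesgue) \<bullet> b = - (\<integral>x. \<phi> x *\<^sub>R gradient u x \<partial>lebesgue) \<bullet> b"
        using int by (simp add: inner_add_left)
    qed
    then show ?thesis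
      using K by (subst (1 2) S_int) auto
  qed
  then show ?thesis
    using u by (auto simp: has_weak_gradient_def intro!: locally_integrable_on_continuous smooth_on_continuous
        smooth_on_continuous_gradient)
qed

subsection \<open>Uniqueness of weak gradients\<close>

text \<open>One smooth factor for each face of the box. The functions vanish off the box, stay
  between 0 and 1 and converge pointwise to its indicator, so testing against them recovers
  integrals over boxes.\<close>

definition box_cutoff :: "nat \<Rightarrow> 'a::euclidean_space \<Rightarrow> 'a \<Rightarrow> 'a \<Rightarrow> real" where
  "box_cutoff n l u x =
     (\<Prod>b\<in>Basis. step (real n * (x \<bullet> b - l \<bullet> b)) * step (real n * (u \<bullet> b - x \<bullet> b)))"

lemma smooth_box_cutoff: "smooth_on UNIV (box_cutoff n l u :: 'a::euclidean_space \<Rightarrow> real)"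
proof -
  have 1: "smooth_on UNIV (\<lambda>x::'a. real n * (x \<bullet> b - l \<bullet> b))" for b
    by (rule smooth_on_mult[OF _ smooth_on_const smooth_on_diff[OF _ smooth_on_inner smooth_on_const]])
       simp_all
  have 2: "smooth_on UNIV (\<lambda>x::'a. real n * (u \<bullet> b - x \<bullet> b))" for b
    by (rule smooth_on_mult[OF _ smooth_on_const smooth_on_diff[OF _ smooth_on_const smooth_on_inner]])
       simp_all
  have "smooth_on UNIV (\<lambda>x::'a. \<Prod>b\<in>Basis. step (real n * (x \<bullet> b - l \<bullet> b)) *
      step (real n * (u \<bullet> b - x \<bullet> b)))"
    by (rule smooth_on_prod, simp, rule smooth_on_mult;
        (rule smooth_on_compose[OF _ _ _ smooth_step 1] smooth_on_compose[OF _ _ _ smooth_step 2])?)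
       simp_all
  then show ?thesis by (simp add: box_cutoff_def[abs_def])
qed

lemma box_cutoff_bounds: "0 \<le> box_cutoff n l u x" "box_cutoff n l u x \<le> 1"
  unfolding box_cutoff_def
  by (auto intro!: prod_nonneg prod_le_1 mult_le_one mult_nonneg_nonneg step_nonneg step_le_1)

lemma box_cutoff_eq_0:
  assumes "x \<notin> box l u" shows "box_cutoff n l u x = 0"
proof -
  obtain b where b: "b \<in> Basis" "x \<bullet> b \<le> l \<bullet> b \<or> u \<bullet> b \<le> x \<bullet> b"
    using assms by (auto simp: mem_box not_less)
  then have "step (real n * (x \<bullet> b - l \<bullet> b)) * step (real n * (u \<bullet> b - x \<bullet> b)) = 0"
    by (auto simp: mult_nonneg_nonpos step_eq_0)
  then show ?thesis
    unfolding box_cutoff_def using b(1) by (intro prod_zero) auto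
qed

lemma box_cutoff_tendsto: "(\<lambda>n. box_cutoff n l u x) \<longlonglongrightarrow> indicator (box l u) x"
proof (cases "x \<in> box l u")
  case False
  then show ?thesis by (simp add: box_cutoff_eq_0)
next
  case True
  have ev: "\<forall>\<^sub>F n in sequentially. step (real n * d) = 1" if "d > 0" for d
  proof -
    obtain m where m: "1 < real m * d"
      using reals_Archimedean3[OF \<open>d > 0\<close>] by blast
    have "step (real n * d) = 1" if "n \<ge> m" for n
    proof (rule step_eq_1)
      have "real m * d \<le> real n * d"
        using that \<open>d > 0\<close> by simp
      with m show "1 \<le> real n * d" by simp
    qed
    then show ?thesis by (auto simp: eventually_sequentially)
  qed
  have "\<forall>\<^sub>F n in sequentially. \<forall>b\<in>Basis. step (real n * (x \<bullet> b - l \<bullet> b)) = 1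
      \<and> step (real n * (u \<bullet> b - x \<bullet> b)) = 1"
    using True by (intro eventually_ball_finite ballI eventually_conj ev) (auto simp: mem_box)
  then have "\<forall>\<^sub>F n in sequentially. 1 = box_cutoff n l u x"
    by eventually_elim (simp add: box_cutoff_def)
  from Lim_transform_eventually[OF tendsto_const this] True show ?thesis by simp
qed

lemma integral_lebesgue_on_support:
  fixes f :: "'a::euclidean_space \<Rightarrow> 'b::euclidean_space"
  assumes "K \<subseteq> S" "K \<in> sets lebesgue" "S \<in> sets lebesgue" "\<And>x. x \<in> S - K \<Longrightarrow> f x = 0"
  shows "(\<integral>x. f x \<partial>lebesgue_on S) = (\<integral>x. f x \<partial>lebesgue_on K)"
proof -
  have "(\<lambda>x. indicator S x *\<^sub>R f x) = (\<lambda>x. indicator K x *\<^sub>R f x)"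
    using assms(1,4) by (force simp: indicator_def fun_eq_iff)
  then show ?thesis
    using assms(2,3) by (simp add: integral_restrict_space)
qed

text \<open>Dominated convergence along the box cut-offs. The majorant \<open>norm (G x)\<close> is
  available because local integrability covers the compact box.\<close>

lemma integral_cbox_eq_0_of_test_functions:
  fixes G :: "'a::euclidean_space \<Rightarrow> 'b::euclidean_space"
  assumes S: "open S" and G: "locally_integrable_on S G"
    and orth: "\<And>\<phi>. \<phi> \<in> test_functions S \<Longrightarrow> (\<integral>x. \<phi> x *\<^sub>R G x \<partial>lebesgue_on S) = 0"
    and sub: "cbox l u \<subseteq> S"
  shows "integral (cbox l u) G = 0"
proof -
  let ?M = "lebesgue_on (cbox l u)"
  have int: "integrable ?M G"
    using G sub by (auto simp: locally_integrable_on_def)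
  have lim: "(\<lambda>n. \<integral>x. box_cutoff n l u x *\<^sub>R G x \<partial>?M) \<longlonglongrightarrow> (\<integral>x. indicator (box l u) x *\<^sub>R G x \<partial>?M)"
    and lim_int: "integrable ?M (\<lambda>x. indicator (box l u) x *\<^sub>R G x :: 'b)"
  proof -
    have bm: "box_cutoff n l u \<in> borel_measurable ?M" for n
      using smooth_on_continuous[OF smooth_box_cutoff[of n l u]]
      by (intro measurable_restrict_space1 measurable_completion) (simp add: borel_measurable_continuous_onI)
    have im: "(indicator (box l u) :: 'a \<Rightarrow> real) \<in> borel_measurable ?M"
      by (intro measurable_restrict_space1 measurable_completion) simp
    have m1: "(\<lambda>x. box_cutoff n l u x *\<^sub>R G x) \<in> borel_measurable ?M" for n
      using bm int by (intro borel_measurable_scaleR) auto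
    have m2: "(\<lambda>x. indicator (box l u) x *\<^sub>R G x) \<in> borel_measurable ?M"
      using im int by (intro borel_measurable_scaleR) auto
    have c: "AE x in ?M. (\<lambda>n. box_cutoff n l u x *\<^sub>R G x) \<longlonglongrightarrow> indicator (box l u) x *\<^sub>R G x"
      by (intro AE_I2 tendsto_scaleR box_cutoff_tendsto tendsto_const)
    have b: "AE x in ?M. norm (box_cutoff n l u x *\<^sub>R G x) \<le> norm (G x)" for n
      using box_cutoff_bounds[of n l u] by (intro AE_I2) (simp add: mult_left_le_one_le)
    show "(\<lambda>n. \<integral>x. box_cutoff n l u x *\<^sub>R G x \<partial>?M) \<longlonglongrightarrow> (\<integral>x. indicator (box l u) x *\<^sub>R G x \<partial>?M)"
      by (rule integral_dominated_convergence[OF m2 m1 integrable_norm[OF int] c b])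
    show "integrable ?M (\<lambda>x. indicator (box l u) x *\<^sub>R G x :: 'b)"
      by (rule integrable_dominated_convergence[OF m2 m1 integrable_norm[OF int] c b])
  qed
  have "(\<integral>x. box_cutoff n l u x *\<^sub>R G x \<partial>?M) = 0" for n
  proof -
    have 0: "box_cutoff n l u x = 0" if "x \<notin> cbox l u" for x
      using that box_subset_cbox by (intro box_cutoff_eq_0) blast
    then have "box_cutoff n l u \<in> test_functions S"
      by (intro test_functionsI[OF smooth_box_cutoff _ sub]) auto
    from orth[OF this] show ?thesis
      using sub S 0 by (subst (asm) integral_lebesgue_on_support[of "cbox l u"]) auto
  qed
  with lim have "(\<integral>x. indicator (box l u) x *\<^sub>R G x \<partial>?M) = 0"
    by (simp add: LIMSEQ_const_iff)
  \<comment> \<open>The change to gauge integrals prepares the differentiation theorem used next;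
    passing from the open to the closed box costs only the negligible boundary.\<close>
  then have "integral (cbox l u) (\<lambda>x. indicator (box l u) x *\<^sub>R G x) = 0"
    using lim_int by (simp add: lebesgue_integral_eq_integral)
  moreover have "integral (cbox l u) G = integral (cbox l u) (\<lambda>x. indicator (box l u) x *\<^sub>R G x)"
    by (rule integral_spike[OF negligible_frontier_interval[of l u]]) simp
  ultimately show ?thesis by (simp only:)
qed

text \<open>The cubes with lower corner \<open>x\<close> are those over which the differentiation
  theorem takes averages; the l1 norm bounds their size.\<close>

lemma cube_subset_ball:
  assumes "0 < h" "h * real DIM('a::euclidean_space) < r"
  shows "cbox x (x + h *\<^sub>R One) \<subseteq> ball (x::'a) r"
proof
  fix y assume y: "y \<in> cbox x (x + h *\<^sub>R One)"
  have "norm (y - x) \<le> (\<Sum>b\<in>Basis. \<bar>(y - x) \<bullet> b\<bar>)"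
    by (rule norm_le_l1)
  also have "\<dots> \<le> (\<Sum>b\<in>(Basis::'a set). h)"
    using y by (intro sum_mono) (auto simp: mem_box inner_diff_left inner_add_left)
  also have "\<dots> < r"
    using assms(2) by (simp add: mult.commute)
  finally show "y \<in> ball x r" by (simp add: dist_norm norm_minus_commute)
qed

text \<open>Lebesgue differentiation: at almost every point \<open>G x\<close> is the limit of
  averages over small cubes, and all these averages are zero.\<close>

lemma AE_zero_of_integral_cbox_eq_0:
  fixes G :: "'a::euclidean_space \<Rightarrow> 'b::euclidean_space"
  assumes int: "integrable (lebesgue_on (cbox c d)) G"
    and zero: "\<And>l u. cbox l u \<subseteq> cbox c d \<Longrightarrow> integral (cbox l u) G = 0"
  shows "AE x in lebesgue. x \<in> cbox c d \<longrightarrow> G x = 0"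
proof -
  define f where "f = (\<lambda>x. if x \<in> cbox c d then G x else 0)"
  have "f integrable_on UNIV"
    using integrable_on_lebesgue_on[OF int] by (simp add: f_def integrable_restrict_UNIV)
  then have "f integrable_on cbox a b" for a b
    by (rule integrable_on_subcbox) simp
  then obtain N where N: "negligible N" and
    lim: "\<And>x e. \<lbrakk>x \<notin> N; 0 < e\<rbrakk> \<Longrightarrow> \<exists>\<delta>>0. \<forall>h. 0 < h \<and> h < \<delta> \<longrightarrow>
            norm (integral (cbox x (x + h *\<^sub>R One)) f /\<^sub>R h ^ DIM('a) - f x) < e"
    by (rule integrable_ccontinuous_explicit) blast
  have "G x = 0" if x: "x \<in> box c d" "x \<notin> N" for x
  proof (rule ccontr)
    assume "G x \<noteq> 0"
    obtain r where r: "r > 0" "ball x r \<subseteq> box c d"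
      using x(1) open_box by (meson open_contains_ball)
    obtain \<delta> where \<delta>: "\<delta> > 0" "\<And>h. 0 < h \<Longrightarrow> h < \<delta> \<Longrightarrow>
        norm (integral (cbox x (x + h *\<^sub>R One)) f /\<^sub>R h ^ DIM('a) - f x) < norm (G x)"
      using lim[OF x(2), of "norm (G x)"] \<open>G x \<noteq> 0\<close> by auto
    \<comment> \<open>Half of \<open>\<delta>\<close> makes \<open>h < \<delta>\<close> strict, and
      \<open>r / (2 * N)\<close> keeps the l1 size \<open>h * N\<close> of the cube below
      \<open>r\<close>.\<close>
    define h where "h = min (\<delta> / 2) (r / (2 * real DIM('a)))"
    have D: "real DIM('a) > 0" by simp
    have h: "0 < h" "h < \<delta>" "h \<le> r / (2 * real DIM('a))"
      using r(1) \<delta>(1) D by (auto simp: h_def)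
    from h(3) D have "h * real DIM('a) \<le> r / 2" by (simp add: field_simps)
    with r(1) have "h * real DIM('a) < r" by linarith
    then have sub: "cbox x (x + h *\<^sub>R One) \<subseteq> cbox c d"
      using cube_subset_ball[OF h(1), of r x] r(2) box_subset_cbox[of c d] by blast
    have "integral (cbox x (x + h *\<^sub>R One)) f = integral (cbox x (x + h *\<^sub>R One)) G"
      using sub by (intro integral_cong) (auto simp: f_def)
    also have "\<dots> = 0" by (rule zero[OF sub])
    finally have "norm (f x) < norm (G x)"
      using \<delta>(2)[OF h(1,2)] by simp
    then show False using x(1) box_subset_cbox by (auto simp: f_def split: if_splits)
  qed
  then have "x \<in> N \<union> (cbox c d - box c d)" if "\<not> (x \<in> cbox c d \<longrightarrow> G x = 0)" for x
    using that by blast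
  moreover have "N \<union> (cbox c d - box c d) \<in> null_sets lebesgue"
    using N negligible_frontier_interval by (simp add: negligible_iff_null_sets[symmetric] negligible_Un)
  ultimately show ?thesis
    by (intro AE_I'[of "N \<union> (cbox c d - box c d)"]) auto
qed

text \<open>The fundamental lemma of the calculus of variations. An open set is a countable union of
  closed boxes, and on each of them \<open>G\<close> is integrable, so the statement for one box
  suffices.\<close>

lemma AE_zero_of_test_functions:
  fixes G :: "'a::euclidean_space \<Rightarrow> 'b::euclidean_space"
  assumes S: "open S" and G: "locally_integrable_on S G"
    and orth: "\<And>\<phi>. \<phi> \<in> test_functions S \<Longrightarrow> (\<integral>x. \<phi> x *\<^sub>R G x \<partial>lebesgue_on S) = 0"
  shows "AE x in lebesgue_on S. G x = 0"
proof -
  obtain \<D> where \<D>: "countable \<D>" "\<D> \<subseteq> Pow S" "\<And>X. X \<in> \<D> \<Longrightarrow> \<exists>a b. X = cbox a b" "\<Union>\<D> = S"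
    using open_countable_Union_open_cbox[OF S] by metis
  have "AE x in lebesgue. x \<in> X \<longrightarrow> G x = 0" if X: "X \<in> \<D>" for X
  proof -
    obtain a b where ab: "X = cbox a b" using \<D>(3)[OF X] by blast
    have sub: "cbox a b \<subseteq> S" using \<D>(2) X ab by blast
    show ?thesis
      unfolding ab
    proof (rule AE_zero_of_integral_cbox_eq_0)
      show "integrable (lebesgue_on (cbox a b)) G"
        using G sub by (simp add: locally_integrable_on_def)
      show "integral (cbox l u) G = 0" if "cbox l u \<subseteq> cbox a b" for l u
        using integral_cbox_eq_0_of_test_functions[OF S G orth] that sub by blast
    qed
  qed
  then have "AE x in lebesgue. \<forall>X\<in>\<D>. x \<in> X \<longrightarrow> G x = 0"
    by (rule AE_ball_countable'[OF _ \<D>(1)])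
  then have "AE x in lebesgue. x \<in> S \<longrightarrow> G x = 0"
    by eventually_elim (use \<D>(4) in blast)
  then show ?thesis
    using S by (simp add: AE_restrict_space_iff)
qed

text \<open>Allows the integral of a difference of two weak gradients against a test function to be
  split. Integrability is checked on the compact support, where \<open>\<phi>\<close> is
  bounded.\<close>

lemma locally_integrable_on_scaleR_test:
  assumes "locally_integrable_on S G" "open S" "\<phi> \<in> test_functions S"
  shows "integrable (lebesgue_on S) (\<lambda>x. \<phi> x *\<^sub>R G x)"
proof -
  obtain K where K: "smooth_on UNIV \<phi>" "compact K" "K \<subseteq> S" "\<And>x. x \<notin> K \<Longrightarrow> \<phi> x = 0"
    using assms(3) by (rule test_functionsE) blast
  have KL: "K \<in> sets lebesgue" using K(2) by (simp add: fmeasurableD lmeasurable_compact)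
  have int: "integrable (lebesgue_on K) G"
    using assms(1) K by (simp add: locally_integrable_on_def)
  have cont: "continuous_on UNIV \<phi>" using K(1) by (rule smooth_on_continuous)
  have "compact (\<phi> ` K)"
    using cont K(2) by (intro compact_continuous_image continuous_on_subset[OF cont]) auto
  then obtain C where C: "\<And>x. x \<in> K \<Longrightarrow> \<bar>\<phi> x\<bar> \<le> C"
    using compact_imp_bounded[of "\<phi> ` K"] by (auto simp: bounded_iff)
  have "integrable (lebesgue_on K) (\<lambda>x. \<phi> x *\<^sub>R G x)"
  proof (rule Bochner_Integration.integrable_bound)
    show "integrable (lebesgue_on K) (\<lambda>x. C *\<^sub>R G x)" using int by simp
    have "\<phi> \<in> borel_measurable (lebesgue_on K)"
      using cont by (intro measurable_restrict_space1 measurable_completion)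
        (simp add: borel_measurable_continuous_onI)
    then show "(\<lambda>x. \<phi> x *\<^sub>R G x) \<in> borel_measurable (lebesgue_on K)"
      using int by (intro borel_measurable_scaleR) auto
    show "AE x in lebesgue_on K. norm (\<phi> x *\<^sub>R G x) \<le> norm (C *\<^sub>R G x)"
    proof (rule AE_I2)
      fix x assume "x \<in> space (lebesgue_on K)"
      then have "\<bar>\<phi> x\<bar> \<le> \<bar>C\<bar>" using C[of x] by (auto simp: space_restrict_space)
      then show "norm (\<phi> x *\<^sub>R G x) \<le> norm (C *\<^sub>R G x)"
        by (simp add: mult_right_mono)
    qed
  qed
  then have "integrable lebesgue (\<lambda>x. indicator K x *\<^sub>R \<phi> x *\<^sub>R G x)"
    using KL by (simp add: integrable_restrict_space)
  also have "(\<lambda>x. indicator K x *\<^sub>R \<phi> x *\<^sub>R G x) = (\<lambda>x. indicator S x *\<^sub>R \<phi> x *\<^sub>R G x)"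
    using K(3,4) by (force simp: indicator_def fun_eq_iff)
  finally show ?thesis
    using assms(2) by (simp add: integrable_restrict_space)
qed

lemma has_weak_gradient_unique:
  fixes u :: "'a::euclidean_space \<Rightarrow> real"
  assumes S: "open S" and "has_weak_gradient S u G" "has_weak_gradient S u H"
  shows "AE x in lebesgue_on S. G x = H x"
proof -
  have G: "locally_integrable_on S G" and H: "locally_integrable_on S H"
    using assms by (auto simp: has_weak_gradient_def)
  have "AE x in lebesgue_on S. G x - H x = 0"
  proof (rule AE_zero_of_test_functions[OF S])
    show "locally_integrable_on S (\<lambda>x. G x - H x)"
      using G H by (auto simp: locally_integrable_on_def)
    show "(\<integral>x. \<phi> x *\<^sub>R (G x - H x) \<partial>lebesgue_on S) = 0" if "\<phi> \<in> test_functions S" for \<phi>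
    proof -
      have "(\<integral>x. \<phi> x *\<^sub>R G x \<partial>lebesgue_on S) = (\<integral>x. \<phi> x *\<^sub>R H x \<partial>lebesgue_on S)"
        using assms(2,3) that unfolding has_weak_gradient_def by (metis neg_equal_iff_equal)
      then show ?thesis
        using locally_integrable_on_scaleR_test[OF G S that] locally_integrable_on_scaleR_test[OF H S that]
        by (simp add: scaleR_diff_right)
    qed
  qed
  then show ?thesis by simp
qed

lemma has_weak_gradient_weak_gradient:
  "has_weak_gradient S u G \<Longrightarrow> has_weak_gradient S u (weak_gradient S u)"
  unfolding weak_gradient_def by (rule someI[of "has_weak_gradient S u"])

lemma weak_gradient_smooth:
  assumes "open S" "smooth_on UNIV u"
  shows "AE x in lebesgue_on S. weak_gradient S u x = gradient u x"
proof -
  have "has_weak_gradient S u (gradient u)"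
    using assms by (intro smooth_has_weak_gradient)
  then show ?thesis
    by (intro has_weak_gradient_unique[OF assms(1) has_weak_gradient_weak_gradient])
qed

subsection \<open>The divergence theorem in the exterior of the ball\<close>

lemma scale_measure_eq_density: "scale_measure r M = density M (\<lambda>_. r)"
  by (rule measure_eqI) (simp_all add: emeasure_density_const)

lemma measurable_sgn_sphere:
  "sgn \<in> measurable (lebesgue_on (ball 0 1 - {0::'a::euclidean_space}))
     (restrict_space borel (sphere 0 1))"
proof (rule measurable_restrict_space2)
  show "sgn \<in> space (lebesgue_on (ball 0 1 - {0::'a})) \<rightarrow> sphere 0 1"
    by (auto simp: norm_sgn)
  show "sgn \<in> borel_measurable (lebesgue_on (ball 0 1 - {0::'a}))"
    by (intro measurable_restrict_space1 measurable_completion) simp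
qed

lemma space_sphere_measure: "space sphere_measure = sphere (0::'a::euclidean_space) 1"
  by (simp add: sphere_measure_def space_scale_measure space_restrict_space)

lemma sets_sphere_measure: "sets sphere_measure = sets (restrict_space borel (sphere (0::'a::euclidean_space) 1))"
  by (simp add: sphere_measure_def)

lemma borel_measurable_sphere_measure_continuous:
  assumes "continuous_on UNIV (f :: 'a::euclidean_space \<Rightarrow> 'b::euclidean_space)"
  shows "f \<in> borel_measurable sphere_measure"
proof -
  have "f \<in> borel_measurable (restrict_space borel (sphere 0 1))"
    using assms by (intro measurable_restrict_space1 borel_measurable_continuous_onI)
  then show ?thesis
    by (simp cong: measurable_cong_sets add: measurable_cong_sets[OF sets_sphere_measure refl])
qed

lemma finite_measure_sphere_measure: "finite_measure (sphere_measure :: 'a::euclidean_space measure)"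
proof (rule finite_measureI)
  have "emeasure (lebesgue_on (ball 0 1 - {0::'a})) (ball 0 1 - {0}) = emeasure lebesgue (ball 0 1 - {0::'a})"
    by (intro emeasure_restrict_space) auto
  also have "\<dots> \<le> emeasure lebesgue (ball (0::'a) 1)"
    by (intro emeasure_mono) auto
  also have "\<dots> < top"
    using emeasure_lborel_ball_finite[of "0::'a" 1] by (simp add: less_top)
  finally have fin: "emeasure (lebesgue_on (ball 0 1 - {0::'a})) (ball 0 1 - {0}) < top" .
  have "emeasure (sphere_measure :: 'a measure) (space sphere_measure) =
      ennreal (real DIM('a)) * emeasure (lebesgue_on (ball 0 1 - {0::'a}))
        (sgn -` sphere 0 1 \<inter> space (lebesgue_on (ball 0 1 - {0::'a})))"
    unfolding space_sphere_measure unfolding sphere_measure_def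
    by (subst emeasure_scale_measure, subst emeasure_distr[OF measurable_sgn_sphere])
       (auto simp: sets_restrict_space)
  also have "sgn -` sphere 0 1 \<inter> space (lebesgue_on (ball 0 1 - {0::'a})) = ball 0 1 - {0}"
    by (auto simp: norm_sgn)
  finally show "emeasure (sphere_measure :: 'a measure) (space sphere_measure) \<noteq> \<infinity>"
    using fin by (auto simp: ennreal_mult_eq_top_iff)
qed

lemma integral_sphere_measure:
  fixes f :: "'a::euclidean_space \<Rightarrow> real"
  assumes "f \<in> borel_measurable sphere_measure"
  shows "(\<integral>y. f y \<partial>sphere_measure) = real DIM('a) * (\<integral>x. indicator (ball 0 1) x *\<^sub>R f (sgn x) \<partial>lebesgue)"
proof -
  let ?M = "lebesgue_on (ball 0 1 - {0::'a})"
  let ?S = "restrict_space borel (sphere (0::'a) 1)"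
  have f: "f \<in> borel_measurable ?S"
    using assms by (simp add: measurable_cong_sets[OF sets_sphere_measure refl])
  then have f': "f \<in> borel_measurable (distr ?M ?S sgn)"
    by simp
  have fs: "(\<lambda>x. f (sgn x)) \<in> borel_measurable ?M"
    using measurable_compose[OF measurable_sgn_sphere f] .
  have "(\<integral>y. f y \<partial>sphere_measure) = (\<integral>y. real DIM('a) *\<^sub>R f y \<partial>distr ?M ?S sgn)"
    unfolding sphere_measure_def scale_measure_eq_density
    by (rule integral_density[OF f']) auto
  also have "\<dots> = (\<integral>x. real DIM('a) *\<^sub>R f (sgn x) \<partial>?M)"
    using f by (intro integral_distr[OF measurable_sgn_sphere]) simp
  also have "\<dots> = real DIM('a) * (\<integral>x. f (sgn x) \<partial>?M)"
    by simp
  also have "(\<integral>x. f (sgn x) \<partial>?M) = (\<integral>x. indicator (ball 0 1 - {0}) x *\<^sub>R f (sgn x) \<partial>lebesgue)"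
    by (intro integral_restrict_space) simp
  also have "\<dots> = (\<integral>x. indicator (ball 0 1) x *\<^sub>R f (sgn x) \<partial>lebesgue)"
  proof (rule integral_cong_AE)
    have "AE x in lebesgue. x \<noteq> (0::'a)"
      by (rule AE_I'[of "{0}"]) (auto simp: null_sets_completionI)
    then show eq: "AE x in lebesgue. indicator (ball 0 1 - {0}) x *\<^sub>R f (sgn x) =
        indicator (ball 0 1) x *\<^sub>R f (sgn x)"
      by eventually_elim (simp add: indicator_def)
    show m: "(\<lambda>x. indicator (ball 0 1 - {0}) x *\<^sub>R f (sgn x)) \<in> borel_measurable lebesgue"
      using fs by (subst (asm) borel_measurable_restrict_space_iff) auto
    \<comment> \<open>Since \<open>sgn 0 = 0\<close>, restoring the origin adds exactly the value
      \<open>f 0\<close> at that point.\<close>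
    have "(\<lambda>x. indicator (ball 0 1 - {0}) x *\<^sub>R f (sgn x) + indicator {0} x *\<^sub>R f 0)
        \<in> borel_measurable lebesgue"
      by (rule borel_measurable_add[OF m borel_measurable_scaleR]) (auto intro!: borel_measurable_indicator)
    also have "(\<lambda>x. indicator (ball 0 1 - {0}) x *\<^sub>R f (sgn x) + indicator {0} x *\<^sub>R f 0) =
        (\<lambda>x::'a. indicator (ball 0 1) x *\<^sub>R f (sgn x))"
      by (auto simp: fun_eq_iff indicator_def)
    finally show "(\<lambda>x. indicator (ball 0 1) x *\<^sub>R f (sgn x)) \<in> borel_measurable lebesgue" .
  qed
  finally show ?thesis .
qed

text \<open>A positive dilation leaves \<open>sgn x\<close> unchanged, so only the Jacobian
  \<open>R ^ DIM('a)\<close> appears.\<close>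

lemma integral_ball_sgn_scale:
  fixes k :: "'a::euclidean_space \<Rightarrow> real"
  assumes k[measurable]: "k \<in> borel_measurable borel" and R: "R > 0"
  shows "(\<integral>x. indicator (ball 0 R) x *\<^sub>R k (sgn x) \<partial>lebesgue) =
    R ^ DIM('a) * (\<integral>x. indicator (ball 0 1) x *\<^sub>R k (sgn x) \<partial>lebesgue)"
proof -
  have m: "(\<lambda>x. indicator (ball 0 r) x *\<^sub>R k (sgn x)) \<in> borel_measurable borel" for r
    by (intro borel_measurable_scaleR borel_measurable_indicator measurable_compose[OF borel_measurable_sgn k]) simp
  have "(\<integral>x. indicator (ball 0 R) x *\<^sub>R k (sgn x) \<partial>lebesgue) =
      (\<integral>x. indicator (ball 0 R) x *\<^sub>R k (sgn x) \<partial>lborel)"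
    using m by (intro integral_completion) simp
  also have "\<dots> = (\<integral>x. indicator (ball 0 R) x *\<^sub>R k (sgn x)
      \<partial>density (distr lborel borel (\<lambda>x. 0 + R *\<^sub>R x)) (\<lambda>_. ennreal (\<bar>R\<bar> ^ DIM('a))))"
    using lborel_affine[of R "0::'a"] R by simp
  also have "\<dots> = (\<integral>x. (\<bar>R\<bar> ^ DIM('a)) *\<^sub>R indicator (ball 0 R) x *\<^sub>R k (sgn x)
      \<partial>distr lborel borel (\<lambda>x. 0 + R *\<^sub>R x))"
    using m by (intro integral_density) auto
  also have "\<dots> = (\<integral>x. (\<bar>R\<bar> ^ DIM('a)) *\<^sub>R indicator (ball 0 R) (0 + R *\<^sub>R x) *\<^sub>R k (sgn (0 + R *\<^sub>R x)) \<partial>lborel)"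
    using m by (intro integral_distr) auto
  also have "\<dots> = (\<integral>x. R ^ DIM('a) * (indicator (ball 0 1) x *\<^sub>R k (sgn x)) \<partial>lborel)"
    using R by (intro Bochner_Integration.integral_cong)
       (auto simp: indicator_def sgn_scaleR field_simps)
  also have "\<dots> = R ^ DIM('a) * (\<integral>x. indicator (ball 0 1) x *\<^sub>R k (sgn x) \<partial>lborel)"
    by simp
  also have "(\<integral>x. indicator (ball 0 1) x *\<^sub>R k (sgn x) \<partial>lborel) =
      (\<integral>x. indicator (ball 0 1) x *\<^sub>R k (sgn x) \<partial>lebesgue)"
    using m by (intro integral_completion[symmetric]) simp
  finally show ?thesis .
qed

section \<open>Thin shells around the unit sphere\<close>

lemma test_function_bounded:
  assumes "g \<in> test_functions S"
  obtains M where "\<And>x. \<bar>g x\<bar> \<le> M"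
proof -
  obtain K where K: "smooth_on UNIV g" "compact K" "\<And>x. x \<notin> K \<Longrightarrow> g x = 0"
    using assms by (rule test_functionsE) blast
  have "compact (g ` K)"
    using K smooth_on_continuous[OF K(1)] by (intro compact_continuous_image) (auto intro: continuous_on_subset)
  then obtain C where C: "\<And>x. x \<in> K \<Longrightarrow> \<bar>g x\<bar> \<le> C"
    using compact_imp_bounded[of "g ` K"] by (auto simp: bounded_iff)
  have "\<bar>g x\<bar> \<le> max 0 C" for x
    using C[of x] K(3)[of x] by (cases "x \<in> K") auto
  then show thesis by (rule that)
qed

text \<open>Piecewise linear in \<open>norm x\<close> on purpose: inside the shell the gradient is
  exactly \<open>sgn x / e\<close>, so integrating it yields the average over the shell with no
  profile function left to handle.\<close>

definition shell_cutoff :: "real \<Rightarrow> 'a::euclidean_space \<Rightarrow> real" where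
  "shell_cutoff e x = min 1 (max 0 ((norm x - 1) / e))"

lemma shell_cutoff_bounds: "0 \<le> shell_cutoff e x" "shell_cutoff e x \<le> 1"
  by (simp_all add: shell_cutoff_def)

lemma shell_cutoff_lipschitz:
  assumes "e > 0" shows "\<bar>shell_cutoff e x - shell_cutoff e y\<bar> \<le> dist x y / e"
proof -
  have "\<bar>shell_cutoff e x - shell_cutoff e y\<bar> \<le> \<bar>(norm x - 1) / e - (norm y - 1) / e\<bar>"
    by (auto simp: shell_cutoff_def min_def max_def)
  also have "\<dots> = \<bar>norm x - norm y\<bar> / e"
    using assms by (simp add: diff_divide_distrib[symmetric] abs_divide)
  also have "\<dots> \<le> dist x y / e"
    using assms norm_triangle_ineq3[of x y] by (simp add: divide_right_mono dist_norm)
  finally show ?thesis .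
qed

lemma shell_cutoff_mult_lipschitz:
  assumes e: "e > 0" and L: "L-lipschitz_on UNIV g" and M: "\<And>x. \<bar>g x\<bar> \<le> M"
  shows "(L + M / e)-lipschitz_on UNIV (\<lambda>x. shell_cutoff e x * g x)"
proof (rule lipschitz_onI)
  have M0: "0 \<le> M" using M[of 0] by linarith
  then show "0 \<le> L + M / e" using lipschitz_on_nonneg[OF L] e by simp
  fix x y :: 'a
  have "\<bar>shell_cutoff e x * g x - shell_cutoff e y * g y\<bar> =
      \<bar>shell_cutoff e x * (g x - g y) + (shell_cutoff e x - shell_cutoff e y) * g y\<bar>"
    by (simp add: algebra_simps)
  also have "\<dots> \<le> \<bar>shell_cutoff e x\<bar> * \<bar>g x - g y\<bar> + \<bar>shell_cutoff e x - shell_cutoff e y\<bar> * \<bar>g y\<bar>"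
    by (metis abs_mult abs_triangle_ineq)
  also have "\<dots> \<le> 1 * (L * dist x y) + (dist x y / e) * M"
    using shell_cutoff_bounds[of e x] lipschitz_onD[OF L, of x y] e M M0
    by (intro add_mono mult_mono shell_cutoff_lipschitz)
       (auto simp: dist_real_def)
  also have "\<dots> = (L + M / e) * dist x y"
    by (simp add: algebra_simps)
  finally show "dist (shell_cutoff e x * g x) (shell_cutoff e y * g y) \<le> (L + M / e) * dist x y"
    by (simp add: dist_real_def)
qed

definition shell :: "real \<Rightarrow> 'a::euclidean_space set" where
  "shell e = ball 0 (1 + e) - ball 0 1"

text \<open>Off the two bounding spheres the cut-off is differentiable, so the theorem on Lipschitz
  functions applies to its product with \<open>g\<close>.\<close>

lemma integral_shell_cutoff:
  fixes g :: "'a::euclidean_space \<Rightarrow> real"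
  assumes g: "g \<in> test_functions UNIV" and e: "e > 0"
  shows "(\<integral>x. shell_cutoff e x * (gradient g x \<bullet> v) \<partial>lebesgue) =
    - (\<integral>x. indicator (shell e) x *\<^sub>R (g x * (sgn x \<bullet> v)) \<partial>lebesgue) / e"
proof -
  obtain K where K: "smooth_on UNIV g" "compact K" "\<And>x. x \<notin> K \<Longrightarrow> g x = 0"
      "\<And>x. x \<notin> K \<Longrightarrow> gradient g x = 0"
    using g by (rule test_functionsE) blast
  obtain L where L: "L-lipschitz_on UNIV g" using g by (rule test_function_lipschitz)
  obtain M where M: "\<And>x. \<bar>g x\<bar> \<le> M" using g by (rule test_function_bounded) blast
  \<comment> \<open>The product rule; the second term is \<open>g\<close> times the gradient of the
    cut-off, which is supported in the shell.\<close>
  define D where "D x = shell_cutoff e x *\<^sub>R gradient g x + (indicator (shell e) x * g x / e) *\<^sub>R sgn x" for x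
  have cont: "continuous_on UNIV (shell_cutoff e :: 'a \<Rightarrow> real)"
    unfolding shell_cutoff_def by (intro continuous_intros) (use e in auto)
  have contg: "continuous_on UNIV g" "continuous_on UNIV (gradient g)"
    using K(1) by (auto intro: smooth_on_continuous smooth_on_continuous_gradient)
  have int1: "integrable lebesgue (\<lambda>x. shell_cutoff e x * (gradient g x \<bullet> v))"
    by (rule integrable_continuous_compact_support[OF _ K(2)])
       (auto intro!: continuous_on_mult continuous_on_inner cont contg simp: K(4))
  have int2: "integrable lebesgue (\<lambda>x. indicator (shell e) x *\<^sub>R (g x * (sgn x \<bullet> v)))"
  proof (rule Bochner_Integration.integrable_bound)
    show "integrable lebesgue (\<lambda>x. g x * norm v)"
      by (rule integrable_continuous_compact_support[OF _ K(2)])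
         (auto intro!: continuous_on_mult contg simp: K(3))
    have "g \<in> borel_measurable borel" using contg(1) by (rule borel_measurable_continuous_onI)
    then have "(\<lambda>x. indicator (shell e) x *\<^sub>R (g x * (sgn x \<bullet> v))) \<in> borel_measurable borel"
      by (intro borel_measurable_scaleR borel_measurable_indicator borel_measurable_times
          borel_measurable_inner) (auto simp: shell_def)
    then show "(\<lambda>x. indicator (shell e) x *\<^sub>R (g x * (sgn x \<bullet> v))) \<in> borel_measurable lebesgue"
      by (intro measurable_completion) simp
    show "AE x in lebesgue. norm (indicator (shell e) x *\<^sub>R (g x * (sgn x \<bullet> v))) \<le> norm (g x * norm v)"
    proof (rule AE_I2)
      fix x :: 'a
      have "\<bar>sgn x \<bullet> v\<bar> \<le> norm v"
        using Cauchy_Schwarz_ineq2[of "sgn x" v] by (auto simp: norm_sgn split: if_splits)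
      then have "\<bar>g x\<bar> * \<bar>sgn x \<bullet> v\<bar> \<le> \<bar>g x\<bar> * norm v"
        by (intro mult_left_mono) auto
      then show "norm (indicator (shell e) x *\<^sub>R (g x * (sgn x \<bullet> v))) \<le> norm (g x * norm v)"
        by (auto simp: indicator_def abs_mult)
    qed
  qed
  have "(\<integral>x. D x \<bullet> v \<partial>lebesgue) = 0"
  proof (rule integral_gradient_lipschitz_eq_0[OF shell_cutoff_mult_lipschitz[OF e L M]])
    show "bounded K" using K(2) by (rule compact_imp_bounded)
    show "shell_cutoff e x * g x = 0" if "x \<notin> K" for x
      using K(3)[OF that] by simp
    have "AE x in lebesgue. x \<notin> sphere 0 1 \<union> sphere (0::'a) (1 + e)"
      by (intro AE_not_in) (simp add: negligible_iff_null_sets[symmetric] negligible_Un negligible_sphere)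
    then show "AE x in lebesgue. GDERIV (\<lambda>x. shell_cutoff e x * g x) x :> D x"
    proof eventually_elim
      case (elim x)
      have Gg: "GDERIV g x :> gradient g x" using smooth_on_GDERIV[OF K(1)] by simp
      have "GDERIV (shell_cutoff e) x :> (indicator (shell e) x / e) *\<^sub>R sgn x"
      proof -
        consider "norm x < 1" | "1 < norm x" "norm x < 1 + e" | "norm x > 1 + e"
          using elim by fastforce
        then show ?thesis
        proof cases
          case 1
          have "GDERIV (\<lambda>x. 0) x :> 0" by (rule GDERIV_const)
          then have "GDERIV (shell_cutoff e) x :> 0"
            by (rule GDERIV_transform_open[where S = "ball 0 1"])
               (use 1 e in \<open>auto simp: shell_cutoff_def field_simps\<close>)
          then show ?thesis using 1 by (simp add: shell_def)
        next
          case 2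
          have "((\<lambda>t. (t - 1) / e) has_real_derivative 1 / e) (at (norm x))"
            using e by (auto intro!: derivative_eq_intros)
          from GDERIV_DERIV_compose[OF GDERIV_norm this]
          have "GDERIV (\<lambda>x. (norm x - 1) / e) x :> (1 / e) *\<^sub>R sgn x"
            using 2 by fastforce
          then have "GDERIV (shell_cutoff e) x :> (1 / e) *\<^sub>R sgn x"
            by (rule GDERIV_transform_open[where S = "ball 0 (1 + e) - cball 0 1"])
               (use 2 e in \<open>auto simp: shell_cutoff_def field_simps\<close>)
          then show ?thesis using 2 by (simp add: shell_def)
        next
          case 3
          have "GDERIV (\<lambda>x. 1) x :> 0" by (rule GDERIV_const)
          then have "GDERIV (shell_cutoff e) x :> 0"
            by (rule GDERIV_transform_open[where S = "- cball 0 (1 + e)"])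
               (use 3 e in \<open>auto simp: shell_cutoff_def field_simps\<close>)
          then show ?thesis using 3 by (simp add: shell_def)
        qed
      qed
      from GDERIV_mult[OF this Gg] show ?case
        by (simp add: D_def mult.commute)
    qed
    have "(\<lambda>x. shell_cutoff e x * (gradient g x \<bullet> v) + indicator (shell e) x *\<^sub>R (g x * (sgn x \<bullet> v)) / e)
        \<in> borel_measurable lebesgue"
      using int1 int2 by (intro borel_measurable_add borel_measurable_divide) auto
    then show "(\<lambda>x. D x \<bullet> v) \<in> borel_measurable lebesgue"
      by (simp add: D_def inner_add_left mult.assoc)
  qed
  moreover have "(\<lambda>x. D x \<bullet> v) = (\<lambda>x. shell_cutoff e x * (gradient g x \<bullet> v) +
      indicator (shell e) x *\<^sub>R (g x * (sgn x \<bullet> v)) / e)"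
    by (simp add: D_def inner_add_left fun_eq_iff)
  ultimately have "(\<integral>x. shell_cutoff e x * (gradient g x \<bullet> v) +
      indicator (shell e) x *\<^sub>R (g x * (sgn x \<bullet> v)) / e \<partial>lebesgue) = 0"
    by simp
  moreover have "(\<integral>x. shell_cutoff e x * (gradient g x \<bullet> v) +
      indicator (shell e) x *\<^sub>R (g x * (sgn x \<bullet> v)) / e \<partial>lebesgue) =
      (\<integral>x. shell_cutoff e x * (gradient g x \<bullet> v) \<partial>lebesgue) +
      (\<integral>x. indicator (shell e) x *\<^sub>R (g x * (sgn x \<bullet> v)) \<partial>lebesgue) / e"
    using int1 int2 by (subst Bochner_Integration.integral_add) auto
  ultimately show ?thesis by simp
qed

text \<open>The derivative of \<open>x ^ d\<close> at 1. It turns the volume growth of balls into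
  the factor \<open>DIM('a)\<close> in the definition of \<open>sphere_measure\<close>.\<close>

lemma power_difference_quotient_tendsto:
  assumes "filterlim h (at 0) F"
  shows "((\<lambda>n. ((1 + h n) ^ d - 1) / h n) \<longlongrightarrow> real d) F"
proof -
  have "((\<lambda>x. x ^ d) has_real_derivative real d) (at (1::real))"
    by (auto intro!: derivative_eq_intros)
  then have "((\<lambda>h. ((1 + h) ^ d - 1) / h) \<longlongrightarrow> real d) (at 0)"
    by (simp add: DERIV_def)
  then show ?thesis by (rule filterlim_compose[OF _ assms])
qed

text \<open>On a thin shell \<open>g x\<close> may be replaced by \<open>g (sgn x)\<close>. The new
  integrand is constant along rays, so dilation evaluates its shell integral as
  \<open>((1 + r) ^ N - 1) * J\<close> with \<open>J\<close> the integral over the unit ball, and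
  \<open>N * J\<close> is the surface integral.\<close>

lemma shell_integral_tendsto:
  fixes g :: "'a::euclidean_space \<Rightarrow> real"
  assumes g: "g \<in> test_functions UNIV"
    and h0: "\<And>n. h n > 0" and h: "h \<longlonglongrightarrow> 0"
  shows "(\<lambda>n. (\<integral>x. indicator (shell (h n)) x *\<^sub>R (g x * (sgn x \<bullet> v)) \<partial>lebesgue) / h n)
    \<longlonglongrightarrow> (\<integral>y. g y * (y \<bullet> v) \<partial>sphere_measure)"
proof -
  obtain K where K: "smooth_on UNIV g" "compact K" "\<And>x. x \<notin> K \<Longrightarrow> g x = 0"
    using g by (rule test_functionsE) blast
  obtain L where L: "L-lipschitz_on UNIV g" using g by (rule test_function_lipschitz)
  obtain M where M: "\<And>x. \<bar>g x\<bar> \<le> M" using g by (rule test_function_bounded) blast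
  have contg: "continuous_on UNIV g" using K(1) by (rule smooth_on_continuous)
  have gm: "g \<in> borel_measurable borel" using contg by (rule borel_measurable_continuous_onI)
  define k where "k y = g y * (y \<bullet> v)" for y
  define J where "J = (\<integral>x. indicator (ball 0 1) x *\<^sub>R k (sgn x) \<partial>lebesgue)"
  define w where "w = measure lebesgue (ball (0::'a) 1)"
  let ?N = "DIM('a)"
  have at0: "filterlim h (at 0) sequentially"
    using h h0 by (auto simp: filterlim_at less_imp_neq[symmetric] eventually_sequentially intro!: exI[of _ 0])
  have sv: "\<bar>sgn x \<bullet> v\<bar> \<le> norm v" for x :: 'a
    using Cauchy_Schwarz_ineq2[of "sgn x" v] by (auto simp: norm_sgn split: if_splits)
  have contk: "continuous_on UNIV k"
    unfolding k_def by (intro continuous_on_mult contg continuous_intros)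
  have km: "k \<in> borel_measurable borel"
    using contk by (rule borel_measurable_continuous_onI)
  have ks: "(\<lambda>x. k (sgn x)) \<in> borel_measurable borel"
    by (rule measurable_compose[OF borel_measurable_sgn km])
  have bnd: "integrable lebesgue (\<lambda>x. indicator A x *\<^sub>R f x)"
    if "A \<in> sets borel" "A \<subseteq> ball 0 r" "f \<in> borel_measurable borel" "\<And>x. \<bar>f x\<bar> \<le> C"
    for A :: "'a set" and f :: "'a \<Rightarrow> real" and r C
  proof (rule Bochner_Integration.integrable_bound)
    show "integrable lebesgue (\<lambda>x. indicator (ball (0::'a) r) x * C)"
      using emeasure_lborel_ball_finite[of "0::'a" r]
      by (intro integrable_mult_left) (simp add: integrable_indicator_iff)
    show "(\<lambda>x. indicator A x *\<^sub>R f x) \<in> borel_measurable lebesgue"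
      using that by (intro measurable_completion) simp
    show "AE x in lebesgue. norm (indicator A x *\<^sub>R f x) \<le> norm (indicator (ball 0 r) x * C)"
    proof (rule AE_I2)
      fix x show "norm (indicator A x *\<^sub>R f x) \<le> norm (indicator (ball 0 r) x * C)"
        using that(2) that(4)[of x] by (auto simp: indicator_def abs_mult)
    qed
  qed
  have kb: "\<bar>k (sgn x)\<bar> \<le> M * norm v" for x
    using M[of "sgn x"] sv[of x] order_trans[OF abs_ge_zero M[of 0]]
    by (auto simp: k_def abs_mult intro!: mult_mono)
  have split: "(\<lambda>x. indicator (shell r) x *\<^sub>R f x) =
      (\<lambda>x. indicator (ball 0 (1 + r)) x *\<^sub>R f x - indicator (ball 0 1) x *\<^sub>R f x)"
    if "r > 0" for r and f :: "'a \<Rightarrow> real"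
    using that by (auto simp: shell_def indicator_def fun_eq_iff)
  have A: "(\<integral>x. indicator (shell r) x *\<^sub>R k (sgn x) \<partial>lebesgue) = ((1 + r) ^ ?N - 1) * J" if r: "r > 0" for r
  proof -
    have "(\<integral>x. indicator (shell r) x *\<^sub>R k (sgn x) \<partial>lebesgue) =
        (\<integral>x. indicator (ball 0 (1 + r)) x *\<^sub>R k (sgn x) \<partial>lebesgue) -
        (\<integral>x. indicator (ball 0 1) x *\<^sub>R k (sgn x) \<partial>lebesgue)"
      unfolding split[OF r]
      by (intro Bochner_Integration.integral_diff bnd[OF _ order_refl ks kb]) auto
    also have "\<dots> = ((1 + r) ^ ?N - 1) * J"
      using r by (subst integral_ball_sgn_scale[OF km]) (auto simp: J_def algebra_simps)
    finally show ?thesis .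
  qed
  have V: "(\<integral>x. indicator (shell r :: 'a set) x *\<^sub>R (1::real) \<partial>lebesgue) = ((1 + r) ^ ?N - 1) * w" if r: "r > 0" for r
  proof -
    have "(\<integral>x. indicator (shell r :: 'a set) x *\<^sub>R (1::real) \<partial>lebesgue) =
        (\<integral>x. indicator (ball (0::'a) (1 + r)) x *\<^sub>R (1::real) \<partial>lebesgue) -
        (\<integral>x. indicator (ball (0::'a) 1) x *\<^sub>R (1::real) \<partial>lebesgue)"
      unfolding split[OF r, where f = "\<lambda>_. 1"]
      by (intro Bochner_Integration.integral_diff bnd[OF _ order_refl, where C = 1]) auto
    also have "\<dots> = measure lebesgue (ball (0::'a) (1 + r)) - w"
      by (simp add: w_def)
    also have "\<dots> = ((1 + r) ^ ?N - 1) * w"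
      using r content_ball_conv_unit_ball[of "1 + r" "0::'a"] by (simp add: w_def algebra_simps)
    finally show ?thesis .
  qed
  \<comment> \<open>The integrand changes by at most \<open>r * L * norm v\<close> on a shell whose
    volume is of order \<open>r\<close>; after division by \<open>r\<close> the error is still of
    order \<open>r\<close>.\<close>
  have est: "\<bar>(\<integral>x. indicator (shell r) x *\<^sub>R (g x * (sgn x \<bullet> v)) \<partial>lebesgue) / r - ((1 + r) ^ ?N - 1) / r * J\<bar>
      \<le> (((1 + r) ^ ?N - 1) / r) * (r * (L * norm v * w))" if r: "r > 0" for r
  proof -
    let ?f = "\<lambda>x. g x * (sgn x \<bullet> v)"
    have sh: "shell r \<in> sets borel" "shell r \<subseteq> ball (0::'a) (1 + r)"
      by (auto simp: shell_def)
    have fm: "?f \<in> borel_measurable borel"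
      by (intro borel_measurable_times borel_measurable_inner gm) auto
    have fb: "\<bar>?f x\<bar> \<le> M * norm v" for x
      using M[of x] sv[of x] order_trans[OF abs_ge_zero M[of 0]]
      by (auto simp: abs_mult intro!: mult_mono)
    have L0: "L \<ge> 0" using L by (rule lipschitz_on_nonneg)
    have pt: "\<bar>indicator (shell r) x *\<^sub>R ?f x - indicator (shell r) x *\<^sub>R k (sgn x)\<bar>
        \<le> (r * (L * norm v)) * (indicator (shell r) x *\<^sub>R 1)" for x
    proof (cases "x \<in> shell r")
      case True
      then have x: "1 \<le> norm x" "norm x < 1 + r" by (auto simp: shell_def not_less)
      then have "x \<noteq> 0" by auto
      have "x - sgn x = (1 - inverse (norm x)) *\<^sub>R x"
        by (simp add: sgn_div_norm scaleR_diff_left)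
      then have "dist x (sgn x) = \<bar>1 - inverse (norm x)\<bar> * norm x"
        by (simp add: dist_norm)
      also have "\<dots> = norm x - 1"
        using x \<open>x \<noteq> 0\<close> by (simp add: abs_if field_simps)
      finally have d: "dist x (sgn x) \<le> r" using x by simp
      have "\<bar>g x - g (sgn x)\<bar> \<le> L * r"
        using lipschitz_onD[OF L, of x "sgn x"] mult_left_mono[OF d L0] by (simp add: dist_real_def)
      then have "\<bar>g x - g (sgn x)\<bar> * \<bar>sgn x \<bullet> v\<bar> \<le> (L * r) * norm v"
        using sv[of x] L0 r by (intro mult_mono) auto
      then show ?thesis using True
        by (simp add: k_def abs_mult[symmetric] algebra_simps)
    qed simp
    have i1: "integrable lebesgue (\<lambda>x. indicator (shell r) x *\<^sub>R ?f x)"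
      by (rule bnd[OF sh fm fb])
    have i2: "integrable lebesgue (\<lambda>x. indicator (shell r) x *\<^sub>R k (sgn x))"
      by (rule bnd[OF sh ks kb])
    have i3: "integrable lebesgue (\<lambda>x. indicator (shell r :: 'a set) x *\<^sub>R (1::real))"
      by (rule bnd[OF sh, where C = 1]) auto
    have "\<bar>(\<integral>x. indicator (shell r) x *\<^sub>R ?f x \<partial>lebesgue) - (\<integral>x. indicator (shell r) x *\<^sub>R k (sgn x) \<partial>lebesgue)\<bar>
        = \<bar>\<integral>x. indicator (shell r) x *\<^sub>R ?f x - indicator (shell r) x *\<^sub>R k (sgn x) \<partial>lebesgue\<bar>"
      using i1 i2 by (subst Bochner_Integration.integral_diff) auto
    also have "\<dots> \<le> (\<integral>x. \<bar>indicator (shell r) x *\<^sub>R ?f x - indicator (shell r) x *\<^sub>R k (sgn x)\<bar> \<partial>lebesgue)"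
      by (rule integral_abs_bound)
    also have "\<dots> \<le> (\<integral>x. (r * (L * norm v)) * (indicator (shell r :: 'a set) x *\<^sub>R (1::real)) \<partial>lebesgue)"
    proof (rule Bochner_Integration.integral_mono)
      show "integrable lebesgue (\<lambda>x. \<bar>indicator (shell r) x *\<^sub>R ?f x - indicator (shell r) x *\<^sub>R k (sgn x)\<bar>)"
        by (rule integrable_abs[OF Bochner_Integration.integrable_diff[OF i1 i2]])
      show "integrable lebesgue (\<lambda>x::'a. (r * (L * norm v)) * (indicator (shell r) x *\<^sub>R (1::real)))"
        using i3 by (rule integrable_mult_right)
    qed (rule pt)
    also have "\<dots> = (r * (L * norm v)) * (((1 + r) ^ ?N - 1) * w)"
      using V[OF r] by simp
    finally have "\<bar>(\<integral>x. indicator (shell r) x *\<^sub>R ?f x \<partial>lebesgue) - ((1 + r) ^ ?N - 1) * J\<bar> / r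
        \<le> (r * (L * norm v)) * (((1 + r) ^ ?N - 1) * w) / r"
      using r unfolding A[OF r] by (intro divide_right_mono) auto
    moreover have "\<bar>(\<integral>x. indicator (shell r) x *\<^sub>R ?f x \<partial>lebesgue) - ((1 + r) ^ ?N - 1) * J\<bar> / r
        = \<bar>(\<integral>x. indicator (shell r) x *\<^sub>R ?f x \<partial>lebesgue) / r - ((1 + r) ^ ?N - 1) / r * J\<bar>"
      using r by (simp add: diff_divide_distrib[symmetric] abs_divide)
    ultimately show ?thesis by (simp add: mult_ac)
  qed
  note q = power_difference_quotient_tendsto[OF at0, of ?N]
  have "(\<lambda>n. ((1 + h n) ^ ?N - 1) / h n * (h n * (L * norm v * w))) \<longlonglongrightarrow> real ?N * (0 * (L * norm v * w))"
    by (intro tendsto_mult q h tendsto_const)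
  then have z: "(\<lambda>n. ((1 + h n) ^ ?N - 1) / h n * (h n * (L * norm v * w))) \<longlonglongrightarrow> 0"
    by simp
  have "(\<lambda>n. (\<integral>x. indicator (shell (h n)) x *\<^sub>R (g x * (sgn x \<bullet> v)) \<partial>lebesgue) / h n
      - ((1 + h n) ^ ?N - 1) / h n * J) \<longlonglongrightarrow> 0"
    by (rule Lim_null_comparison[OF _ z]) (use est[OF h0] in \<open>simp add: always_eventually\<close>)
  from tendsto_add[OF this tendsto_mult[OF q tendsto_const[of J]]]
  have "(\<lambda>n. (\<integral>x. indicator (shell (h n)) x *\<^sub>R (g x * (sgn x \<bullet> v)) \<partial>lebesgue) / h n) \<longlonglongrightarrow> real ?N * J"
    by simp
  moreover have "(\<integral>y. g y * (y \<bullet> v) \<partial>sphere_measure) = real ?N * J"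
    using integral_sphere_measure[OF borel_measurable_sphere_measure_continuous[OF contk]]
    by (simp add: k_def J_def)
  ultimately show ?thesis by simp
qed

lemma AE_not_in_sphere: "AE x in lebesgue. x \<notin> sphere (0::'a::euclidean_space) 1"
  by (intro AE_not_in) (simp add: negligible_iff_null_sets[symmetric] negligible_sphere)

text \<open>The cut-offs turn into the indicator of the exterior while their gradients concentrate
  on the sphere. The minus sign reflects the normal \<open>- y\<close>, which is outward for the
  exterior.\<close>

theorem exterior_divergence:
  fixes g :: "'a::euclidean_space \<Rightarrow> real"
  assumes g: "g \<in> test_functions UNIV"
  shows "(\<integral>x. gradient g x \<bullet> v \<partial>lebesgue_on exterior) = - (\<integral>y. g y * (y \<bullet> v) \<partial>sphere_measure)"
proof -
  obtain K where K: "smooth_on UNIV g" "compact K" "\<And>x. x \<notin> K \<Longrightarrow> gradient g x = 0"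
    using g by (rule test_functionsE) blast
  define h where "h n = inverse (real (Suc n))" for n
  have h0: "h n > 0" for n by (simp add: h_def)
  have h: "h \<longlonglongrightarrow> 0" unfolding h_def by (rule LIMSEQ_inverse_real_of_nat)
  have contg: "continuous_on UNIV (\<lambda>x. gradient g x \<bullet> v)"
    by (intro continuous_on_inner smooth_on_continuous_gradient K(1) continuous_on_const)
  have int: "integrable lebesgue (\<lambda>x. gradient g x \<bullet> v)"
    by (rule integrable_continuous_compact_support[OF contg K(2)]) (simp add: K(3))
  \<comment> \<open>The sphere has to be excluded: there every cut-off is 0, whereas the indicator
    of the closed exterior is 1.\<close>
  have lim: "(\<lambda>n. shell_cutoff (h n) x) \<longlonglongrightarrow> indicator exterior x" if "x \<notin> sphere 0 1" for x :: 'a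
  proof (cases "norm x < 1")
    case True
    then have "shell_cutoff (h n) x = 0" for n
      using h0[of n] divide_nonpos_pos[of "norm x - 1" "h n"] by (simp add: shell_cutoff_def max_absorb1)
    then show ?thesis using True by simp
  next
    case False
    with that have x: "norm x > 1" by simp
    have "\<forall>\<^sub>F n in sequentially. h n < norm x - 1"
      using h x by (intro order_tendstoD) auto
    then have "\<forall>\<^sub>F n in sequentially. 1 = shell_cutoff (h n) x"
    proof eventually_elim
      case (elim n)
      then have "1 \<le> (norm x - 1) / h n" using h0[of n] by (simp add: field_simps)
      then show ?case by (simp add: shell_cutoff_def)
    qed
    from Lim_transform_eventually[OF tendsto_const this] False show ?thesis by simp
  qed
  have "(\<lambda>n. \<integral>x. shell_cutoff (h n) x * (gradient g x \<bullet> v) \<partial>lebesgue) \<longlonglongrightarrow>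
      (\<integral>x. indicator exterior x *\<^sub>R (gradient g x \<bullet> v) \<partial>lebesgue)"
  proof (rule integral_dominated_convergence)
    show "integrable lebesgue (\<lambda>x. norm (gradient g x \<bullet> v))"
      using int by (rule integrable_norm)
    show "(\<lambda>x. indicator exterior x *\<^sub>R (gradient g x \<bullet> v)) \<in> borel_measurable lebesgue"
      using int by (intro borel_measurable_scaleR borel_measurable_indicator) auto
    show "(\<lambda>x. shell_cutoff (h n) x * (gradient g x \<bullet> v)) \<in> borel_measurable lebesgue" for n
    proof -
      have "continuous_on UNIV (shell_cutoff (h n) :: 'a \<Rightarrow> real)"
        unfolding shell_cutoff_def by (intro continuous_intros) (use h0[of n] in auto)
      then have "(shell_cutoff (h n) :: 'a \<Rightarrow> real) \<in> borel_measurable lebesgue"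
        by (intro measurable_completion) (simp add: borel_measurable_continuous_onI)
      then show ?thesis using int by (intro borel_measurable_times) auto
    qed
    show "AE x in lebesgue. (\<lambda>n. shell_cutoff (h n) x * (gradient g x \<bullet> v)) \<longlonglongrightarrow>
        indicator exterior x *\<^sub>R (gradient g x \<bullet> v)"
      using AE_not_in_sphere
    proof eventually_elim
      case (elim x)
      show ?case unfolding real_scaleR_def by (intro tendsto_mult lim elim tendsto_const)
    qed
    show "AE x in lebesgue. norm (shell_cutoff (h n) x * (gradient g x \<bullet> v)) \<le> norm (gradient g x \<bullet> v)" for n
    proof (rule AE_I2)
      fix x :: 'a
      show "norm (shell_cutoff (h n) x * (gradient g x \<bullet> v)) \<le> norm (gradient g x \<bullet> v)"
        using shell_cutoff_bounds[of "h n" x]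
          mult_right_mono[of "shell_cutoff (h n) x" 1 "\<bar>gradient g x \<bullet> v\<bar>"]
        by (simp add: abs_mult)
    qed
  qed
  moreover have "(\<lambda>n. \<integral>x. shell_cutoff (h n) x * (gradient g x \<bullet> v) \<partial>lebesgue) \<longlonglongrightarrow>
      - (\<integral>y. g y * (y \<bullet> v) \<partial>sphere_measure)"
    using tendsto_minus[OF shell_integral_tendsto[OF g h0 h, of v]]
    by (simp add: integral_shell_cutoff[OF g h0])
  ultimately have "(\<integral>x. indicator exterior x *\<^sub>R (gradient g x \<bullet> v) \<partial>lebesgue) =
      - (\<integral>y. g y * (y \<bullet> v) \<partial>sphere_measure)"
    by (rule LIMSEQ_unique)
  then show ?thesis by (subst integral_restrict_space) auto
qed

subsection \<open>The explicit solution\<close>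

text \<open>The argument stands for \<open>x \<bullet> x\<close>. The factor
  \<open>step (4 * s - 1)\<close> removes the singularity by vanishing for
  \<open>s \<le> 1 / 4\<close> and is 1 for \<open>s \<ge> 1 / 2\<close>. The result is smooth on
  the whole line and unchanged on an open neighbourhood of the values taken on the closed exterior,
  so classical gradients there are those of the pure power.\<close>

definition radial_cut :: "real \<Rightarrow> real \<Rightarrow> real" where
  "radial_cut p s = step (4 * s - 1) * s powr p"

lemma radial_cut_eq: "s \<ge> 1 / 2 \<Longrightarrow> radial_cut p s = s powr p"
  by (simp add: radial_cut_def step_eq_1)

lemma smooth_radial_cut: "smooth_on UNIV (radial_cut p)"
proof -
  have lin: "smooth_on S (\<lambda>s::real. 4 * s - 1)" if "open S" for S
    using smooth_on_diff[OF that smooth_on_mult[OF that smooth_on_const[OF that, of 4]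
          smooth_on_inner[OF that, of 1]] smooth_on_const[OF that, of 1]] by simp
  have st: "smooth_on {0<..} (\<lambda>s::real. step (4 * s - 1))"
    by (rule smooth_on_compose[OF _ _ _ smooth_step lin]) auto
  then have 1: "smooth_on {0<..} (radial_cut p)"
    using smooth_on_mult[OF _ st smooth_on_powr[of p]] by (simp add: radial_cut_def[abs_def])
  have "smooth_on {..<1/4} (\<lambda>s::real. 0::real)"
    by (rule smooth_on_const) simp
  then have 2: "smooth_on {..<1/4} (radial_cut p)"
    by (rule smooth_on_cong_open[rotated 2]) (auto simp: radial_cut_def step_eq_0)
  have "smooth_on ({0<..} \<union> {..<1/4}) (radial_cut p)"
    by (rule smooth_on_Un[OF _ _ 1 2]) auto
  moreover have "{0<..} \<union> {..<1/4} = (UNIV :: real set)"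
    by auto
  ultimately show ?thesis by simp
qed

text \<open>Outside the ball of radius \<open>1 / sqrt 2\<close> this is the dipole potential
  \<open>- (a \<bullet> x) / ((N - 1) |x|\<^sup>N)\<close>, whose exterior normal derivative on the unit sphere is \<open>- a \<bullet> x\<close>.\<close>

definition dipole :: "'a::euclidean_space \<Rightarrow> 'a \<Rightarrow> real" where
  "dipole a x = - (1 / (real DIM('a) - 1)) * ((x \<bullet> a) * radial_cut (- (real DIM('a) / 2)) (x \<bullet> x))"

lemma smooth_dipole: "smooth_on UNIV (dipole a :: 'a::euclidean_space \<Rightarrow> real)"
proof -
  have "smooth_on UNIV (\<lambda>x::'a. radial_cut p (x \<bullet> x))" for p
    by (rule smooth_on_compose[OF _ _ _ smooth_radial_cut smooth_on_inner_self]) auto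
  then show ?thesis
    unfolding dipole_def[abs_def] by (intro smooth_on_mult smooth_on_const smooth_on_inner) auto
qed

lemma open_inner_self_greater: "open {x::'a::euclidean_space. x \<bullet> x > c}"
  by (intro open_Collect_less continuous_intros)

lemma GDERIV_inner: "GDERIV (\<lambda>x. x \<bullet> a) x :> a"
  unfolding gderiv_def by (auto intro!: derivative_eq_intros)

lemma GDERIV_inner_self_powr:
  assumes "x \<bullet> x > 0"
  shows "GDERIV (\<lambda>x. (x \<bullet> x) powr p) x :> (2 * p * (x \<bullet> x) powr (p - 1)) *\<^sub>R x"
proof -
  have "GDERIV (\<lambda>x. x \<bullet> x) x :> 2 *\<^sub>R x"
    unfolding gderiv_def
    by (auto intro!: derivative_eq_intros simp: inner_commute)
  from GDERIV_DERIV_compose[OF this has_real_derivative_powr[OF assms, of p]]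
  show ?thesis by (rule GDERIV_subst) (simp add: mult_ac)
qed

lemma dipole_eq:
  fixes a :: "'a::euclidean_space"
  shows "x \<bullet> x \<ge> 1 / 2 \<Longrightarrow> dipole a x = (- (1 / (real DIM('a) - 1))) * ((x \<bullet> a) * (x \<bullet> x) powr (- (real DIM('a) / 2)))"
  by (simp add: dipole_def radial_cut_eq)

lemma gradient_dipole:
  fixes a :: "'a::euclidean_space"
  assumes x: "x \<bullet> x > 1 / 2"
  shows "gradient (dipole a) x =
    (- (1 / (real DIM('a) - 1))) *\<^sub>R ((x \<bullet> x) powr (- (real DIM('a) / 2)) *\<^sub>R a - (real DIM('a) * (x \<bullet> a) * (x \<bullet> x) powr (- (real DIM('a) / 2) - 1)) *\<^sub>R x)"
proof -
  let ?N = "real DIM('a)"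
  let ?c = "- (1 / (real DIM('a) - 1))"
  have "x \<bullet> x > 0" using x by linarith
  from GDERIV_mult[OF GDERIV_const[of ?c] GDERIV_mult[OF GDERIV_inner GDERIV_inner_self_powr[OF this, of "- (?N / 2)"], of a]]
  have "GDERIV (\<lambda>x. ?c * ((x \<bullet> a) * (x \<bullet> x) powr (- (?N / 2)))) x :>
      ?c *\<^sub>R ((x \<bullet> x) powr (- (?N / 2)) *\<^sub>R a - (?N * (x \<bullet> a) * (x \<bullet> x) powr (- (?N / 2) - 1)) *\<^sub>R x)"
    by (rule GDERIV_subst) (simp add: algebra_simps)
  then have "GDERIV (dipole a) x :>
      ?c *\<^sub>R ((x \<bullet> x) powr (- (?N / 2)) *\<^sub>R a - (?N * (x \<bullet> a) * (x \<bullet> x) powr (- (?N / 2) - 1)) *\<^sub>R x)"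
    by (rule GDERIV_transform_open[OF _ open_inner_self_greater[of "1/2"]]) (use x in \<open>auto simp: dipole_eq\<close>)
  then show ?thesis by (rule gradient_eqI)
qed

text \<open>The exponent is forced: with \<open>s = x \<bullet> x\<close>, the Laplacian of
  \<open>(x \<bullet> a) * s powr p\<close> is
  \<open>2 * p * (2 * p + N) * (x \<bullet> a) * s powr (p - 1)\<close>, which vanishes for
  \<open>p = - N / 2\<close>.\<close>

lemma laplacian_dipole:
  fixes a :: "'a::euclidean_space"
  assumes x: "x \<bullet> x > 1 / 2"
  shows "(\<Sum>b\<in>Basis. gradient (\<lambda>x. gradient (dipole a) x \<bullet> b) x \<bullet> b) = 0"
proof -
  let ?N = "real DIM('a)"
  let ?c = "- (1 / (real DIM('a) - 1))"
  have x0: "x \<bullet> x > 0" using x by linarith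
  define s where "s = x \<bullet> x"
  define p where "p = - (?N / 2)"
  have s0: "s > 0" using x0 by (simp add: s_def)
  \<comment> \<open>After summation over the basis the term with the second derivative of the power
    carries a factor \<open>s\<close>; absorbing it brings all terms to the common power
    \<open>p - 1\<close>.\<close>
  have s1: "s * s powr (p - 2) = s powr (p - 1)"
    using s0 by (simp add: powr_mult_base)
  have G: "gradient (\<lambda>x. gradient (dipole a) x \<bullet> b) x \<bullet> b =
      ?c * (2 * p * s powr (p - 1) * ((x \<bullet> b) * (a \<bullet> b)) - ?N * (s powr (p - 1) * ((x \<bullet> b) * (a \<bullet> b))
        + (x \<bullet> a) * (2 * (p - 1) * s powr (p - 2) * ((x \<bullet> b) * (x \<bullet> b))) + (x \<bullet> a) * s powr (p - 1)))"
    if b: "b \<in> Basis" for b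
  proof -
    have 1: "GDERIV (\<lambda>x. (x \<bullet> x) powr p * (a \<bullet> b)) x :> (2 * p * s powr (p - 1) * (a \<bullet> b)) *\<^sub>R x"
      using GDERIV_mult[OF GDERIV_inner_self_powr[OF x0, of p] GDERIV_const[of "a \<bullet> b"]]
      by (simp add: s_def mult_ac)
    have 2: "GDERIV (\<lambda>x. ?N * (((x \<bullet> a) * (x \<bullet> x) powr (p - 1)) * (x \<bullet> b))) x :>
        ?N *\<^sub>R (((x \<bullet> a) * s powr (p - 1)) *\<^sub>R b + (x \<bullet> b) *\<^sub>R
          ((x \<bullet> a) *\<^sub>R (2 * (p - 1) * s powr (p - 2)) *\<^sub>R x + s powr (p - 1) *\<^sub>R a))"
      using GDERIV_mult[OF GDERIV_const[of ?N] GDERIV_mult[OF GDERIV_mult[OF GDERIV_inner[of a]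
            GDERIV_inner_self_powr[OF x0, of "p - 1"]] GDERIV_inner[of b]]]
      by (simp add: s_def)
    have "GDERIV (\<lambda>x. ?c * ((x \<bullet> x) powr p * (a \<bullet> b) - ?N * (((x \<bullet> a) * (x \<bullet> x) powr (p - 1)) * (x \<bullet> b)))) x :>
        ?c *\<^sub>R ((2 * p * s powr (p - 1) * (a \<bullet> b)) *\<^sub>R x - ?N *\<^sub>R (((x \<bullet> a) * s powr (p - 1)) *\<^sub>R b + (x \<bullet> b) *\<^sub>R
          ((x \<bullet> a) *\<^sub>R (2 * (p - 1) * s powr (p - 2)) *\<^sub>R x + s powr (p - 1) *\<^sub>R a)))" (is "GDERIV ?f x :> ?D")
      using GDERIV_mult[OF GDERIV_const[of ?c] GDERIV_diff[OF 1 2]] by simp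
    then have "GDERIV (\<lambda>x. gradient (dipole a) x \<bullet> b) x :> ?D"
      by (rule GDERIV_transform_open[OF _ open_inner_self_greater[of "1/2"]])
         (use x in \<open>auto simp: gradient_dipole p_def inner_diff_left\<close>)
    then have "gradient (\<lambda>x. gradient (dipole a) x \<bullet> b) x = ?D"
      by (rule gradient_eqI)
    moreover have "?D \<bullet> b = ?c * (2 * p * s powr (p - 1) * ((x \<bullet> b) * (a \<bullet> b)) - ?N * (s powr (p - 1) * ((x \<bullet> b) * (a \<bullet> b))
        + (x \<bullet> a) * (2 * (p - 1) * s powr (p - 2) * ((x \<bullet> b) * (x \<bullet> b))) + (x \<bullet> a) * s powr (p - 1)))"
      using b by (simp add: inner_add_left inner_diff_left algebra_simps)
    ultimately show ?thesis by simp
  qed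
  have e1: "(\<Sum>b\<in>Basis. (x \<bullet> b) * (a \<bullet> b)) = x \<bullet> a"
    by (rule euclidean_inner[symmetric])
  have e2: "(\<Sum>b\<in>Basis. (x \<bullet> b) * (x \<bullet> b)) = s"
    unfolding s_def by (rule euclidean_inner[symmetric])
  have "(\<Sum>b\<in>Basis. gradient (\<lambda>x. gradient (dipole a) x \<bullet> b) x \<bullet> b) =
      (\<Sum>b\<in>Basis. ?c * (2 * p * s powr (p - 1) * ((x \<bullet> b) * (a \<bullet> b)) - ?N * (s powr (p - 1) * ((x \<bullet> b) * (a \<bullet> b))
        + (x \<bullet> a) * (2 * (p - 1) * s powr (p - 2) * ((x \<bullet> b) * (x \<bullet> b))) + (x \<bullet> a) * s powr (p - 1))))"
    by (intro sum.cong refl G)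
  also have "\<dots> = ?c * (2 * p * s powr (p - 1) * (\<Sum>b\<in>Basis. (x \<bullet> b) * (a \<bullet> b)) -
      ?N * (s powr (p - 1) * (\<Sum>b\<in>Basis. (x \<bullet> b) * (a \<bullet> b))
        + (x \<bullet> a) * (2 * (p - 1) * s powr (p - 2) * (\<Sum>b\<in>Basis. (x \<bullet> b) * (x \<bullet> b)))
        + (\<Sum>b\<in>(Basis :: 'a set). (x \<bullet> a) * s powr (p - 1))))"
    by (simp only: sum_distrib_left[symmetric] sum_subtractf sum.distrib)
  also have "\<dots> = ?c * (2 * p * s powr (p - 1) * (x \<bullet> a) - ?N * (s powr (p - 1) * (x \<bullet> a)
        + (x \<bullet> a) * (2 * (p - 1) * (s * s powr (p - 2))) + ?N * ((x \<bullet> a) * s powr (p - 1))))"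
    unfolding e1 e2 by (simp add: mult_ac)
  also have "\<dots> = 0"
    unfolding s1 by (simp add: p_def algebra_simps)
  finally show ?thesis .
qed

text \<open>Along a ray the dipole is a multiple of \<open>r\<close> to the power
  \<open>1 - N\<close>. Differentiation at \<open>r = 1\<close> gives the factor
  \<open>1 - N\<close>, which the normalisation \<open>- 1 / (N - 1)\<close> cancels.\<close>

lemma gradient_dipole_radial:
  fixes a :: "'a::euclidean_space"
  assumes "DIM('a) \<ge> 2" "norm y = 1"
  shows "gradient (dipole a) y \<bullet> y = y \<bullet> a"
proof -
  let ?N = "real DIM('a)"
  have y: "y \<bullet> y = 1" using assms(2) by (simp add: norm_eq_1)
  have N: "?N - 1 \<noteq> 0" using assms(1) by linarith
  have "gradient (dipole a) y \<bullet> y = (- (1 / (?N - 1)) * (1 - ?N)) * (y \<bullet> a)"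
    using y by (simp add: gradient_dipole inner_diff_left inner_commute[of a y] algebra_simps diff_divide_distrib add_divide_distrib)
  also have "- (1 / (?N - 1)) * (1 - ?N) = 1"
    using N by (simp add: divide_simps)
  finally show ?thesis by simp
qed

text \<open>Decay of order \<open>|x|^(-N)\<close>, which is what makes the Dirichlet energy finite.
  In the constant, 1 comes from the term along \<open>a\<close> and \<open>N\<close> from the term
  along \<open>x\<close>.\<close>

lemma norm_gradient_dipole_le:
  fixes a :: "'a::euclidean_space"
  assumes "norm x \<ge> 1"
  shows "norm (gradient (dipole a) x) \<le> (\<bar>(- (1 / (real DIM('a) - 1)))\<bar> * (1 + real DIM('a)) * norm a) * (x \<bullet> x) powr (- (real DIM('a) / 2))"
proof -
  let ?N = "real DIM('a)"
  let ?c = "- (1 / (real DIM('a) - 1))"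
  have x: "x \<bullet> x \<ge> 1" using assms by (metis norm_le_square norm_one one_power2 zero_le_one power2_norm_eq_inner one_le_power)
  define s where "s = x \<bullet> x"
  have s: "s \<ge> 1" using x by (simp add: s_def)
  have "\<bar>x \<bullet> a\<bar> * norm x \<le> s * norm a"
    using mult_right_mono[OF Cauchy_Schwarz_ineq2[of x a], of "norm x"]
    by (simp add: s_def dot_square_norm power2_eq_square mult_ac)
  then have "(\<bar>x \<bullet> a\<bar> * norm x) * (?N * s powr (- (?N / 2) - 1)) \<le> (s * norm a) * (?N * s powr (- (?N / 2) - 1))"
    by (intro mult_right_mono) auto
  also have "\<dots> = ?N * norm a * (s * s powr (- (?N / 2) - 1))"
    by (simp add: mult_ac)
  also have "s * s powr (- (?N / 2) - 1) = s powr (- (?N / 2))"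
    using s by (simp add: powr_mult_base)
  finally have 1: "norm ((?N * (x \<bullet> a) * s powr (- (?N / 2) - 1)) *\<^sub>R x) \<le> ?N * norm a * s powr (- (?N / 2))"
    by (simp add: abs_mult mult_ac)
  have "norm (s powr (- (?N / 2)) *\<^sub>R a - (?N * (x \<bullet> a) * s powr (- (?N / 2) - 1)) *\<^sub>R x)
      \<le> norm (s powr (- (?N / 2)) *\<^sub>R a) + norm ((?N * (x \<bullet> a) * s powr (- (?N / 2) - 1)) *\<^sub>R x)"
    by (rule norm_triangle_ineq4)
  also have "\<dots> \<le> s powr (- (?N / 2)) * norm a + ?N * norm a * s powr (- (?N / 2))"
    using 1 by simp
  also have "\<dots> = (1 + ?N) * norm a * s powr (- (?N / 2))"
    by (simp add: algebra_simps)
  finally have "\<bar>?c\<bar> * norm (s powr (- (?N / 2)) *\<^sub>R a - (?N * (x \<bullet> a) * s powr (- (?N / 2) - 1)) *\<^sub>R x) \<le>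
      \<bar>?c\<bar> * ((1 + ?N) * norm a * s powr (- (?N / 2)))"
    by (intro mult_left_mono) auto
  moreover have "norm (gradient (dipole a) x) =
      \<bar>?c\<bar> * norm (s powr (- (?N / 2)) *\<^sub>R a - (?N * (x \<bullet> a) * s powr (- (?N / 2) - 1)) *\<^sub>R x)"
    using x by (subst gradient_dipole) (auto simp: s_def)
  ultimately show ?thesis
    by (simp add: s_def mult.assoc)
qed

text \<open>The dipole is one order larger than its gradient. The form with the separate factor
  \<open>norm x\<close> is the one that meets a cut-off gradient of order
  \<open>1 / |x|\<close>.\<close>

lemma abs_dipole_le:
  fixes a :: "'a::euclidean_space"
  assumes "norm x \<ge> 1"
  shows "\<bar>dipole a x\<bar> \<le> (\<bar>(- (1 / (real DIM('a) - 1)))\<bar> * norm a) * (norm x * (x \<bullet> x) powr (- (real DIM('a) / 2)))"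
proof -
  let ?N = "real DIM('a)"
  let ?c = "- (1 / (real DIM('a) - 1))"
  have x: "x \<bullet> x \<ge> 1" using assms by (metis one_le_power power2_norm_eq_inner)
  have "\<bar>dipole a x\<bar> = \<bar>?c\<bar> * (\<bar>x \<bullet> a\<bar> * (x \<bullet> x) powr (- (?N / 2)))"
    using x by (subst dipole_eq) (auto simp: abs_mult)
  also have "\<dots> \<le> \<bar>?c\<bar> * ((norm x * norm a) * (x \<bullet> x) powr (- (?N / 2)))"
    by (intro mult_left_mono mult_right_mono Cauchy_Schwarz_ineq2) auto
  finally show ?thesis by (simp add: mult_ac)
qed

lemma borel_measurable_lebesgue_on_continuous:
  fixes f :: "'a::euclidean_space \<Rightarrow> 'b::euclidean_space"
  shows "continuous_on UNIV f \<Longrightarrow> f \<in> borel_measurable (lebesgue_on S)"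
  by (intro measurable_restrict_space1 measurable_completion) (simp add: borel_measurable_continuous_onI)

lemma integrable_sphere_measure_continuous:
  fixes f :: "'a::euclidean_space \<Rightarrow> real"
  assumes "continuous_on UNIV f"
  shows "integrable sphere_measure f"
proof -
  interpret finite_measure "sphere_measure :: 'a measure" by (rule finite_measure_sphere_measure)
  have "compact (f ` sphere 0 1)"
    by (intro compact_continuous_image continuous_on_subset[OF assms]) auto
  then obtain C where "\<And>x. x \<in> sphere 0 1 \<Longrightarrow> \<bar>f x\<bar> \<le> C"
    using compact_imp_bounded[of "f ` sphere 0 1"] unfolding bounded_iff by (metis imageI real_norm_def)
  then show ?thesis
    using borel_measurable_sphere_measure_continuous[OF assms]
    by (intro integrable_const_bound[of _ C] AE_I2) (auto simp: space_sphere_measure)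
qed

text \<open>The divergence theorem is applied to the components of the field \<open>v\<close> times
  the gradient of the dipole. Its divergence is the inner product of the two gradients plus
  \<open>v\<close> times the Laplacian, and the latter vanishes on the exterior.\<close>

theorem green_dipole:
  fixes a :: "'a::euclidean_space"
  assumes N: "DIM('a) \<ge> 2" and v: "v \<in> test_functions UNIV"
  shows "(\<integral>x. gradient (dipole a) x \<bullet> gradient v x \<partial>lebesgue_on exterior) =
    (\<integral>y. (a \<bullet> sphere_normal y) * v y \<partial>sphere_measure)"
proof -
  obtain K where K: "smooth_on UNIV v" "compact K" "\<And>x. x \<notin> K \<Longrightarrow> v x = 0"
      "\<And>x. x \<notin> K \<Longrightarrow> gradient v x = 0"
    using v by (rule test_functionsE) blast
  let ?U = "dipole a"
  define g where "g b x = (gradient ?U x \<bullet> b) * v x" for b x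
  have sU: "smooth_on UNIV (\<lambda>x. gradient ?U x \<bullet> b)" if "b \<in> Basis" for b
    using smooth_dipole that by (rule smooth_on_gradient)
  have g: "g b \<in> test_functions UNIV" if "b \<in> Basis" for b
    unfolding g_def by (rule test_functions_mult[OF sU[OF that] v])
  have gg: "gradient (g b) x \<bullet> b = (gradient ?U x \<bullet> b) * (gradient v x \<bullet> b) +
      v x * (gradient (\<lambda>x. gradient ?U x \<bullet> b) x \<bullet> b)" if "b \<in> Basis" for b x
    unfolding g_def by (subst gradient_mult[OF sU[OF that] K(1)]) (simp add: inner_add_left)
  have int: "integrable (lebesgue_on exterior) (\<lambda>x. gradient (g b) x \<bullet> b)" if b: "b \<in> Basis" for b
  proof -
    obtain K' where K': "smooth_on UNIV (g b)" "compact K'" "\<And>x. x \<notin> K' \<Longrightarrow> gradient (g b) x = 0"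
      using g[OF b] by (rule test_functionsE) blast
    have "integrable lebesgue (\<lambda>x. gradient (g b) x \<bullet> b)"
      by (rule integrable_continuous_compact_support[OF _ K'(2)])
         (auto intro!: continuous_on_inner smooth_on_continuous_gradient K'(1) continuous_on_const simp: K'(3))
    then have "integrable lebesgue (\<lambda>x. indicator exterior x *\<^sub>R (gradient (g b) x \<bullet> b))"
      by (intro integrable_mult_indicator) auto
    then show ?thesis
      by (subst integrable_restrict_space) auto
  qed
  have contU: "continuous_on UNIV (gradient ?U)" and contv: "continuous_on UNIV v"
    using smooth_on_continuous_gradient[OF smooth_dipole] smooth_on_continuous[OF K(1)] by auto
  have ints: "integrable sphere_measure (\<lambda>y. g b y * (y \<bullet> b))" for b
    unfolding g_def
    by (intro integrable_sphere_measure_continuous continuous_on_mult continuous_on_inner contU contv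
        continuous_on_const continuous_on_id)
  have "(\<integral>x. gradient ?U x \<bullet> gradient v x \<partial>lebesgue_on exterior) =
      (\<integral>x. (\<Sum>b\<in>Basis. gradient (g b) x \<bullet> b) \<partial>lebesgue_on exterior)"
  \<comment> \<open>The integrands agree only where the dipole is harmonic; on the exterior
    \<open>x \<bullet> x \<ge> 1\<close> keeps clear of the modified region.\<close>
  proof (rule Bochner_Integration.integral_cong[OF refl])
    fix x :: 'a assume "x \<in> space (lebesgue_on exterior)"
    then have "norm x \<ge> 1" by simp
    then have "x \<bullet> x \<ge> 1" by (metis one_le_power power2_norm_eq_inner)
    then have lap: "(\<Sum>b\<in>Basis. gradient (\<lambda>x. gradient ?U x \<bullet> b) x \<bullet> b) = 0"
      by (intro laplacian_dipole) linarith
    have "(\<Sum>b\<in>Basis. gradient (g b) x \<bullet> b) = (\<Sum>b\<in>Basis. (gradient ?U x \<bullet> b) * (gradient v x \<bullet> b)) +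
        v x * (\<Sum>b\<in>Basis. gradient (\<lambda>x. gradient ?U x \<bullet> b) x \<bullet> b)"
      by (simp add: gg sum.distrib sum_distrib_left)
    then show "gradient ?U x \<bullet> gradient v x = (\<Sum>b\<in>Basis. gradient (g b) x \<bullet> b)"
      by (simp only: lap mult_zero_right add_0_right euclidean_inner[symmetric])
  qed
  also have "\<dots> = (\<Sum>b\<in>Basis. \<integral>x. gradient (g b) x \<bullet> b \<partial>lebesgue_on exterior)"
    by (rule Bochner_Integration.integral_sum) (rule int)
  also have "\<dots> = (\<Sum>b\<in>Basis. - (\<integral>y. g b y * (y \<bullet> b) \<partial>sphere_measure))"
    by (intro sum.cong refl exterior_divergence g)
  also have "\<dots> = - (\<integral>y. (\<Sum>b\<in>Basis. g b y * (y \<bullet> b)) \<partial>sphere_measure)"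
    by (subst Bochner_Integration.integral_sum) (auto simp: ints sum_negf)
  also have "(\<integral>y. (\<Sum>b\<in>Basis. g b y * (y \<bullet> b)) \<partial>sphere_measure) = (\<integral>y. (a \<bullet> y) * v y \<partial>sphere_measure)"
  proof (rule Bochner_Integration.integral_cong[OF refl])
    fix y :: 'a assume "y \<in> space sphere_measure"
    then have y: "norm y = 1" by (simp add: space_sphere_measure)
    have "(\<Sum>b\<in>Basis. g b y * (y \<bullet> b)) = v y * (\<Sum>b\<in>Basis. (gradient ?U y \<bullet> b) * (y \<bullet> b))"
      by (simp add: g_def sum_distrib_left mult_ac)
    also have "(\<Sum>b\<in>Basis. (gradient ?U y \<bullet> b) * (y \<bullet> b)) = a \<bullet> y"
      using gradient_dipole_radial[OF N y, of a]
      by (simp only: euclidean_inner[symmetric] inner_commute[of a y])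
    finally show "(\<Sum>b\<in>Basis. g b y * (y \<bullet> b)) = (a \<bullet> y) * v y" by simp
  qed
  also have "- (\<integral>y. (a \<bullet> y) * v y \<partial>sphere_measure) = (\<integral>y. (a \<bullet> sphere_normal y) * v y \<partial>sphere_measure)"
    by (simp add: sphere_normal_def)
  finally show ?thesis .
qed

text \<open>Decomposition into annuli of width 1: where \<open>norm x\<close> lies between
  \<open>n\<close> and \<open>n + 1\<close> the integrand is at most \<open>n^(-2N)\<close>, and the
  ball containing that annulus has volume of order \<open>n^N\<close>. The series of
  \<open>n^(-N)\<close> converges for \<open>N \<ge> 2\<close>.\<close>

lemma integrable_inner_self_powr:
  assumes "DIM('a::euclidean_space) \<ge> 2"
  shows "integrable (lebesgue_on exterior) (\<lambda>x::'a. (x \<bullet> x) powr (- real DIM('a)))"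
proof -
  let ?N = "DIM('a)"
  define w where "w = measure lebesgue (ball (0::'a) 1)"
  have w: "w \<ge> 0" by (simp add: w_def)
  have m: "(\<lambda>x::'a. (x \<bullet> x) powr (- real ?N)) \<in> borel_measurable borel" by measurable
  \<comment> \<open>On the annulus from \<open>j + 1\<close> to \<open>j + 2\<close> the single term
    \<open>t j\<close> already dominates the integrand. Using the full ball in place of the annulus
    is wasteful but still summable.\<close>
  define t where "t j x = ennreal (inverse (real (Suc j) ^ (2 * ?N))) * indicator (ball (0::'a) (real j + 2)) x" for j x
  have pt: "ennreal (indicator exterior x *\<^sub>R (x \<bullet> x) powr (- real ?N)) \<le> (\<Sum>j. t j x)" for x :: 'a
  proof (cases "norm x < 1")
    case False
    define n where "n = nat \<lfloor>norm x\<rfloor>"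
    have n: "real n \<le> norm x" "norm x < real n + 1" "n \<ge> 1"
      using False by (auto simp: n_def le_nat_iff le_floor_iff)
    then obtain j where j: "n = Suc j" by (cases n) auto
    have x0: "x \<bullet> x > 0" using False by (metis inner_gt_zero_iff norm_zero zero_less_one)
    have "(real n)\<^sup>2 \<le> x \<bullet> x"
      using n by (metis of_nat_0_le_iff power2_norm_eq_inner power_mono)
    then have "(real n)\<^sup>2 ^ ?N \<le> (x \<bullet> x) ^ ?N"
      by (intro power_mono) auto
    then have "inverse ((x \<bullet> x) ^ ?N) \<le> inverse (real (Suc j) ^ (2 * ?N))"
      using n(3) by (intro le_imp_inverse_le) (auto simp: power_mult j)
    then have "ennreal ((x \<bullet> x) powr (- real ?N)) \<le> ennreal (inverse (real (Suc j) ^ (2 * ?N)))"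
      using x0 by (intro ennreal_leI) (simp add: powr_minus powr_realpow)
    also have "\<dots> = t j x"
      using n j by (simp add: t_def)
    also have "\<dots> = (\<Sum>i\<in>{j}. t i x)" by simp
    also have "\<dots> \<le> (\<Sum>i. t i x)"
      by (rule sum_le_suminf) auto
    finally show ?thesis using False by simp
  qed simp
  have tm: "t j \<in> borel_measurable lebesgue" for j
    unfolding t_def
    by (rule borel_measurable_times_ennreal[OF borel_measurable_const borel_measurable_indicator]) simp
  have t_int: "(\<integral>\<^sup>+x. t j x \<partial>lebesgue) \<le> ennreal (2 ^ ?N * w * inverse (real (Suc j) ^ ?N))" for j
  proof -
    have "(\<integral>\<^sup>+x. t j x \<partial>lebesgue) = ennreal (inverse (real (Suc j) ^ (2 * ?N))) * emeasure lebesgue (ball (0::'a) (real j + 2))"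
      unfolding t_def by (subst nn_integral_cmult_indicator) auto
    also have "emeasure lebesgue (ball (0::'a) (real j + 2)) = ennreal (measure lebesgue (ball (0::'a) (real j + 2)))"
      using emeasure_lborel_ball_finite[of "0::'a" "real j + 2"] by (intro emeasure_eq_ennreal_measure) simp
    also have "measure lebesgue (ball (0::'a) (real j + 2)) = (real j + 2) ^ ?N * w"
      using content_ball_conv_unit_ball[of "real j + 2" "0::'a"] by (simp add: w_def)
    also have "ennreal (inverse (real (Suc j) ^ (2 * ?N))) * ennreal ((real j + 2) ^ ?N * w) =
        ennreal (inverse (real (Suc j) ^ (2 * ?N)) * ((real j + 2) ^ ?N * w))"
      using w by (intro ennreal_mult[symmetric]) auto
    also have "\<dots> \<le> ennreal (2 ^ ?N * w * inverse (real (Suc j) ^ ?N))"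
    proof (rule ennreal_leI)
      have "(real j + 2) ^ ?N \<le> (2 * real (Suc j)) ^ ?N"
        by (intro power_mono) auto
      then have "inverse (real (Suc j) ^ (2 * ?N)) * ((real j + 2) ^ ?N * w) \<le>
          inverse (real (Suc j) ^ (2 * ?N)) * ((2 * real (Suc j)) ^ ?N * w)"
        using w by (intro mult_left_mono mult_right_mono) auto
      also have "\<dots> = 2 ^ ?N * w * inverse (real (Suc j) ^ ?N)"
      proof -
        define m where "m = real (Suc j)"
        have "m > 0" by (simp add: m_def)
        then show ?thesis
          unfolding m_def[symmetric] mult_2 power_add power_mult_distrib by (simp add: field_simps)
      qed
      finally show "inverse (real (Suc j) ^ (2 * ?N)) * ((real j + 2) ^ ?N * w) \<le> 2 ^ ?N * w * inverse (real (Suc j) ^ ?N)" .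
    qed
    finally show ?thesis .
  qed
  have summ: "summable (\<lambda>j. 2 ^ ?N * w * inverse (real (Suc j) ^ ?N))"
    using inverse_power_summable[OF assms, where 'a = real]
    by (intro summable_mult) (subst summable_Suc_iff, simp)
  have "(\<integral>\<^sup>+x. ennreal (indicator exterior x *\<^sub>R (x \<bullet> x) powr (- real ?N)) \<partial>(lebesgue :: 'a measure)) \<le> (\<integral>\<^sup>+x. (\<Sum>j. t j x) \<partial>lebesgue)"
    by (intro nn_integral_mono pt)
  also have "\<dots> = (\<Sum>j. \<integral>\<^sup>+x. t j x \<partial>lebesgue)"
    by (rule nn_integral_suminf) (rule tm)
  also have "\<dots> \<le> (\<Sum>j. ennreal (2 ^ ?N * w * inverse (real (Suc j) ^ ?N)))"
    by (intro suminf_le t_int) auto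
  also have "\<dots> = ennreal (\<Sum>j. 2 ^ ?N * w * inverse (real (Suc j) ^ ?N))"
    using w summ by (intro suminf_ennreal2) auto
  also have "\<dots> < top" by simp
  finally have fin: "(\<integral>\<^sup>+x. ennreal (indicator exterior x *\<^sub>R (x \<bullet> x) powr (- real ?N)) \<partial>(lebesgue :: 'a measure)) < top" .
  have "integrable lebesgue (\<lambda>x::'a. indicator exterior x *\<^sub>R (x \<bullet> x) powr (- real ?N))"
  proof (rule integrableI_nonneg)
    show "(\<lambda>x::'a. indicator exterior x *\<^sub>R (x \<bullet> x) powr (- real ?N)) \<in> borel_measurable lebesgue"
      using m by (intro measurable_completion) simp
    show "AE x in lebesgue. 0 \<le> indicator exterior x *\<^sub>R (x \<bullet> (x::'a)) powr (- real ?N)"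
      by simp
    show "(\<integral>\<^sup>+x. ennreal (indicator exterior x *\<^sub>R (x \<bullet> x) powr (- real ?N)) \<partial>(lebesgue :: 'a measure)) < \<infinity>"
      using fin by simp
  qed
  then show ?thesis
    by (subst integrable_restrict_space) auto
qed

subsection \<open>Limits of square integrable functions\<close>

text \<open>Formulated for an arbitrary measure because it serves both gradients on the exterior and
  traces on the sphere.\<close>

definition square_integrable :: "'a measure \<Rightarrow> ('a \<Rightarrow> 'b::euclidean_space) \<Rightarrow> bool" where
  "square_integrable M f \<longleftrightarrow> f \<in> borel_measurable M \<and> integrable M (\<lambda>x. (norm (f x))\<^sup>2)"

lemma square_integrable_diff:
  assumes "square_integrable M f" "square_integrable M g"
  shows "square_integrable M (\<lambda>x. f x - g x)"
proof -
  have m: "f \<in> borel_measurable M" "g \<in> borel_measurable M"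
    and i: "integrable M (\<lambda>x. (norm (f x))\<^sup>2)" "integrable M (\<lambda>x. (norm (g x))\<^sup>2)"
    using assms by (auto simp: square_integrable_def)
  have "integrable M (\<lambda>x. (norm (f x - g x))\<^sup>2)"
  proof (rule Bochner_Integration.integrable_bound)
    show "integrable M (\<lambda>x. 2 * (norm (f x))\<^sup>2 + 2 * (norm (g x))\<^sup>2)" using i by simp
    show "(\<lambda>x. (norm (f x - g x))\<^sup>2) \<in> borel_measurable M" using m by measurable
    show "AE x in M. norm ((norm (f x - g x))\<^sup>2) \<le> norm (2 * (norm (f x))\<^sup>2 + 2 * (norm (g x))\<^sup>2)"
    proof (rule AE_I2)
      fix x
      have "(norm (f x - g x))\<^sup>2 \<le> (norm (f x) + norm (g x))\<^sup>2"
        by (intro power_mono norm_triangle_ineq4) auto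
      also have "\<dots> \<le> 2 * (norm (f x))\<^sup>2 + 2 * (norm (g x))\<^sup>2"
        using sum_squares_bound[of "norm (f x)" "norm (g x)"] by (simp add: power2_sum)
      finally show "norm ((norm (f x - g x))\<^sup>2) \<le> norm (2 * (norm (f x))\<^sup>2 + 2 * (norm (g x))\<^sup>2)"
        by simp
    qed
  qed
  then show ?thesis using m by (simp add: square_integrable_def)
qed

lemma square_integrable_of_nn_integral:
  assumes "f \<in> borel_measurable M" "(\<integral>\<^sup>+x. ennreal ((norm (f x))\<^sup>2) \<partial>M) < top"
  shows "square_integrable M f"
  unfolding square_integrable_def
proof
  show "integrable M (\<lambda>x. (norm (f x))\<^sup>2)"
    by (rule integrableI_nonneg) (use assms in \<open>auto intro!: borel_measurable_power borel_measurable_norm\<close>)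
qed (fact assms(1))

text \<open>\<open>D12_approx\<close> speaks only of extended integrals tending to 0. Some index has
  distance less than 1, and \<open>g\<close> is then the difference of \<open>v k\<close> and
  \<open>v k - g\<close>, both square integrable.\<close>

lemma square_integrable_limit:
  assumes "\<And>k. square_integrable M (v k)" "g \<in> borel_measurable M"
    and "(\<lambda>k. \<integral>\<^sup>+x. ennreal ((norm (v k x - g x))\<^sup>2) \<partial>M) \<longlonglongrightarrow> 0"
  shows "square_integrable M g"
proof -
  have "\<forall>\<^sub>F k in sequentially. (\<integral>\<^sup>+x. ennreal ((norm (v k x - g x))\<^sup>2) \<partial>M) < 1"
    using assms(3) by (rule order_tendstoD) simp
  then obtain k where k: "(\<integral>\<^sup>+x. ennreal ((norm (v k x - g x))\<^sup>2) \<partial>M) < 1"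
    by (auto simp: eventually_sequentially)
  have m: "v k \<in> borel_measurable M" using assms(1) by (simp add: square_integrable_def)
  have "square_integrable M (\<lambda>x. v k x - g x)"
  proof (rule square_integrable_of_nn_integral)
    show "(\<lambda>x. v k x - g x) \<in> borel_measurable M" using m assms(2) by (rule borel_measurable_diff)
    show "(\<integral>\<^sup>+x. ennreal ((norm (v k x - g x))\<^sup>2) \<partial>M) < top"
      using k by (rule less_trans) simp
  qed
  from square_integrable_diff[OF assms(1)[of k] this] show ?thesis by simp
qed

lemma integrable_inner_square_integrable:
  assumes "square_integrable M f" "square_integrable M g"
  shows "integrable M (\<lambda>x. f x \<bullet> g x)"
proof (rule Bochner_Integration.integrable_bound)
  show "integrable M (\<lambda>x. (norm (f x))\<^sup>2 + (norm (g x))\<^sup>2)"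
    using assms by (auto simp: square_integrable_def)
  show "(\<lambda>x. f x \<bullet> g x) \<in> borel_measurable M"
    using assms by (auto simp: square_integrable_def intro!: borel_measurable_inner)
  show "AE x in M. norm (f x \<bullet> g x) \<le> norm ((norm (f x))\<^sup>2 + (norm (g x))\<^sup>2)"
  proof (rule AE_I2)
    fix x
    have "2 * (norm (f x) * norm (g x)) \<le> (norm (f x))\<^sup>2 + (norm (g x))\<^sup>2"
      using sum_squares_bound[of "norm (f x)" "norm (g x)"] by simp
    moreover have "0 \<le> norm (f x) * norm (g x)" by simp
    ultimately show "norm (f x \<bullet> g x) \<le> norm ((norm (f x))\<^sup>2 + (norm (g x))\<^sup>2)"
      using Cauchy_Schwarz_ineq2[of "f x" "g x"] by simp
  qed
qed

lemma Cauchy_Schwarz_integral: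
  assumes f: "square_integrable M f" and g: "square_integrable M g"
  shows "(\<integral>x. f x \<bullet> g x \<partial>M)\<^sup>2 \<le> (\<integral>x. (norm (f x))\<^sup>2 \<partial>M) * (\<integral>x. (norm (g x))\<^sup>2 \<partial>M)"
proof -
  define A B C where "A = (\<integral>x. (norm (f x))\<^sup>2 \<partial>M)" and "B = (\<integral>x. f x \<bullet> g x \<partial>M)"
    and "C = (\<integral>x. (norm (g x))\<^sup>2 \<partial>M)"
  have i: "integrable M (\<lambda>x. (norm (f x))\<^sup>2)" "integrable M (\<lambda>x. (norm (g x))\<^sup>2)"
    using f g by (auto simp: square_integrable_def)
  have "0 \<le> A * t\<^sup>2 + 2 * B * t + C" for t
  proof -
    have "0 \<le> (\<integral>x. (norm (t *\<^sub>R f x + g x))\<^sup>2 \<partial>M)" by simp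
    also have "(\<lambda>x. (norm (t *\<^sub>R f x + g x))\<^sup>2) =
        (\<lambda>x. (t * t) * (norm (f x))\<^sup>2 + 2 * t * (f x \<bullet> g x) + (norm (g x))\<^sup>2)"
      by (simp add: fun_eq_iff power2_norm_eq_inner inner_add_left inner_add_right
          inner_commute algebra_simps)
    also have "(\<integral>x. (t * t) * (norm (f x))\<^sup>2 + 2 * t * (f x \<bullet> g x) + (norm (g x))\<^sup>2 \<partial>M) =
        (t * t) * A + 2 * t * B + C"
      using i integrable_inner_square_integrable[OF f g]
      by (simp add: A_def B_def C_def)
    finally show ?thesis by (simp add: power2_eq_square mult_ac)
  qed
  note q = this
  have "A \<ge> 0" "C \<ge> 0" by (simp_all add: A_def C_def)
  have "B\<^sup>2 \<le> A * C"
  proof (cases "A = 0")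
    case True
    have "B = 0"
    proof (rule ccontr)
      assume "B \<noteq> 0"
      \<comment> \<open>With \<open>A = 0\<close> the polynomial is \<open>2 * B * t + C\<close>;
        this \<open>t\<close> gives it the value -1.\<close>
      then show False
        using q[of "- (C + 1) / (2 * B)"] True by (simp add: field_simps)
    qed
    then show ?thesis using True by simp
  next
    case False
    then have A: "A > 0" using \<open>A \<ge> 0\<close> by simp
    have "0 \<le> A * (A * (- B / A)\<^sup>2 + 2 * B * (- B / A) + C)"
      using A by (intro mult_nonneg_nonneg q) simp
    also have "\<dots> = A * C - B\<^sup>2"
      using A by (simp add: field_simps power2_eq_square)
    finally show ?thesis by simp
  qed
  then show ?thesis by (simp add: A_def B_def C_def)
qed

lemma integral_inner_tendsto:
  assumes f: "square_integrable M f" and v: "\<And>k. square_integrable M (v k)"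
    and g: "square_integrable M g"
    and lim: "(\<lambda>k. \<integral>\<^sup>+x. ennreal ((norm (v k x - g x))\<^sup>2) \<partial>M) \<longlonglongrightarrow> 0"
  shows "(\<lambda>k. \<integral>x. f x \<bullet> v k x \<partial>M) \<longlonglongrightarrow> (\<integral>x. f x \<bullet> g x \<partial>M)"
proof -
  define A where "A = (\<integral>x. (norm (f x))\<^sup>2 \<partial>M)"
  define I where "I k = (\<integral>x. (norm (v k x - g x))\<^sup>2 \<partial>M)" for k
  have d: "square_integrable M (\<lambda>x. v k x - g x)" for k
    using v g by (intro square_integrable_diff)
  have "(\<integral>\<^sup>+x. ennreal ((norm (v k x - g x))\<^sup>2) \<partial>M) = ennreal (I k)" for k
    using d[of k] unfolding I_def square_integrable_def by (intro nn_integral_eq_integral) auto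
  with lim have "(\<lambda>k. ennreal (I k)) \<longlonglongrightarrow> ennreal 0" by simp
  then have "I \<longlonglongrightarrow> 0"
    by (subst (asm) tendsto_ennreal_iff) (auto simp: I_def)
  then have "(\<lambda>k. sqrt (A * I k)) \<longlonglongrightarrow> sqrt (A * 0)"
    by (intro tendsto_intros)
  then have 0: "(\<lambda>k. sqrt (A * I k)) \<longlonglongrightarrow> 0" by simp
  have "(\<lambda>k. (\<integral>x. f x \<bullet> v k x \<partial>M) - (\<integral>x. f x \<bullet> g x \<partial>M)) \<longlonglongrightarrow> 0"
  proof (rule Lim_null_comparison[OF _ 0], rule always_eventually, rule allI)
    fix k
    have "(\<integral>x. f x \<bullet> v k x \<partial>M) - (\<integral>x. f x \<bullet> g x \<partial>M) = (\<integral>x. f x \<bullet> (v k x - g x) \<partial>M)"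
      using integrable_inner_square_integrable[OF f v[of k]] integrable_inner_square_integrable[OF f g]
      by (simp add: inner_diff_right)
    moreover have "\<bar>\<integral>x. f x \<bullet> (v k x - g x) \<partial>M\<bar> \<le> sqrt (A * I k)"
      using Cauchy_Schwarz_integral[OF f d[of k]] unfolding A_def I_def
      by (metis real_sqrt_abs real_sqrt_le_iff)
    ultimately show "norm ((\<integral>x. f x \<bullet> v k x \<partial>M) - (\<integral>x. f x \<bullet> g x \<partial>M)) \<le> sqrt (A * I k)"
      by simp
  qed
  then show ?thesis by (simp add: LIM_zero_iff)
qed


subsection \<open>Green's formula in the energy space\<close>

text \<open>Local integrability speaks of compact subsets only; a countable cover by closed boxes
  assembles measurability on all of \<open>S\<close>.\<close>

lemma locally_integrable_on_measurable:
  fixes G :: "'a::euclidean_space \<Rightarrow> 'b::euclidean_space"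
  assumes S: "open S" and G: "locally_integrable_on S G"
  shows "G \<in> borel_measurable (lebesgue_on S)"
proof -
  obtain \<D> where \<D>: "countable \<D>" "\<D> \<subseteq> Pow S" "\<And>X. X \<in> \<D> \<Longrightarrow> \<exists>a b. X = cbox a b" "\<Union>\<D> = S"
    using open_countable_Union_open_cbox[OF S] by metis
  show ?thesis
  proof (rule measurable_piecewise_restrict[OF \<D>(1)])
    fix X assume X: "X \<in> \<D>"
    then obtain a b where ab: "X = cbox a b" using \<D>(3) by blast
    have XS: "X \<subseteq> S" using X \<D>(2) by blast
    have "X \<in> sets lebesgue" "S \<in> sets lebesgue" using ab S by auto
    then show "X \<inter> space (lebesgue_on S) \<in> sets (lebesgue_on S)"
      using XS by (auto simp: sets_restrict_space_iff Int_absorb2)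
    have "restrict_space (lebesgue_on S) X = lebesgue_on X"
      using XS by (simp add: restrict_restrict_space Int_absorb1 \<open>X \<in> sets lebesgue\<close> \<open>S \<in> sets lebesgue\<close>)
    moreover have "integrable (lebesgue_on X) G"
      using G XS ab by (simp add: locally_integrable_on_def)
    then have "G \<in> borel_measurable (lebesgue_on X)" by simp
    ultimately show "G \<in> borel_measurable (restrict_space (lebesgue_on S) X)" by simp
  qed (use \<D>(4) in auto)
qed

text \<open>The chosen weak gradient is controlled only off the sphere, while energies are integrals
  over the closed exterior. The sphere is null and Lebesgue measure complete, so arbitrary values
  there do no harm.\<close>

lemma borel_measurable_lebesgue_on_exterior:
  fixes G :: "'a::euclidean_space \<Rightarrow> 'b::euclidean_space"
  assumes "G \<in> borel_measurable (lebesgue_on (- cball 0 1))"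
  shows "G \<in> borel_measurable (lebesgue_on exterior)"
proof -
  have null: "G \<in> borel_measurable (lebesgue_on (sphere 0 1))"
  proof (rule measurableI)
    fix A :: "'b set"
    have "negligible (G -` A \<inter> sphere 0 1)"
      by (rule negligible_subset[OF negligible_sphere]) auto
    then have "G -` A \<inter> sphere 0 1 \<in> sets lebesgue"
      by (simp add: negligible_iff_null_sets null_sets_def)
    then show "G -` A \<inter> space (lebesgue_on (sphere 0 1)) \<in> sets (lebesgue_on (sphere 0 1))"
      by (auto simp: sets_restrict_space_iff)
  qed simp
  show ?thesis
  proof (rule measurable_piecewise_restrict[of "{- cball 0 1, sphere 0 1}"])
    fix X assume X: "X \<in> {- cball (0::'a) 1, sphere 0 1}"
    then have s: "X \<subseteq> exterior" "X \<in> sets lebesgue" by auto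
    then show "X \<inter> space (lebesgue_on exterior) \<in> sets (lebesgue_on exterior)"
      by (auto simp: sets_restrict_space_iff Int_absorb2)
    have "restrict_space (lebesgue_on exterior) X = lebesgue_on X"
      using s by (simp add: restrict_restrict_space Int_absorb1)
    then show "G \<in> borel_measurable (restrict_space (lebesgue_on exterior) X)"
      using X assms null by auto
  qed auto
qed

lemma AE_exteriorI:
  "(AE x in lebesgue_on (- cball (0::'a::euclidean_space) 1). P x) \<Longrightarrow> (AE x in lebesgue_on exterior. P x)"
proof -
  assume "AE x in lebesgue_on (- cball (0::'a) 1). P x"
  then have "AE x in lebesgue. x \<in> - cball (0::'a) 1 \<longrightarrow> P x"
    by (subst (asm) AE_restrict_space_iff) auto
  then have "AE x in lebesgue. x \<in> exterior \<longrightarrow> P x"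
    using AE_not_in_sphere by eventually_elim auto
  then show "AE x in lebesgue_on exterior. P x"
    by (subst AE_restrict_space_iff) auto
qed

lemma ext_gradient_measurable:
  assumes "has_weak_gradient (- cball (0::'a::euclidean_space) 1) u G"
  shows "ext_gradient u \<in> borel_measurable (lebesgue_on exterior)"
proof -
  have "locally_integrable_on (- cball (0::'a) 1) (ext_gradient u)"
    using has_weak_gradient_weak_gradient[OF assms] by (simp add: has_weak_gradient_def)
  then show ?thesis
    by (intro borel_measurable_lebesgue_on_exterior locally_integrable_on_measurable) auto
qed

lemma square_integrable_gradient_test_function:
  assumes "v \<in> test_functions UNIV"
  shows "square_integrable (lebesgue_on exterior) (gradient v)"
proof -
  obtain K where K: "smooth_on UNIV v" "compact K" "\<And>x. x \<notin> K \<Longrightarrow> gradient v x = 0"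
    using assms by (rule test_functionsE) blast
  have c: "continuous_on UNIV (gradient v)" using K(1) by (rule smooth_on_continuous_gradient)
  have "integrable lebesgue (\<lambda>x. (norm (gradient v x))\<^sup>2)"
    by (rule integrable_continuous_compact_support[OF _ K(2)])
       (auto intro!: continuous_on_power continuous_on_norm c simp: K(3))
  then have "integrable lebesgue (\<lambda>x. indicator exterior x *\<^sub>R (norm (gradient v x))\<^sup>2)"
    by (intro integrable_mult_indicator) auto
  then have "integrable (lebesgue_on exterior) (\<lambda>x. (norm (gradient v x))\<^sup>2)"
    by (subst integrable_restrict_space) auto
  then show ?thesis
    using borel_measurable_lebesgue_on_continuous[OF c] by (simp add: square_integrable_def)
qed

lemma square_integrable_sphere_measure_continuous:
  assumes "continuous_on UNIV f"
  shows "square_integrable sphere_measure f"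
  unfolding square_integrable_def
  using assms by (intro conjI borel_measurable_sphere_measure_continuous
      integrable_sphere_measure_continuous continuous_on_power continuous_on_norm)

lemma square_integrable_gradient_dipole:
  fixes a :: "'a::euclidean_space"
  assumes "DIM('a) \<ge> 2"
  shows "square_integrable (lebesgue_on exterior) (gradient (dipole a))"
proof -
  let ?C = "\<bar>- (1 / (real DIM('a) - 1))\<bar> * (1 + real DIM('a)) * norm a"
  have c: "continuous_on UNIV (gradient (dipole a))"
    using smooth_dipole by (rule smooth_on_continuous_gradient)
  have "integrable (lebesgue_on exterior) (\<lambda>x. (norm (gradient (dipole a) x))\<^sup>2)"
  proof (rule Bochner_Integration.integrable_bound)
    show "integrable (lebesgue_on exterior) (\<lambda>x::'a. ?C\<^sup>2 * (x \<bullet> x) powr (- real DIM('a)))"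
      using integrable_inner_self_powr[OF assms] by simp
    show "(\<lambda>x. (norm (gradient (dipole a) x))\<^sup>2) \<in> borel_measurable (lebesgue_on exterior)"
      by (intro borel_measurable_lebesgue_on_continuous continuous_on_power continuous_on_norm c)
    show "AE x in lebesgue_on exterior. norm ((norm (gradient (dipole a) x))\<^sup>2) \<le>
        norm (?C\<^sup>2 * (x \<bullet> x) powr (- real DIM('a)))"
    proof (rule AE_I2)
      fix x :: 'a assume "x \<in> space (lebesgue_on exterior)"
      then have "norm x \<ge> 1" by simp
      then have "(norm (gradient (dipole a) x))\<^sup>2 \<le> (?C * (x \<bullet> x) powr (- (real DIM('a) / 2)))\<^sup>2"
        by (intro power_mono norm_gradient_dipole_le) auto
      also have "\<dots> = ?C\<^sup>2 * (x \<bullet> x) powr (- real DIM('a))"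
        by (simp add: power_mult_distrib power2_eq_square powr_add[symmetric])
      finally show "norm ((norm (gradient (dipole a) x))\<^sup>2) \<le> norm (?C\<^sup>2 * (x \<bullet> x) powr (- real DIM('a)))"
        by simp
    qed
  qed
  then show ?thesis
    using borel_measurable_lebesgue_on_continuous[OF c] by (simp add: square_integrable_def)
qed

text \<open>Both sides of \<open>green_dipole\<close> are inner products in \<open>L2\<close>, hence
  continuous along an approximating sequence. Keeping \<open>T\<close> arbitrary lets the formula be
  used for \<open>sphere_trace u\<close> as well as for an explicitly known trace.\<close>

lemma D12_trace_green:
  fixes a :: "'a::euclidean_space"
  assumes N: "DIM('a) \<ge> 2" and u: "has_weak_gradient (- cball 0 1) u G" and T: "D12_trace u T"
  shows "square_integrable (lebesgue_on exterior) (ext_gradient u)"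
    and "(\<integral>x. gradient (dipole a) x \<bullet> ext_gradient u x \<partial>lebesgue_on exterior) =
      (\<integral>y. (a \<bullet> sphere_normal y) * T y \<partial>sphere_measure)"
proof -
  let ?M = "lebesgue_on (exterior :: 'a set)"
  obtain v where v: "\<And>k. v k \<in> test_functions UNIV"
    and lim1: "(\<lambda>k. \<integral>\<^sup>+x. ennreal ((norm (gradient (v k) x - ext_gradient u x))\<^sup>2) \<partial>?M) \<longlonglongrightarrow> 0"
    and lim2: "(\<lambda>k. \<integral>\<^sup>+x. ennreal ((v k x - T x)\<^sup>2) \<partial>sphere_measure) \<longlonglongrightarrow> 0"
    and Tm: "T \<in> borel_measurable sphere_measure"
    using T by (auto simp: D12_trace_def D12_approx_def)
  have lim2': "(\<lambda>k. \<integral>\<^sup>+x. ennreal ((norm (v k x - T x))\<^sup>2) \<partial>sphere_measure) \<longlonglongrightarrow> 0"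
    using lim2 by simp
  have g2: "square_integrable ?M (gradient (v k))" for k
    using v by (rule square_integrable_gradient_test_function)
  have v2: "square_integrable sphere_measure (v k)" for k
    using v by (intro square_integrable_sphere_measure_continuous smooth_on_continuous)
      (simp add: test_functions_def)
  show u2: "square_integrable ?M (ext_gradient u)"
    by (rule square_integrable_limit[OF g2 ext_gradient_measurable[OF u] lim1])
  have T2: "square_integrable sphere_measure T"
    by (rule square_integrable_limit[OF v2 Tm lim2'])
  have f2: "square_integrable sphere_measure (\<lambda>y. a \<bullet> sphere_normal y)"
    unfolding sphere_normal_def
    by (intro square_integrable_sphere_measure_continuous continuous_intros)
  have "(\<lambda>k. \<integral>x. gradient (dipole a) x \<bullet> gradient (v k) x \<partial>?M) \<longlonglongrightarrow>
      (\<integral>x. gradient (dipole a) x \<bullet> ext_gradient u x \<partial>?M)"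
    by (rule integral_inner_tendsto[OF square_integrable_gradient_dipole[OF N] g2 u2 lim1])
  moreover have "(\<lambda>k. \<integral>y. (a \<bullet> sphere_normal y) \<bullet> v k y \<partial>sphere_measure) \<longlonglongrightarrow>
      (\<integral>y. (a \<bullet> sphere_normal y) \<bullet> T y \<partial>sphere_measure)"
    by (rule integral_inner_tendsto[OF f2 v2 T2 lim2'])
  ultimately show "(\<integral>x. gradient (dipole a) x \<bullet> ext_gradient u x \<partial>?M) =
      (\<integral>y. (a \<bullet> sphere_normal y) * T y \<partial>sphere_measure)"
    by (simp add: green_dipole[OF N v] LIMSEQ_unique)
qed

subsection \<open>The explicit solution is the minimiser\<close>

text \<open>Written in \<open>x \<bullet> x\<close> to be smooth at the origin. With
  \<open>Suc k\<close> the radius is at least 1, so every member of the sequence is 1 on the closed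
  unit ball and leaves boundary values alone.\<close>

definition far_cutoff :: "nat \<Rightarrow> 'a::euclidean_space \<Rightarrow> real" where
  "far_cutoff k x = 1 - step ((x \<bullet> x) / (real (Suc k))\<^sup>2 - 1)"

lemma smooth_far_cutoff: "smooth_on UNIV (far_cutoff k :: 'a::euclidean_space \<Rightarrow> real)"
proof -
  have "smooth_on UNIV (\<lambda>x::'a. (x \<bullet> x) * inverse ((real (Suc k))\<^sup>2) - 1)"
    by (rule smooth_on_diff[OF _ smooth_on_mult[OF _ smooth_on_inner_self smooth_on_const] smooth_on_const])
       simp_all
  then have "smooth_on UNIV (\<lambda>x::'a. (x \<bullet> x) / (real (Suc k))\<^sup>2 - 1)"
    by (simp only: divide_inverse)
  then have "smooth_on UNIV (\<lambda>x::'a. step ((x \<bullet> x) / (real (Suc k))\<^sup>2 - 1))"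
    by (intro smooth_on_compose[OF _ _ _ smooth_step, where f = "\<lambda>x. (x \<bullet> x) / (real (Suc k))\<^sup>2 - 1"]) simp_all
  then have "smooth_on UNIV (\<lambda>x::'a. 1 - step ((x \<bullet> x) / (real (Suc k))\<^sup>2 - 1))"
    by (intro smooth_on_diff[OF _ smooth_on_const]) simp_all
  then show ?thesis by (simp only: far_cutoff_def[abs_def])
qed

lemma far_cutoff_eq_1: "x \<bullet> x \<le> (real (Suc k))\<^sup>2 \<Longrightarrow> far_cutoff k x = 1"
  by (simp add: far_cutoff_def step_eq_0 divide_le_eq_1)

lemma far_cutoff_eq_0:
  assumes "norm x \<ge> 2 * real (Suc k)" shows "far_cutoff k x = 0"
proof -
  have "(2 * real (Suc k))\<^sup>2 \<le> (norm x)\<^sup>2"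
    using assms by (intro power_mono) auto
  then have "4 * (real (Suc k))\<^sup>2 \<le> x \<bullet> x"
    unfolding power_mult_distrib power2_norm_eq_inner by simp
  then have "4 \<le> (x \<bullet> x) / (real (Suc k))\<^sup>2"
    by (subst le_divide_eq) auto
  then show ?thesis by (simp add: far_cutoff_def step_eq_1)
qed

lemma far_cutoff_bounds: "0 \<le> far_cutoff k x" "far_cutoff k x \<le> 1"
  using step_nonneg step_le_1 by (simp_all add: far_cutoff_def)

lemma far_cutoff_mult_test_function:
  assumes "smooth_on UNIV u"
  shows "(\<lambda>x. far_cutoff k x * u x) \<in> test_functions (UNIV :: 'a::euclidean_space set)"
proof (rule test_functionsI)
  show "smooth_on UNIV (\<lambda>x. far_cutoff k x * u x)"
    by (intro smooth_on_mult smooth_far_cutoff assms) simp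
  show "far_cutoff k x * u x = 0" if "x \<notin> cball 0 (2 * real (Suc k))" for x
    using that by (simp add: far_cutoff_eq_0)
qed auto

lemma gradient_step_bounded:
  obtains C where "C \<ge> 0" "\<And>t. \<bar>gradient step t\<bar> \<le> C"
proof -
  have c: "continuous_on {0..1} (gradient step)"
    using smooth_on_continuous_gradient[OF smooth_step] by (rule continuous_on_subset) simp
  then have "bounded (gradient step ` {0..1})"
    by (intro compact_imp_bounded compact_continuous_image) auto
  then obtain C where C: "\<And>t. t \<in> {0..1} \<Longrightarrow> \<bar>gradient step t\<bar> \<le> C"
    unfolding bounded_iff by (metis imageI real_norm_def)
  have zero: "gradient step t = 0" if t: "t \<notin> {0..1}" for t
  proof -
    define c :: real where "c = (if t < 0 then 0 else 1)"
    have "gradient step t = gradient (\<lambda>_. c) t"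
    proof (rule gradient_cong_open)
      show "open (if t < 0 then {..<0} else {1<..} :: real set)" by simp
      show "t \<in> (if t < 0 then {..<0} else {1<..})" using t by (auto simp: not_le)
      show "step y = c" if "y \<in> (if t < 0 then {..<0} else {1<..})" for y
        using that by (auto simp: c_def step_eq_0 step_eq_1 split: if_splits)
    qed
    also have "\<dots> = 0" by (rule gradient_eqI) (rule GDERIV_const)
    finally show ?thesis .
  qed
  have "\<bar>gradient step t\<bar> \<le> max 0 C" for t
    using C[of t] zero[of t] by (cases "t \<in> {0..1}") auto
  then show thesis by (intro that[of "max 0 C"]) auto
qed

text \<open>Scaling makes the bound uniform in \<open>k\<close>: with
  \<open>m = real (Suc k)\<close> the product is at most \<open>2 * (norm x)^2 / m^2\<close> times
  the bound for the derivative of \<open>step\<close>, and the gradient vanishes once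
  \<open>norm x > 2 * m\<close>. Hence the factor 8.\<close>

lemma norm_gradient_far_cutoff_le:
  obtains C where "C \<ge> 0"
    "\<And>k (x::'a::euclidean_space). norm x * norm (gradient (far_cutoff k) x) \<le> C"
proof -
  obtain C where C0: "C \<ge> 0" and C: "\<And>t. \<bar>gradient step t\<bar> \<le> C"
    using gradient_step_bounded by blast
  have "norm x * norm (gradient (far_cutoff k) x) \<le> 8 * C" for k and x :: 'a
  proof (cases "norm x > 2 * real (Suc k)")
    case True
    have "gradient (far_cutoff k) x = gradient (\<lambda>_. 0) x"
    proof (rule gradient_cong_open)
      show "open (- cball (0::'a) (2 * real (Suc k)))" by auto
      show "x \<in> - cball 0 (2 * real (Suc k))" using True by simp
      show "far_cutoff k y = 0" if "y \<in> - cball 0 (2 * real (Suc k))" for y :: 'a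
        using that by (intro far_cutoff_eq_0) simp
    qed
    also have "\<dots> = 0" by (rule gradient_eqI) (rule GDERIV_const)
    finally show ?thesis using C0 by simp
  next
    case False
    define m where "m = real (Suc k)"
    have m: "m > 0" by (simp add: m_def)
    let ?t = "(x \<bullet> x) / m\<^sup>2 - 1"
    have "GDERIV step ?t :> gradient step ?t"
      using smooth_on_GDERIV[OF smooth_step] by simp
    then have 1: "(step has_real_derivative gradient step ?t) (at ?t)"
      by simp
    have 2: "GDERIV (\<lambda>x. (x \<bullet> x) / m\<^sup>2 - 1) x :> (2 / m\<^sup>2) *\<^sub>R x"
      unfolding gderiv_def using m
      by (auto intro!: derivative_eq_intros simp: inner_commute field_simps)
    have "GDERIV (\<lambda>x. 1 - step ((x \<bullet> x) / m\<^sup>2 - 1)) x :> 0 - gradient step ?t *\<^sub>R (2 / m\<^sup>2) *\<^sub>R x"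
      by (rule GDERIV_diff[OF GDERIV_const GDERIV_DERIV_compose[OF 2 1]])
    then have "gradient (far_cutoff k) x = - (gradient step ?t *\<^sub>R (2 / m\<^sup>2) *\<^sub>R x)"
      by (intro gradient_eqI) (simp add: far_cutoff_def[abs_def] m_def)
    then have "norm x * norm (gradient (far_cutoff k) x) = \<bar>gradient step ?t\<bar> * (2 * (norm x)\<^sup>2 / m\<^sup>2)"
      by (simp add: power2_eq_square abs_mult)
    also have "\<dots> \<le> C * (2 * (2 * m)\<^sup>2 / m\<^sup>2)"
      using False C C0 by (intro mult_mono divide_right_mono mult_left_mono power_mono) (auto simp: m_def)
    also have "\<dots> = 8 * C" using m by (simp add: power2_eq_square)
    finally show ?thesis .
  qed
  then show thesis using C0 by (intro that[of "8 * C"]) auto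
qed

text \<open>The error consists of the dipole gradient where the cut-off is below 1 and of the dipole
  times the cut-off gradient. Both are of order \<open>|x|^(-N)\<close> uniformly in
  \<open>k\<close>, which provides the majorant for dominated convergence.\<close>

lemma gradient_far_cutoff_dipole_bound:
  fixes a :: "'a::euclidean_space"
  obtains D where "D \<ge> 0" "\<And>k x. norm x \<ge> 1 \<Longrightarrow>
    norm (gradient (\<lambda>x. far_cutoff k x * dipole a x) x - gradient (dipole a) x)
      \<le> D * (x \<bullet> x) powr (- (real DIM('a) / 2))"
proof -
  let ?c = "\<bar>- (1 / (real DIM('a) - 1))\<bar>"
  let ?N = "real DIM('a)"
  obtain C where C0: "C \<ge> 0"
    and C: "\<And>k (x::'a). norm x * norm (gradient (far_cutoff k) x) \<le> C"
    using norm_gradient_far_cutoff_le by blast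
  define D where "D = ?c * (1 + ?N) * norm a + ?c * norm a * C"
  have D0: "D \<ge> 0" unfolding D_def using C0 by (intro add_nonneg_nonneg mult_nonneg_nonneg) auto
  have "norm (gradient (\<lambda>x. far_cutoff k x * dipole a x) x - gradient (dipole a) x)
      \<le> D * (x \<bullet> x) powr (- (?N / 2))" if x: "norm x \<ge> 1" for k and x :: 'a
  proof -
    define P where "P = (x \<bullet> x) powr (- (?N / 2))"
    have P: "P \<ge> 0" by (simp add: P_def)
    have "gradient (\<lambda>x. far_cutoff k x * dipole a x) x - gradient (dipole a) x =
        (far_cutoff k x - 1) *\<^sub>R gradient (dipole a) x + dipole a x *\<^sub>R gradient (far_cutoff k) x"
      unfolding gradient_mult[OF smooth_far_cutoff smooth_dipole] by (simp add: algebra_simps)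
    also have "norm \<dots> \<le> \<bar>far_cutoff k x - 1\<bar> * norm (gradient (dipole a) x) +
        \<bar>dipole a x\<bar> * norm (gradient (far_cutoff k) x)"
      by (rule order_trans[OF norm_triangle_ineq]) simp
    also have "\<dots> \<le> 1 * ((?c * (1 + ?N) * norm a) * P) + ?c * norm a * (norm x * P) * norm (gradient (far_cutoff k) x)"
      using far_cutoff_bounds[of k x] norm_gradient_dipole_le[OF x, of a] abs_dipole_le[OF x, of a]
      unfolding P_def by (intro add_mono mult_mono) auto
    also have "?c * norm a * (norm x * P) * norm (gradient (far_cutoff k) x) =
        (?c * norm a * P) * (norm x * norm (gradient (far_cutoff k) x))"
      by (simp add: mult_ac)
    also have "(?c * norm a * P) * (norm x * norm (gradient (far_cutoff k) x)) \<le> (?c * norm a * P) * C"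
      using C[of x k] P by (intro mult_left_mono mult_nonneg_nonneg) auto
    also have "1 * ((?c * (1 + ?N) * norm a) * P) + (?c * norm a * P) * C = D * P"
      by (simp add: D_def algebra_simps)
    finally show ?thesis by (simp add: P_def)
  qed
  with D0 show thesis by (rule that)
qed

lemma ext_gradient_dipole:
  "AE x in lebesgue_on exterior. ext_gradient (dipole a) x = gradient (dipole a) x"
  by (rule AE_exteriorI[OF weak_gradient_smooth[OF _ smooth_dipole]]) auto

lemma weak_gradient_dipole: "has_weak_gradient (- cball 0 1) (dipole a) (gradient (dipole a))"
  by (rule smooth_has_weak_gradient[OF smooth_dipole]) auto

lemma eventually_le_Suc_power2: "\<forall>\<^sub>F k in sequentially. r < (real (Suc k))\<^sup>2"
proof -
  obtain n where n: "r < real n" using reals_Archimedean2 by blast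
  have "r < (real (Suc k))\<^sup>2" if "k \<ge> n" for k
  proof -
    have "real (Suc k) * 1 \<le> real (Suc k) * real (Suc k)" by (intro mult_left_mono) auto
    then have "real (Suc k) \<le> (real (Suc k))\<^sup>2" by (simp only: power2_eq_square mult_1_right)
    moreover have "real n \<le> real (Suc k)" using that by simp
    ultimately show ?thesis using n by linarith
  qed
  then show ?thesis by (auto simp: eventually_sequentially)
qed

text \<open>On each bounded set the truncations eventually coincide with the dipole, and on the
  sphere they do so for every \<open>k\<close>. Only the gradients over the unbounded exterior call
  for a limit argument.\<close>

lemma D12_approx_dipole:
  fixes a :: "'a::euclidean_space"
  assumes N: "DIM('a) \<ge> 2"
  shows "D12_approx (\<lambda>k x. far_cutoff k x * dipole a x) (dipole a) (dipole a)"
  unfolding D12_approx_def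
proof (intro conjI allI)
  let ?v = "\<lambda>k x. far_cutoff k x * dipole a x"
  let ?M = "lebesgue_on (exterior :: 'a set)"
  show v: "?v k \<in> test_functions UNIV" for k
    by (rule far_cutoff_mult_test_function[OF smooth_dipole])
  have cg: "continuous_on UNIV (gradient (?v k))" for k
    using v[of k] by (intro smooth_on_continuous_gradient) (simp add: test_functions_def)
  have cU: "continuous_on UNIV (gradient (dipole a))"
    using smooth_dipole by (rule smooth_on_continuous_gradient)
  obtain D where D: "D \<ge> 0" "\<And>k x. norm x \<ge> 1 \<Longrightarrow> norm (gradient (?v k) x - gradient (dipole a) x)
      \<le> D * (x \<bullet> x) powr (- (real DIM('a) / 2))"
    using gradient_far_cutoff_dipole_bound[of a] by blast
  define W where "W x = D\<^sup>2 * (x \<bullet> x) powr (- real DIM('a))" for x :: 'a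
  have W: "integrable ?M W"
    unfolding W_def using integrable_inner_self_powr[OF N] by simp
  have "(\<lambda>k. \<integral>\<^sup>+x. ennreal ((norm (gradient (?v k) x - gradient (dipole a) x))\<^sup>2) \<partial>?M) \<longlonglongrightarrow>
      (\<integral>\<^sup>+x. 0 \<partial>?M)"
  proof (rule nn_integral_dominated_convergence)
    show "(\<lambda>x. ennreal ((norm (gradient (?v k) x - gradient (dipole a) x))\<^sup>2)) \<in> borel_measurable ?M" for k
      by (intro measurable_compose[OF _ measurable_ennreal] borel_measurable_lebesgue_on_continuous
          continuous_on_power continuous_on_norm continuous_on_diff cg cU)
    show "(\<lambda>x. ennreal (W x)) \<in> borel_measurable ?M"
      using W by (intro measurable_compose[OF _ measurable_ennreal]) auto
    show "AE x in ?M. ennreal ((norm (gradient (?v k) x - gradient (dipole a) x))\<^sup>2) \<le> ennreal (W x)" for k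
    proof (rule AE_I2)
      fix x :: 'a assume "x \<in> space ?M"
      then have "norm x \<ge> 1" by simp
      then have "(norm (gradient (?v k) x - gradient (dipole a) x))\<^sup>2 \<le> (D * (x \<bullet> x) powr (- (real DIM('a) / 2)))\<^sup>2"
        by (intro power_mono D(2)) auto
      also have "\<dots> = W x"
        by (simp add: W_def power_mult_distrib power2_eq_square powr_add[symmetric])
      finally show "ennreal ((norm (gradient (?v k) x - gradient (dipole a) x))\<^sup>2) \<le> ennreal (W x)"
        by (rule ennreal_leI)
    qed
    show "(\<integral>\<^sup>+x. ennreal (W x) \<partial>?M) < \<infinity>"
      using W by (subst nn_integral_eq_integral) (auto simp: W_def)
    show "AE x in ?M. (\<lambda>k. ennreal ((norm (gradient (?v k) x - gradient (dipole a) x))\<^sup>2)) \<longlonglongrightarrow> 0"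
    proof (rule AE_I2)
      fix x :: 'a
      have "\<forall>\<^sub>F k in sequentially. 0 = ennreal ((norm (gradient (?v k) x - gradient (dipole a) x))\<^sup>2)"
        using eventually_le_Suc_power2[of "x \<bullet> x"]
      proof eventually_elim
        case (elim k)
        have "gradient (?v k) x = gradient (dipole a) x"
        proof (rule gradient_cong_open)
          show "open {y::'a. y \<bullet> y < (real (Suc k))\<^sup>2}"
            by (intro open_Collect_less continuous_intros)
          show "x \<in> {y. y \<bullet> y < (real (Suc k))\<^sup>2}" using elim by simp
          show "?v k y = dipole a y" if "y \<in> {y. y \<bullet> y < (real (Suc k))\<^sup>2}" for y
            using that far_cutoff_eq_1[of y k] by simp
        qed
        then show ?case by simp
      qed
      then show "(\<lambda>k. ennreal ((norm (gradient (?v k) x - gradient (dipole a) x))\<^sup>2)) \<longlonglongrightarrow> 0"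
        by (rule Lim_transform_eventually[OF tendsto_const])
    qed
  qed simp
  moreover have "(\<integral>\<^sup>+x. ennreal ((norm (gradient (?v k) x - gradient (dipole a) x))\<^sup>2) \<partial>?M) =
      (\<integral>\<^sup>+x. ennreal ((norm (gradient (?v k) x - ext_gradient (dipole a) x))\<^sup>2) \<partial>?M)" for k
    by (rule nn_integral_cong_AE) (use ext_gradient_dipole[of a] in eventually_elim, simp)
  ultimately show "(\<lambda>k. \<integral>\<^sup>+x. ennreal ((norm (gradient (?v k) x - ext_gradient (dipole a) x))\<^sup>2) \<partial>?M) \<longlonglongrightarrow> 0"
    by simp
  show "(\<lambda>k. \<integral>\<^sup>+x. ennreal ((?v k x - dipole a x)\<^sup>2) \<partial>lebesgue_on (exterior \<inter> ball 0 R)) \<longlonglongrightarrow> 0" for R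
  proof -
    have "\<forall>\<^sub>F k in sequentially. 0 = (\<integral>\<^sup>+x. ennreal ((?v k x - dipole a x)\<^sup>2) \<partial>lebesgue_on (exterior \<inter> ball 0 R))"
      using eventually_le_Suc_power2[of "R\<^sup>2"]
    proof eventually_elim
      case (elim k)
      have "(\<integral>\<^sup>+x. ennreal ((?v k x - dipole a x)\<^sup>2) \<partial>lebesgue_on (exterior \<inter> ball 0 R)) =
          (\<integral>\<^sup>+x. 0 \<partial>lebesgue_on (exterior \<inter> ball (0::'a) R))"
      proof (rule nn_integral_cong)
        fix x :: 'a assume "x \<in> space (lebesgue_on (exterior \<inter> ball 0 R))"
        then have "norm x \<le> R" by simp
        then have "(norm x)\<^sup>2 \<le> R\<^sup>2" by (intro power_mono) auto
        with elim have "x \<bullet> x \<le> (real (Suc k))\<^sup>2" by (simp add: power2_norm_eq_inner)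
        then show "ennreal ((?v k x - dipole a x)\<^sup>2) = 0" by (simp add: far_cutoff_eq_1)
      qed
      then show ?case by simp
    qed
    then show ?thesis by (rule Lim_transform_eventually[OF tendsto_const])
  qed
  have "(\<integral>\<^sup>+x. ennreal ((?v k x - dipole a x)\<^sup>2) \<partial>sphere_measure) = (\<integral>\<^sup>+x. 0 \<partial>(sphere_measure :: 'a measure))" for k
  proof (rule nn_integral_cong)
    fix x :: 'a assume "x \<in> space sphere_measure"
    then have "x \<bullet> x = 1" by (simp add: space_sphere_measure norm_eq_1)
    then have "far_cutoff k x = 1" by (intro far_cutoff_eq_1) simp
    then show "ennreal ((?v k x - dipole a x)\<^sup>2) = 0" by simp
  qed
  then show "(\<lambda>k. \<integral>\<^sup>+x. ennreal ((?v k x - dipole a x)\<^sup>2) \<partial>sphere_measure) \<longlonglongrightarrow> 0"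
    by simp
qed

lemma D12_trace_dipole:
  assumes "DIM('a::euclidean_space) \<ge> 2"
  shows "D12_trace (dipole (a::'a)) (dipole a)"
  using D12_approx_dipole[OF assms, of a] borel_measurable_sphere_measure_continuous
    smooth_on_continuous[OF smooth_dipole[of a]]
  by (auto simp: D12_trace_def)

lemma dipole_in_D12:
  assumes "DIM('a::euclidean_space) \<ge> 2"
  shows "dipole (a::'a) \<in> D12"
  using D12_trace_dipole[OF assms, of a] weak_gradient_dipole[of a]
    borel_measurable_lebesgue_on_continuous[OF smooth_on_continuous[OF smooth_dipole[of a]]]
  by (auto simp: D12_def)

text \<open>Green's formula rewrites the boundary term as the inner product with the dipole
  gradient, whichever trace was chosen. The energy becomes a quadratic functional of the gradient
  alone, and the square can be completed.\<close>

lemma neumann_energy_eq: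
  fixes a :: "'a::euclidean_space"
  assumes N: "DIM('a) \<ge> 2" and w: "w \<in> D12"
  shows "neumann_energy (\<lambda>y. a \<bullet> sphere_normal y) w =
    neumann_energy (\<lambda>y. a \<bullet> sphere_normal y) (dipole a) +
    1 / 2 * (\<integral>x. (norm (ext_gradient w x - gradient (dipole a) x))\<^sup>2 \<partial>lebesgue_on exterior)"
proof -
  let ?M = "lebesgue_on (exterior :: 'a set)"
  let ?g = "gradient (dipole a)"
  have E: "neumann_energy (\<lambda>y. a \<bullet> sphere_normal y) u =
      1 / 2 * (\<integral>x. (norm (ext_gradient u x))\<^sup>2 \<partial>?M) - (\<integral>x. ?g x \<bullet> ext_gradient u x \<partial>?M)"
    and L: "square_integrable ?M (ext_gradient u)" if "u \<in> D12" for u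
  proof -
    obtain G T where G: "has_weak_gradient (- cball 0 1) u G" and T: "D12_trace u T"
      using \<open>u \<in> D12\<close> by (auto simp: D12_def)
    have "D12_trace u (sphere_trace u)"
      unfolding sphere_trace_def using T by (rule someI[of "D12_trace u"])
    from D12_trace_green[OF N G this]
    show "neumann_energy (\<lambda>y. a \<bullet> sphere_normal y) u =
      1 / 2 * (\<integral>x. (norm (ext_gradient u x))\<^sup>2 \<partial>?M) - (\<integral>x. ?g x \<bullet> ext_gradient u x \<partial>?M)"
      and "square_integrable ?M (ext_gradient u)"
      by (simp_all add: neumann_energy_def)
  qed
  have g2: "square_integrable ?M ?g" by (rule square_integrable_gradient_dipole[OF N])
  have wm: "integrable ?M (\<lambda>x. (norm (ext_gradient w x))\<^sup>2)" and gm: "integrable ?M (\<lambda>x. (norm (?g x))\<^sup>2)"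
    using L[OF w] g2 by (auto simp: square_integrable_def)
  have "(\<integral>x. (norm (ext_gradient w x - ?g x))\<^sup>2 \<partial>?M) =
      (\<integral>x. (norm (ext_gradient w x))\<^sup>2 - 2 * (?g x \<bullet> ext_gradient w x) + (norm (?g x))\<^sup>2 \<partial>?M)"
    by (rule arg_cong[where f = "integral\<^sup>L ?M"])
       (simp add: fun_eq_iff power2_norm_eq_inner inner_diff_left inner_diff_right inner_commute)
  also have "\<dots> = (\<integral>x. (norm (ext_gradient w x))\<^sup>2 \<partial>?M) - 2 * (\<integral>x. ?g x \<bullet> ext_gradient w x \<partial>?M)
      + (\<integral>x. (norm (?g x))\<^sup>2 \<partial>?M)"
    using wm gm integrable_inner_square_integrable[OF g2 L[OF w]] by simp
  finally have 1: "(\<integral>x. (norm (ext_gradient w x - ?g x))\<^sup>2 \<partial>?M) =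
      (\<integral>x. (norm (ext_gradient w x))\<^sup>2 \<partial>?M) - 2 * (\<integral>x. ?g x \<bullet> ext_gradient w x \<partial>?M)
      + (\<integral>x. (norm (?g x))\<^sup>2 \<partial>?M)" .
  have U: "dipole a \<in> D12" by (rule dipole_in_D12[OF N])
  have Um: "integrable ?M (\<lambda>x. (norm (ext_gradient (dipole a) x))\<^sup>2)"
    using L[OF U] by (simp add: square_integrable_def)
  \<comment> \<open>For the dipole itself the quadratic and the linear integral agree, so its energy
    is minus one half of its Dirichlet integral.\<close>
  have "(\<integral>x. (norm (ext_gradient (dipole a) x))\<^sup>2 \<partial>?M) = (\<integral>x. (norm (?g x))\<^sup>2 \<partial>?M)"
  proof (rule integral_cong_AE)
    show "AE x in ?M. (norm (ext_gradient (dipole a) x))\<^sup>2 = (norm (?g x))\<^sup>2"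
      using ext_gradient_dipole[of a] by eventually_elim simp
  qed (rule borel_measurable_integrable[OF Um] borel_measurable_integrable[OF gm])+
  moreover have "(\<integral>x. ?g x \<bullet> ext_gradient (dipole a) x \<partial>?M) = (\<integral>x. (norm (?g x))\<^sup>2 \<partial>?M)"
  proof (rule integral_cong_AE)
    show "AE x in ?M. ?g x \<bullet> ext_gradient (dipole a) x = (norm (?g x))\<^sup>2"
      using ext_gradient_dipole[of a] by eventually_elim (simp add: power2_norm_eq_inner)
  qed (rule borel_measurable_integrable[OF integrable_inner_square_integrable[OF g2 L[OF U]]]
      borel_measurable_integrable[OF gm])+
  ultimately show ?thesis
    unfolding E[OF w] E[OF U] 1 by (simp add: field_simps)
qed

text \<open>The dipole witnesses that a minimiser exists, so the choice in \<open>U_ball\<close>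
  yields one; comparing energies in both directions then leaves no excess.\<close>

theorem ext_gradient_U_ball:
  fixes a :: "'a::euclidean_space"
  assumes N: "DIM('a) \<ge> 2"
  defines "u \<equiv> U_ball (\<lambda>y. a \<bullet> sphere_normal y)"
  shows "AE x in lebesgue_on exterior. ext_gradient u x = gradient (dipole a) x"
    and "ext_gradient u \<in> borel_measurable (lebesgue_on exterior)"
proof -
  let ?M = "lebesgue_on (exterior :: 'a set)"
  let ?E = "neumann_energy (\<lambda>y. a \<bullet> sphere_normal y)"
  have U: "dipole a \<in> D12" by (rule dipole_in_D12[OF N])
  have "?E (dipole a) \<le> ?E w" if "w \<in> D12" for w
    by (subst neumann_energy_eq[OF N that]) simp
  with U have "dipole a \<in> D12 \<and> (\<forall>w\<in>D12. ?E (dipole a) \<le> ?E w)"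
    by blast
  then have u: "u \<in> D12 \<and> (\<forall>w\<in>D12. ?E u \<le> ?E w)"
    unfolding u_def U_ball_def by (rule someI[of "\<lambda>u. u \<in> D12 \<and> (\<forall>w\<in>D12. ?E u \<le> ?E w)"])
  then obtain G T where G: "has_weak_gradient (- cball 0 1) u G" and T: "D12_trace u T"
    by (auto simp: D12_def)
  show m: "ext_gradient u \<in> borel_measurable ?M"
    by (rule ext_gradient_measurable[OF G])
  have "square_integrable ?M (\<lambda>x. ext_gradient u x - gradient (dipole a) x)"
    by (rule square_integrable_diff[OF D12_trace_green(1)[OF N G T] square_integrable_gradient_dipole[OF N]])
  then have i: "integrable ?M (\<lambda>x. (norm (ext_gradient u x - gradient (dipole a) x))\<^sup>2)"
    by (simp add: square_integrable_def)
  have "?E u \<le> ?E (dipole a)" using u U by blast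
  then have "(\<integral>x. (norm (ext_gradient u x - gradient (dipole a) x))\<^sup>2 \<partial>?M) \<le> 0"
    using neumann_energy_eq[OF N conjunct1[OF u], of a] by linarith
  moreover have "0 \<le> (\<integral>x. (norm (ext_gradient u x - gradient (dipole a) x))\<^sup>2 \<partial>?M)"
    by simp
  ultimately have "(\<integral>x. (norm (ext_gradient u x - gradient (dipole a) x))\<^sup>2 \<partial>?M) = 0"
    by linarith
  then have "AE x in ?M. (norm (ext_gradient u x - gradient (dipole a) x))\<^sup>2 = 0"
    using integral_nonneg_eq_0_iff_AE[OF i] by simp
  then show "AE x in ?M. ext_gradient u x = gradient (dipole a) x"
    by eventually_elim simp
qed

text \<open>A consequence of the divergence theorem: the gradient of a truncated linear function
  integrates to zero over the whole space, so the ball contribution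
  \<open>|B| * (a \<bullet> b)\<close> is opposite to the exterior one, which is a surface
  integral.\<close>

lemma sphere_second_moment:
  fixes a b :: "'a::euclidean_space"
  shows "(\<integral>y. (y \<bullet> a) * (y \<bullet> b) \<partial>sphere_measure) = measure lebesgue (ball (0::'a) 1) * (a \<bullet> b)"
proof -
  \<comment> \<open>Index 1 makes the cut-off equal to 1 up to radius 2, so \<open>g\<close> is
    linear on the unit ball and on its boundary.\<close>
  define g where "g x = far_cutoff 1 x * (x \<bullet> a)" for x
  have g: "g \<in> test_functions UNIV"
    unfolding g_def by (rule far_cutoff_mult_test_function[OF smooth_on_inner]) simp
  obtain K where K: "smooth_on UNIV g" "compact K" "\<And>x. x \<notin> K \<Longrightarrow> gradient g x = 0"
    using g by (rule test_functionsE) blast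
  have g_eq: "g x = x \<bullet> a" if "x \<bullet> x \<le> 4" for x
    using that by (simp add: g_def far_cutoff_eq_1)
  have grad: "gradient g x = a" if x: "x \<in> ball 0 1" for x
  proof (rule gradient_eqI)
    have "x \<bullet> a = g x" if "x \<in> ball 0 1" for x
    proof -
      have "(norm x)\<^sup>2 \<le> 1\<^sup>2" using that by (intro power_mono) auto
      then show ?thesis by (simp add: g_eq power2_norm_eq_inner)
    qed
    then show "GDERIV g x :> a"
      by (rule GDERIV_transform_open[OF GDERIV_inner open_ball x])
  qed
  have int: "integrable lebesgue (\<lambda>x. gradient g x \<bullet> b)"
    by (rule integrable_continuous_compact_support[OF _ K(2)])
       (auto intro!: continuous_on_inner smooth_on_continuous_gradient K(1) continuous_on_const simp: K(3))
  have "0 = (\<integral>x. gradient g x \<bullet> b \<partial>lebesgue)"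
    using integral_gradient_test_function[OF g] by simp
  also have "\<dots> = (\<integral>x. indicator (ball 0 1) x *\<^sub>R (gradient g x \<bullet> b) +
      indicator exterior x *\<^sub>R (gradient g x \<bullet> b) \<partial>lebesgue)"
    by (rule Bochner_Integration.integral_cong) (auto simp: indicator_def)
  also have "\<dots> = (\<integral>x. indicator (ball 0 1) x *\<^sub>R (gradient g x \<bullet> b) \<partial>lebesgue) +
      (\<integral>x. indicator exterior x *\<^sub>R (gradient g x \<bullet> b) \<partial>lebesgue)"
    using int by (intro Bochner_Integration.integral_add integrable_mult_indicator) auto
  also have "(\<integral>x. indicator exterior x *\<^sub>R (gradient g x \<bullet> b) \<partial>lebesgue) =
      (\<integral>x. gradient g x \<bullet> b \<partial>lebesgue_on exterior)"
    by (rule integral_restrict_space[symmetric]) auto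
  also have "\<dots> = - (\<integral>y. g y * (y \<bullet> b) \<partial>sphere_measure)"
    by (rule exterior_divergence[OF g])
  also have "(\<integral>y. g y * (y \<bullet> b) \<partial>sphere_measure) = (\<integral>y. (y \<bullet> a) * (y \<bullet> b) \<partial>sphere_measure)"
    by (rule Bochner_Integration.integral_cong) (auto simp: space_sphere_measure norm_eq_1 g_eq)
  also have "(\<integral>x. indicator (ball 0 1) x *\<^sub>R (gradient g x \<bullet> b) \<partial>lebesgue) =
      (\<integral>x. indicator (ball (0::'a) 1) x * (a \<bullet> b) \<partial>lebesgue)"
    by (rule Bochner_Integration.integral_cong) (auto simp: indicator_def grad)
  also have "\<dots> = measure lebesgue (ball (0::'a) 1) * (a \<bullet> b)"
    by simp
  finally show ?thesis by simp
qed

theorem exterior_energy: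
  fixes a b :: "'a::euclidean_space"
  assumes N: "DIM('a) \<ge> 2"
  shows "(\<integral>x. ext_gradient (U_ball (\<lambda>y. a \<bullet> sphere_normal y)) x
      \<bullet> ext_gradient (U_ball (\<lambda>y. b \<bullet> sphere_normal y)) x \<partial>lebesgue_on exterior) =
    measure lebesgue (ball (0::'a) 1) * (a \<bullet> b) / (real DIM('a) - 1)"
proof -
  let ?M = "lebesgue_on (exterior :: 'a set)"
  have gm: "gradient (dipole a) \<in> borel_measurable ?M"
    using square_integrable_gradient_dipole[OF N, of a] by (simp add: square_integrable_def)
  have em: "ext_gradient (dipole b) \<in> borel_measurable ?M"
    by (rule ext_gradient_measurable[OF weak_gradient_dipole])
  \<comment> \<open>The first gradient is made classical and the second kept weak: this is the shape
    of Green's formula with \<open>dipole b\<close> as the element of the energy space.\<close>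
  have "(\<integral>x. ext_gradient (U_ball (\<lambda>y. a \<bullet> sphere_normal y)) x
      \<bullet> ext_gradient (U_ball (\<lambda>y. b \<bullet> sphere_normal y)) x \<partial>?M) =
      (\<integral>x. gradient (dipole a) x \<bullet> ext_gradient (dipole b) x \<partial>?M)"
  proof (rule integral_cong_AE)
    show "AE x in ?M. ext_gradient (U_ball (\<lambda>y. a \<bullet> sphere_normal y)) x
        \<bullet> ext_gradient (U_ball (\<lambda>y. b \<bullet> sphere_normal y)) x = gradient (dipole a) x \<bullet> ext_gradient (dipole b) x"
      using ext_gradient_U_ball(1)[OF N, of a] ext_gradient_U_ball(1)[OF N, of b] ext_gradient_dipole[of b]
      by eventually_elim simp
  qed (rule borel_measurable_inner ext_gradient_U_ball(2)[OF N] gm em)+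
  also have "\<dots> = (\<integral>y. (a \<bullet> sphere_normal y) * dipole b y \<partial>sphere_measure)"
    by (rule D12_trace_green(2)[OF N weak_gradient_dipole D12_trace_dipole[OF N]])
  also have "\<dots> = (\<integral>y. 1 / (real DIM('a) - 1) * ((y \<bullet> a) * (y \<bullet> b)) \<partial>sphere_measure)"
  proof (rule Bochner_Integration.integral_cong[OF refl])
    fix y :: 'a assume "y \<in> space sphere_measure"
    then have "y \<bullet> y = 1" by (simp add: space_sphere_measure norm_eq_1)
    then show "(a \<bullet> sphere_normal y) * dipole b y = 1 / (real DIM('a) - 1) * ((y \<bullet> a) * (y \<bullet> b))"
      by (simp add: dipole_eq sphere_normal_def inner_commute)
  qed
  also have "\<dots> = measure lebesgue (ball (0::'a) 1) * (a \<bullet> b) / (real DIM('a) - 1)"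
    by (simp add: sphere_second_moment)
  finally show ?thesis .
qed

theorem proposition1p5:
  fixes \<Omega> :: "'a::euclidean_space set" and x\<^sub>0 :: 'a and lam :: real
    and \<phi> \<psi> :: "'a \<Rightarrow> real"
  assumes "DIM('a) \<ge> 3"
    and "open \<Omega>" and "bounded \<Omega>" and "connected \<Omega>" and "lipschitz_set \<Omega>"
    and "x\<^sub>0 \<in> \<Omega>"
    and "neumann_eigenvalue \<Omega> lam"
    and "\<phi> \<in> neumann_eigenspace \<Omega> lam" and "\<psi> \<in> neumann_eigenspace \<Omega> lam"
  shows "L_form lam x\<^sub>0 \<phi> \<psi> =
    measure lebesgue (ball (0::'a) 1) *
      (real DIM('a) / (real DIM('a) - 1) * (gradient \<phi> x\<^sub>0 \<bullet> gradient \<psi> x\<^sub>0)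
        - (lam - 1) * \<phi> x\<^sub>0 * \<psi> x\<^sub>0)"
proof -
  have "DIM('a) \<ge> 2" "real DIM('a) - 1 \<noteq> 0"
    using assms(1) by linarith+
  \<comment> \<open>\<open>N / (N - 1) = 1 + 1 / (N - 1)\<close>: the volume term of
    \<open>L_form\<close> supplies the 1 and the exterior energy the fraction.\<close>
  then show ?thesis
    by (simp add: L_form_def exterior_energy field_simps)
qed

end
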